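(* Let $m\leq n$. The index of the non-harmonic biharmonic map $\phi:\mathbb{S}^m(\tfrac1{\sqrt2})\to\mathbb{S}^{n+1}$ obtained from the totally geodesic inclusion $\mathbb{S}^m(\tfrac1{\sqrt2})\to\mathbb{S}^n(\tfrac1{\sqrt2})$, by composing it with the tropical inclusion $\mathbf{i}:\mathbb{S}^n(\tfrac1{\sqrt2})\to\mathbb{S}^{n+1}$, is $1$. In particular, the inclusion map $\mathbf{i}:\mathbb{S}^n(\tfrac1{\sqrt2})\to\mathbb{S}^{n+1}$ has index $1$.
   Context: $\mathbb{S}^k(r)\subset\mathbb{R}^{k+1}$ is the sphere of radius $r$ with the induced metric, $\mathbb{S}^k=\mathbb{S}^k(1)$. The tropical inclusion $\mathbf{i}$ is the inclusion of $\mathbb{S}^n(\tfrac1{\sqrt2})\cong\mathbb{S}^n(\tfrac1{\sqrt2})\times\{\tfrac1{\sqrt2}\}$ in $\mathbb{S}^{n+1}$, $x\mapsto(x,\tfrac1{\sqrt2})$. Write $M$ for the domain of $\phi$. A biharmonic map is a critical point of $E^2(\phi)=\tfrac12\int_M|\tau(\phi)|^2v_g$, where $\tau(\phi)=\mathrm{trace}\nabla d\phi$. $\Delta^\phi=-\mathrm{trace}_g(\nabla^\phi\nabla^\phi-\nabla^\phi_\nabla)$ is the Laplacian on sections of $\phi^{-1}T\mathbb{S}^{n+1}$. The second variation operator of $E^2$ at $\phi$, on sections $V$ of $\phi^{-1}T\mathbb{S}^{n+1}$, is (writing $dV=\nabla^\phi V$, $d\tau(\phi)=\nabla^\phi\tau(\phi)$,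 traces taken over $M$) \begin{align*}I(V)&=\Delta^\phi(\Delta^\phi V)+\Delta^\phi\left(\mathrm{trace}\langle V,d\phi\cdot\rangle d\phi\cdot-|d\phi|^2V\right)+2\langle d\tau(\phi),d\phi\rangle V+|\tau(\phi)|^2V\\&-2\,\mathrm{trace}\langle V,d\tau(\phi)\cdot\rangle d\phi\cdot-2\,\mathrm{trace}\langle\tau(\phi),dV\cdot\rangle d\phi\cdot-\langle\tau(\phi),V\rangle\tau(\phi)+\mathrm{trace}\langle d\phi\cdot,\Delta^\phi V\rangle d\phi\cdot\\&+\mathrm{trace}\langle d\phi\cdot,\mathrm{trace}\langle V,d\phi\cdot\rangle d\phi\cdot\rangle d\phi\cdot-2|d\phi|^2\,\mathrm{trace}\langle d\phi\cdot,V\rangle d\phi\cdot+2\langle dV,d\phi\rangle\tau(\phi)-|d\phi|^2\Delta^\phi V+|d\phi|^4V,\end{align*} and $(I(V),W)=\int_M\langle I(V),W\rangle v_g$. The index of $\phi$ is the largest dimension of a vector space of smooth sections $V$ of $\phi^{-1}T\mathbb{S}^{n+1}$ on which $(I(V),V)<0$ for all $V\neq0$. *)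

theory Defs
  imports "HOL-Analysis.Analysis" "HOL-Library.Function_Algebras" "HOL-Library.Extended_Nat"
begin

text \<open>
  Throughout, the domain is \<open>M = sphere 0 r\<close>, \<open>r > 0\<close>, in a Euclidean space \<open>'a\<close> (of dimension
  \<open>DIM('a) - 1\<close>), and the target is the unit sphere in a Euclidean space \<open>'c\<close>, both with the
  induced metric.  Maps defined on \<open>M\<close>, and sections along them, are represented by functions on all
  of \<open>'a\<close>, of which only the values on \<open>M\<close> matter.
\<close>


subsection \<open>Smooth maps\<close>

primrec Ck_on :: "nat \<Rightarrow> ('a::euclidean_space \<Rightarrow> 'c::euclidean_space) \<Rightarrow> 'a set \<Rightarrow> bool" where
  "Ck_on 0 f U \<longleftrightarrow> continuous_on U f"
| "Ck_on (Suc k) f U \<longleftrightarrow>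
     (\<forall>x\<in>U. f differentiable at x) \<and> (\<forall>v. Ck_on k (\<lambda>x. frechet_derivative f (at x) v) U)"

text \<open>Smoothness on an arbitrary (usually not open) set, such as an embedded submanifold.\<close>

definition smooth_on :: "'a::euclidean_space set \<Rightarrow> ('a \<Rightarrow> 'c::euclidean_space) \<Rightarrow> bool" where
  "smooth_on S f \<longleftrightarrow>
     (\<exists>U g. open U \<and> S \<subseteq> U \<and> (\<forall>k. Ck_on k g U) \<and> (\<forall>x\<in>S. g x = f x))"


subsection \<open>Calculus on spheres\<close>

text \<open>The tangent space at \<open>x\<close> of the sphere centred at \<open>0\<close> through \<open>x\<close>, and the orthogonal
  projection onto it.\<close>

definition tangent :: "'a::euclidean_space \<Rightarrow> 'a set" where
  "tangent x = {v. inner x v = 0}"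

definition tproj :: "'a::euclidean_space \<Rightarrow> 'a \<Rightarrow> 'a" where
  "tproj x v = v - (inner x v / inner x x) *\<^sub>R x"

text \<open>For \<open>x\<close> on the sphere the derivative within the sphere is determined only on \<open>tangent x\<close>; it is
  only applied to tangent vectors below.  It does not depend on the values of \<open>f\<close> off the sphere.\<close>

definition sderiv :: "real \<Rightarrow> ('a::euclidean_space \<Rightarrow> 'c::euclidean_space) \<Rightarrow> 'a \<Rightarrow> 'a \<Rightarrow> 'c" where
  "sderiv r f x v = frechet_derivative f (at x within sphere 0 r) v"

text \<open>The Levi-Civita connection of \<open>M\<close>, \<open>(\<nabla>\<^sub>v Y)(x)\<close>, for a tangent vector field \<open>Y\<close> on \<open>M\<close>.\<close>

definition levi_civita :: "real \<Rightarrow> ('a::euclidean_space \<Rightarrow> 'a) \<Rightarrow> 'a \<Rightarrow> 'a \<Rightarrow> 'a" where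
  "levi_civita r Y x v = tproj x (sderiv r Y x v)"

text \<open>The connection on the pull-back of the tangent bundle of the unit sphere by \<open>\<phi>\<close>,
  \<open>(\<nabla>\<^sup>\<phi>\<^sub>v V)(x)\<close>.\<close>

definition pb_conn ::
  "real \<Rightarrow> ('a::euclidean_space \<Rightarrow> 'c::euclidean_space) \<Rightarrow> ('a \<Rightarrow> 'c) \<Rightarrow> 'a \<Rightarrow> 'a \<Rightarrow> 'c" where
  "pb_conn r \<phi> V x v = tproj (\<phi> x) (sderiv r V x v)"

text \<open>Traces over the tangent space of \<open>M\<close>, with respect to some orthonormal basis.\<close>

definition onb :: "'a::euclidean_space \<Rightarrow> 'a set" where
  "onb x = (SOME B. pairwise orthogonal B \<and> (\<forall>e\<in>B. norm e = 1) \<and> span B = tangent x)"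

definition tr :: "'a::euclidean_space \<Rightarrow> ('a \<Rightarrow> 'b::comm_monoid_add) \<Rightarrow> 'b" where
  "tr x F = (\<Sum>e\<in>onb x. F e)"

text \<open>The second covariant derivative
  \<open>\<nabla>\<^sup>\<phi>\<^sub>u \<nabla>\<^sup>\<phi>\<^sub>Y V - \<nabla>\<^sup>\<phi>\<^bsub>\<nabla>\<^sub>u Y\<^esub> V\<close> and the second fundamental form
  \<open>(\<nabla>d\<phi>)(u,v) = \<nabla>\<^sup>\<phi>\<^sub>u (d\<phi>(Y)) - d\<phi>(\<nabla>\<^sub>u Y)\<close>, at \<open>x\<close>, are tensorial in \<open>Y\<close>; the vector field
  extending \<open>v = Y x\<close> is chosen to be \<open>Y y = tproj y v\<close>.\<close>

definition cov2 ::
  "real \<Rightarrow> ('a::euclidean_space \<Rightarrow> 'c::euclidean_space) \<Rightarrow> ('a \<Rightarrow> 'c) \<Rightarrow> 'a \<Rightarrow> 'a \<Rightarrow> 'a \<Rightarrow> 'c" where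
  "cov2 r \<phi> V x u v =
     pb_conn r \<phi> (\<lambda>y. pb_conn r \<phi> V y (tproj y v)) x u
     - pb_conn r \<phi> V x (levi_civita r (\<lambda>y. tproj y v) x u)"

definition second_ff ::
  "real \<Rightarrow> ('a::euclidean_space \<Rightarrow> 'c::euclidean_space) \<Rightarrow> 'a \<Rightarrow> 'a \<Rightarrow> 'a \<Rightarrow> 'c" where
  "second_ff r \<phi> x u v =
     pb_conn r \<phi> (\<lambda>y. sderiv r \<phi> y (tproj y v)) x u
     - sderiv r \<phi> x (levi_civita r (\<lambda>y. tproj y v) x u)"

definition laplacian ::
  "real \<Rightarrow> ('a::euclidean_space \<Rightarrow> 'c::euclidean_space) \<Rightarrow> ('a \<Rightarrow> 'c) \<Rightarrow> 'a \<Rightarrow> 'c" where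
  "laplacian r \<phi> V x = - tr x (\<lambda>e. cov2 r \<phi> V x e e)"

definition tension ::
  "real \<Rightarrow> ('a::euclidean_space \<Rightarrow> 'c::euclidean_space) \<Rightarrow> 'a \<Rightarrow> 'c" where
  "tension r \<phi> x = tr x (\<lambda>e. second_ff r \<phi> x e e)"

text \<open>The Riemannian measure of \<open>sphere 0 r\<close>.  By polar coordinates, the Lebesgue measure of the cone
  \<open>{x. 0 < norm x < r, (r / norm x) x \<in> E}\<close> is \<open>r / DIM('a)\<close> times the area of \<open>E\<close>.\<close>

definition sphere_measure :: "real \<Rightarrow> 'a::euclidean_space measure" where
  "sphere_measure r =
     scale_measure (ennreal (real DIM('a) / r))
       (distr (restrict_space lborel (ball 0 r - {0})) (restrict_space borel (sphere 0 r))
          (\<lambda>x. (r / norm x) *\<^sub>R x))"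


subsection \<open>Harmonic and biharmonic maps\<close>

definition bienergy :: "real \<Rightarrow> ('a::euclidean_space \<Rightarrow> 'c::euclidean_space) \<Rightarrow> real" where
  "bienergy r \<phi> = 1/2 * (LINT x|sphere_measure r. (norm (tension r \<phi> x))\<^sup>2)"

definition sphere_map :: "real \<Rightarrow> ('a::euclidean_space \<Rightarrow> 'c::euclidean_space) \<Rightarrow> bool" where
  "sphere_map r \<phi> \<longleftrightarrow> smooth_on (sphere 0 r) \<phi> \<and> \<phi> ` sphere 0 r \<subseteq> sphere 0 1"

definition harmonic :: "real \<Rightarrow> ('a::euclidean_space \<Rightarrow> 'c::euclidean_space) \<Rightarrow> bool" where
  "harmonic r \<phi> \<longleftrightarrow> sphere_map r \<phi> \<and> (\<forall>x\<in>sphere 0 r. tension r \<phi> x = 0)"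

text \<open>Critical points of the bienergy with respect to smooth variations through maps into the
  unit sphere.\<close>

definition biharmonic :: "real \<Rightarrow> ('a::euclidean_space \<Rightarrow> 'c::euclidean_space) \<Rightarrow> bool" where
  "biharmonic r \<phi> \<longleftrightarrow> sphere_map r \<phi> \<and>
     (\<forall>\<epsilon> (\<Phi> :: real \<Rightarrow> 'a \<Rightarrow> 'c).
        0 < \<epsilon> \<and> smooth_on ({-\<epsilon><..<\<epsilon>} \<times> sphere 0 r) (\<lambda>(t, x). \<Phi> t x) \<and>
        (\<forall>t\<in>{-\<epsilon><..<\<epsilon>}. \<Phi> t ` sphere 0 r \<subseteq> sphere 0 1) \<and>
        (\<forall>x\<in>sphere 0 r. \<Phi> 0 x = \<phi> x) \<longrightarrow>
        ((\<lambda>t. bienergy r (\<Phi> t)) has_real_derivative 0) (at 0))"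


subsection \<open>Second variation and index\<close>

definition energy_density ::
  "real \<Rightarrow> ('a::euclidean_space \<Rightarrow> 'c::euclidean_space) \<Rightarrow> 'a \<Rightarrow> real" where
  "energy_density r \<phi> x = tr x (\<lambda>e. (norm (sderiv r \<phi> x e))\<^sup>2)"
  \<comment> \<open>\<open>|d\<phi>|\<^sup>2\<close>, without the factor \<open>1/2\<close>\<close>

text \<open>\<open>trace \<langle>V, d\<phi>\<cdot>\<rangle> d\<phi>\<cdot>\<close> and \<open>\<langle>dV, d\<phi>\<rangle>\<close>.\<close>

definition tr_along ::
  "real \<Rightarrow> ('a::euclidean_space \<Rightarrow> 'c::euclidean_space) \<Rightarrow> ('a \<Rightarrow> 'c) \<Rightarrow> 'a \<Rightarrow> 'c" where
  "tr_along r \<phi> V x = tr x (\<lambda>e. inner (V x) (sderiv r \<phi> x e) *\<^sub>R sderiv r \<phi> x e)"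

definition dinner ::
  "real \<Rightarrow> ('a::euclidean_space \<Rightarrow> 'c::euclidean_space) \<Rightarrow> ('a \<Rightarrow> 'c) \<Rightarrow> 'a \<Rightarrow> real" where
  "dinner r \<phi> V x = tr x (\<lambda>e. inner (pb_conn r \<phi> V x e) (sderiv r \<phi> x e))"

definition second_variation ::
  "real \<Rightarrow> ('a::euclidean_space \<Rightarrow> 'c::euclidean_space) \<Rightarrow> ('a \<Rightarrow> 'c) \<Rightarrow> 'a \<Rightarrow> 'c" where
  "second_variation r \<phi> V x =
     laplacian r \<phi> (laplacian r \<phi> V) x
     + laplacian r \<phi> (\<lambda>y. tr_along r \<phi> V y - energy_density r \<phi> y *\<^sub>R V y) x
     + (2 * dinner r \<phi> (tension r \<phi>) x) *\<^sub>R V x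
     + (norm (tension r \<phi> x))\<^sup>2 *\<^sub>R V x
     - 2 *\<^sub>R tr x (\<lambda>e. inner (V x) (pb_conn r \<phi> (tension r \<phi>) x e) *\<^sub>R sderiv r \<phi> x e)
     - 2 *\<^sub>R tr x (\<lambda>e. inner (tension r \<phi> x) (pb_conn r \<phi> V x e) *\<^sub>R sderiv r \<phi> x e)
     - inner (tension r \<phi> x) (V x) *\<^sub>R tension r \<phi> x
     + tr_along r \<phi> (laplacian r \<phi> V) x
     + tr_along r \<phi> (tr_along r \<phi> V) x
     - (2 * energy_density r \<phi> x) *\<^sub>R tr_along r \<phi> V x
     + (2 * dinner r \<phi> V x) *\<^sub>R tension r \<phi> x
     - energy_density r \<phi> x *\<^sub>R laplacian r \<phi> V x
     + (energy_density r \<phi> x)\<^sup>2 *\<^sub>R V x"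

definition hessian_form ::
  "real \<Rightarrow> ('a::euclidean_space \<Rightarrow> 'c::euclidean_space) \<Rightarrow> ('a \<Rightarrow> 'c) \<Rightarrow> ('a \<Rightarrow> 'c) \<Rightarrow> real" where
  "hessian_form r \<phi> V W =
     (LINT x|sphere_measure r. inner (second_variation r \<phi> V x) (W x))"

instantiation "fun" :: (type, real_vector) real_vector
begin

definition scaleR_fun :: "real \<Rightarrow> ('a \<Rightarrow> 'b) \<Rightarrow> 'a \<Rightarrow> 'b" where
  "scaleR_fun c f = (\<lambda>x. c *\<^sub>R f x)"

instance
  by standard (simp_all add: scaleR_fun_def fun_eq_iff scaleR_add_right scaleR_add_left)

end

text \<open>Sections are normalised to vanish off the sphere, so that they are determined by their
  values on it and form a subspace of the space of all functions.\<close>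

definition sections ::
  "real \<Rightarrow> ('a::euclidean_space \<Rightarrow> 'c::euclidean_space) \<Rightarrow> ('a \<Rightarrow> 'c) set" where
  "sections r \<phi> = {V. smooth_on (sphere 0 r) V \<and> (\<forall>x\<in>sphere 0 r. V x \<in> tangent (\<phi> x)) \<and>
                      (\<forall>x. x \<notin> sphere 0 r \<longrightarrow> V x = 0)}"

text \<open>It suffices to consider finite-dimensional spaces: if some infinite-dimensional one is
  negative, the supremum is \<open>\<infinity>\<close>.\<close>

definition index :: "real \<Rightarrow> ('a::euclidean_space \<Rightarrow> 'c::euclidean_space) \<Rightarrow> enat" where
  "index r \<phi> = Sup {enat (dim W) | W.
     subspace W \<and> (\<exists>B. finite B \<and> W = span B) \<and> W \<subseteq> sections r \<phi> \<and>
     (\<forall>V\<in>W. V \<noteq> 0 \<longrightarrow> hessian_form r \<phi> V V < 0)}"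


subsection \<open>The tropical inclusion\<close>

text \<open>\<open>'b \<times> real\<close> carries the Euclidean inner product, so for \<open>DIM('b) = n + 1\<close> it is
  \<open>(n+2)\<close>-dimensional Euclidean space.\<close>

definition tropical :: "'b::euclidean_space \<Rightarrow> 'b \<times> real" where
  "tropical x = (x, 1 / sqrt 2)"

end

theory Submission
  imports Defs
begin

text \<open>
  Write \<open>\<Delta>\<close> for the nonnegative Laplacian of \<open>M\<close> acting on components, \<open>V = (V\<^sub>1, V\<^sub>2)\<close> for a
  section along \<open>\<phi>\<close>, \<open>w\<close> for the orthogonal projection of \<open>V\<^sub>1\<close> to the linear span of \<open>M\<close>, and
  \<open>\<eta> = (L x, -1/\<surd>2)\<close> for the unit normal of the tropical sphere.  Integration by parts turns the
  second variation into
  \<open>(I V, V) = (\<Delta> (\<Delta> - 2 m) V, V) - 4 \<parallel>div w\<parallel>\<^sup>2\<close>.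
  On \<open>V = \<eta>\<close> this is \<open>- 4 m\<^sup>2 vol M\<close>.  On the other hand it is nonnegative if
  \<open>f = \<langle>\<eta>, V\<rangle> = 2 \<langle>x, w\<rangle>\<close> has mean zero, so that no negative subspace has dimension \<open>2\<close>.  To see
  this, expand in spherical harmonics.  For harmonic \<open>g\<close> of degree \<open>j\<close> the ambient field
  \<open>2 (j + m - 1) g x - \<nabla>g\<close> has harmonic components of degree \<open>j + 1\<close>, and its product with \<open>w\<close>
  integrates to the product of \<open>div w + (j - 1) f\<close> with \<open>g\<close>.  Hence the degree \<open>j\<close> part of \<open>div w\<close>
  is controlled by the degree \<open>j + 1\<close> part of \<open>w\<close> and the degree \<open>j\<close> part of \<open>f\<close>, and the
  eigenvalues \<open>2 j (j + m - 1)\<close> of \<open>\<Delta>\<close> are large enough for the inequality to hold degree by degree.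
\<close>


subsection \<open>Smooth functions on a set\<close>

text \<open>The argument is extrinsic: sections are vector-valued functions, and every trace and
  covariant derivative is rewritten through the coordinate derivatives \<open>sD r b\<close>, so
  that chosen frames disappear. The measure is given only as a push-forward from a cone, hence
  integration by parts has to come from rotation invariance.

  The obstacle in the inequality is that the form of \<Delta> (\<Delta> - 2 m) vanishes in degrees 0
  and 1, whereas a coordinate times g, like the gradient of g, mixes degrees j - 1 and j + 1. Three
  features of the pairing meet this. The ambient field has no part of degree j - 1, so degree 1 of
  div w is never compared with the uncontrolled constants in w. The multiple (j - 1) f disappears
  for j = 1, exactly where f is uncontrolled. Degree 0 of div w is m times the mean of f. The same
  degeneracy makes \<eta> the negative direction: its components have degrees 0 and 1, so only the
  divergence term survives on it.\<close>

lemma Ck_on_SucI: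
  assumes "\<And>x. x \<in> U \<Longrightarrow> (f has_derivative f' x) (at x)"
    and "\<And>v. Ck_on k (\<lambda>x. frechet_derivative f (at x) v) U"
  shows "Ck_on (Suc k) f U"
  using assms by (auto simp: differentiable_def)

lemma Ck_on_SucD:
  assumes "Ck_on (Suc k) f U"
  shows "x \<in> U \<Longrightarrow> (f has_derivative frechet_derivative f (at x)) (at x)"
    and "Ck_on k (\<lambda>x. frechet_derivative f (at x) v) U"
  using assms frechet_derivative_works by auto

lemma frechet_derivative_eqI: "(f has_derivative f') (at x) \<Longrightarrow> frechet_derivative f (at x) = f'"
  using frechet_derivative_at by metis

lemma Ck_on_cong:
  assumes "open U" "\<And>x. x \<in> U \<Longrightarrow> f x = g x" "Ck_on k f U"
  shows "Ck_on k g U"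
  using assms(2,3)
proof (induction k arbitrary: f g)
  case 0
  then show ?case using continuous_on_cong by fastforce
next
  case (Suc k)
  have d: "(g has_derivative frechet_derivative f (at x)) (at x)" if "x \<in> U" for x
    using Suc.prems that assms(1)
    by (intro has_derivative_transform_within_open[OF Ck_on_SucD(1)[OF Suc.prems(2)], of x U]) auto
  show ?case
  proof (rule Ck_on_SucI[OF d])
    show "Ck_on k (\<lambda>x. frechet_derivative g (at x) v) U" for v
      by (rule Suc.IH[OF _ Ck_on_SucD(2)[OF Suc.prems(2)]])
        (simp add: frechet_derivative_eqI[OF d])
  qed
qed

text \<open>\<open>frechet_derivative\<close> is a choice operator. Uniqueness of derivatives on an
  open set lets an explicit \<open>f'\<close>, as the derivative rules deliver it, take its place in
  inductions on \<open>k\<close>.\<close>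

lemma Ck_on_SucI':
  assumes "open U" "\<And>x. x \<in> U \<Longrightarrow> (f has_derivative f' x) (at x)"
    and "\<And>v. Ck_on k (\<lambda>x. f' x v) U"
  shows "Ck_on (Suc k) f U"
proof (rule Ck_on_SucI[OF assms(2)])
  show "Ck_on k (\<lambda>x. frechet_derivative f (at x) v) U" for v
    by (rule Ck_on_cong[OF assms(1) _ assms(3)]) (simp add: frechet_derivative_eqI[OF assms(2)])
qed

lemma Ck_on_subset: "Ck_on k f U \<Longrightarrow> V \<subseteq> U \<Longrightarrow> Ck_on k f V"
proof (induction k arbitrary: f)
  case 0
  then show ?case using continuous_on_subset by auto
next
  case (Suc k)
  then show ?case by (meson Ck_on.simps(2) subset_eq)
qed

lemma Ck_on_Suc_imp: "Ck_on (Suc k) f U \<Longrightarrow> Ck_on k f U"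
proof (induction k arbitrary: f)
  case 0
  then have "f differentiable_on U"
    by (simp add: differentiable_at_withinI differentiable_on_def)
  then show ?case using differentiable_imp_continuous_on by auto
next
  case (Suc k)
  then show ?case by (metis Ck_on.simps(2))
qed

lemma Ck_on_const: "Ck_on k (\<lambda>x. c) U"
proof (induction k arbitrary: c)
  case (Suc k)
  show ?case by (rule Ck_on_SucI[OF has_derivative_const]) (simp add: frechet_derivative_const Suc)
qed auto

lemma Ck_on_bounded_linear:
  assumes "bounded_linear h" "open U" "Ck_on k f U"
  shows "Ck_on k (\<lambda>x. h (f x)) U"
  using assms(3)
proof (induction k arbitrary: f)
  case 0
  then show ?case using assms(1) by (auto intro: bounded_linear.continuous_on)
next
  case (Suc k)
  show ?case
    by (rule Ck_on_SucI'[OF assms(2) bounded_linear.has_derivative[OF assms(1) Ck_on_SucD(1)[OF Suc.prems]]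
          Suc.IH[OF Ck_on_SucD(2)[OF Suc.prems]]])
qed

lemma Ck_on_linear:
  fixes h :: "'a::euclidean_space \<Rightarrow> 'c::euclidean_space"
  assumes "bounded_linear h"
  shows "Ck_on k h U"
proof (cases k)
  case 0
  then show ?thesis using assms by (simp add: linear_continuous_on)
next
  case (Suc n)
  have d: "(h has_derivative h) (at x)" for x
    using assms by (rule bounded_linear_imp_has_derivative)
  show ?thesis
    unfolding Suc by (rule Ck_on_SucI[OF d]) (simp add: frechet_derivative_eqI[OF d] Ck_on_const)
qed

lemma Ck_on_add:
  assumes "open U" "Ck_on k p U" "Ck_on k q U"
  shows "Ck_on k (\<lambda>x. p x + q x) U"
  using assms(2,3)
proof (induction k arbitrary: p q)
  case (Suc k)
  show ?case
    by (rule Ck_on_SucI'[OF assms(1) has_derivative_add[OF Ck_on_SucD(1)[OF Suc.prems(1)]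
            Ck_on_SucD(1)[OF Suc.prems(2)]]])
       (auto intro!: Suc.IH Ck_on_SucD(2) Suc.prems simp del: Ck_on.simps)
qed (auto intro: continuous_on_add)

lemma Ck_on_bounded_bilinear:
  assumes "bounded_bilinear h" "open U" "Ck_on k f U" "Ck_on k g U"
  shows "Ck_on k (\<lambda>x. h (f x) (g x)) U"
  using assms(3,4)
proof (induction k arbitrary: f g)
  case 0
  then show ?case using assms(1) by (auto intro: bounded_bilinear.continuous_on)
next
  case (Suc k)
  show ?case
    by (rule Ck_on_SucI'[OF assms(2) bounded_bilinear.FDERIV[OF assms(1)
            Ck_on_SucD(1)[OF Suc.prems(1)] Ck_on_SucD(1)[OF Suc.prems(2)]]])
      (assumption | intro Ck_on_add[OF assms(2)] Suc.IH Ck_on_SucD(2)[OF Suc.prems(1)]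
        Ck_on_SucD(2)[OF Suc.prems(2)] Ck_on_Suc_imp[OF Suc.prems(1)] Ck_on_Suc_imp[OF Suc.prems(2)])+
qed

text \<open>\<open>Ck_on\<close> differentiates in fixed directions only. A moving direction
  \<open>w x\<close> is expanded in \<open>Basis\<close>, which leaves products of smooth
  coefficients with derivatives in fixed directions.\<close>

lemma Ck_on_frechet_derivative:
  assumes "open U" "\<forall>k. Ck_on k g U" "\<forall>k. Ck_on k w U"
  shows "Ck_on k (\<lambda>x. frechet_derivative g (at x) (w x)) U"
proof -
  have g: "\<forall>x\<in>U. g differentiable at x" "Ck_on k (\<lambda>x. frechet_derivative g (at x) v) U" for v k
    using assms(2)[rule_format, of "Suc k"] by auto
  have sum: "Ck_on k (\<lambda>x. \<Sum>b\<in>B. (w x \<bullet> b) *\<^sub>R frechet_derivative g (at x) b) U" if "finite B" for B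
    using that
  proof induction
    case (insert b B)
    have "Ck_on k (\<lambda>x. (w x \<bullet> b) *\<^sub>R frechet_derivative g (at x) b) U"
      using assms g by (intro Ck_on_bounded_bilinear[OF bounded_bilinear_scaleR]
          Ck_on_bounded_linear[OF bounded_linear_inner_left]) auto
    with insert show ?case by (simp add: Ck_on_add[OF assms(1)])
  qed (simp add: Ck_on_const)
  show ?thesis
  proof (rule Ck_on_cong[OF assms(1) _ sum[OF finite_Basis]])
    fix x assume "x \<in> U"
    then interpret linear "frechet_derivative g (at x)"
      using g linear_frechet_derivative by blast
    show "(\<Sum>b\<in>Basis. (w x \<bullet> b) *\<^sub>R frechet_derivative g (at x) b) = frechet_derivative g (at x) (w x)"
      by (simp add: scale[symmetric] sum[symmetric] euclidean_representation)
  qed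
qed


section \<open>Closure properties of smoothness on a set\<close>

lemma smooth_on_cong: "smooth_on S f \<Longrightarrow> (\<And>x. x \<in> S \<Longrightarrow> f x = g x) \<Longrightarrow> smooth_on S g"
  unfolding smooth_on_def by metis

lemma smooth_on_const [simp, intro]: "smooth_on S (\<lambda>x. c)"
  unfolding smooth_on_def using Ck_on_const by (intro exI[of _ UNIV]) auto

lemma smooth_on_linear:
  fixes h :: "'a::euclidean_space \<Rightarrow> 'c::euclidean_space"
  assumes "linear h"
  shows "smooth_on S h"
  unfolding smooth_on_def using Ck_on_linear[of h] assms linear_conv_bounded_linear[of h]
  by (intro exI[of _ UNIV]) auto

lemma smooth_on_compose_linear:
  fixes h :: "'c::euclidean_space \<Rightarrow> 'd::euclidean_space"
  assumes "linear h" "smooth_on S f"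
  shows "smooth_on S (\<lambda>x. h (f x))"
proof -
  from assms(2) obtain U g where "open U" "S \<subseteq> U" "\<forall>k. Ck_on k g U" "\<forall>x\<in>S. g x = f x"
    unfolding smooth_on_def by auto
  then show ?thesis
    unfolding smooth_on_def using Ck_on_bounded_linear[of h U] assms(1) linear_conv_bounded_linear[of h]
    by (intro exI[of _ U] exI[of _ "\<lambda>x. h (g x)"]) auto
qed

lemma smooth_on_bounded_bilinear:
  assumes "bounded_bilinear h" "smooth_on S f" "smooth_on S g"
  shows "smooth_on S (\<lambda>x. h (f x) (g x))"
proof -
  from assms(2) obtain U f' where f: "open U" "S \<subseteq> U" "\<forall>k. Ck_on k f' U" "\<forall>x\<in>S. f' x = f x"
    unfolding smooth_on_def by auto
  from assms(3) obtain V g' where g: "open V" "S \<subseteq> V" "\<forall>k. Ck_on k g' V" "\<forall>x\<in>S. g' x = g x"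
    unfolding smooth_on_def by auto
  have "\<forall>k. Ck_on k (\<lambda>x. h (f' x) (g' x)) (U \<inter> V)"
    using f g by (auto intro!: Ck_on_bounded_bilinear[OF assms(1)] intro: Ck_on_subset)
  then show ?thesis
    unfolding smooth_on_def using f g
    by (intro exI[of _ "U \<inter> V"] exI[of _ "\<lambda>x. h (f' x) (g' x)"]) auto
qed

lemma smooth_on_add [intro]:
  assumes "smooth_on S f" "smooth_on S g"
  shows "smooth_on S (\<lambda>x. f x + g x)"
proof -
  from assms(1) obtain U f' where f: "open U" "S \<subseteq> U" "\<forall>k. Ck_on k f' U" "\<forall>x\<in>S. f' x = f x"
    unfolding smooth_on_def by auto
  from assms(2) obtain V g' where g: "open V" "S \<subseteq> V" "\<forall>k. Ck_on k g' V" "\<forall>x\<in>S. g' x = g x"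
    unfolding smooth_on_def by auto
  have "\<forall>k. Ck_on k (\<lambda>x. f' x + g' x) (U \<inter> V)"
    using f g by (auto intro!: Ck_on_add intro: Ck_on_subset)
  then show ?thesis
    unfolding smooth_on_def using f g
    by (intro exI[of _ "U \<inter> V"] exI[of _ "\<lambda>x. f' x + g' x"]) auto
qed

lemma smooth_on_scaleR [intro]:
  "smooth_on S f \<Longrightarrow> smooth_on S g \<Longrightarrow> smooth_on S (\<lambda>x. f x *\<^sub>R g x)"
  by (rule smooth_on_bounded_bilinear[OF bounded_bilinear_scaleR])

lemma smooth_on_inner [intro]:
  "smooth_on S f \<Longrightarrow> smooth_on S g \<Longrightarrow> smooth_on S (\<lambda>x. f x \<bullet> g x)"
  by (rule smooth_on_bounded_bilinear[OF bounded_bilinear_inner])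

lemma smooth_on_mult [intro]:
  fixes f g :: "'a::euclidean_space \<Rightarrow> real"
  shows "smooth_on S f \<Longrightarrow> smooth_on S g \<Longrightarrow> smooth_on S (\<lambda>x. f x * g x)"
  by (rule smooth_on_bounded_bilinear[OF bounded_bilinear_mult])

lemma smooth_on_minus [intro]: "smooth_on S f \<Longrightarrow> smooth_on S (\<lambda>x. - f x)"
  by (rule smooth_on_compose_linear) (auto intro: linearI)

lemma smooth_on_diff [intro]:
  "smooth_on S f \<Longrightarrow> smooth_on S g \<Longrightarrow> smooth_on S (\<lambda>x. f x - g x)"
  using smooth_on_add[of S f "\<lambda>x. - g x"] smooth_on_minus[of S g] by auto

lemma smooth_on_sum [intro]:
  "(\<And>i. i \<in> I \<Longrightarrow> smooth_on S (f i)) \<Longrightarrow> smooth_on S (\<lambda>x. \<Sum>i\<in>I. f i x)"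
  by (induction I rule: infinite_finite_induct) auto

lemma smooth_on_id [simp, intro]: "smooth_on S (\<lambda>x. x)"
  by (rule smooth_on_linear) (auto intro: linearI)

lemma smooth_on_Pair [intro]:
  assumes "smooth_on S f" "smooth_on S g"
  shows "smooth_on S (\<lambda>x. (f x, g x))"
proof -
  have "smooth_on S (\<lambda>x. (f x, 0) + (0, g x))"
    using assms by (intro smooth_on_add smooth_on_compose_linear[where h = "\<lambda>y. (y, 0)"]
        smooth_on_compose_linear[where h = "\<lambda>y. (0, y)"]) (auto intro: linearI)
  then show ?thesis by simp
qed

lemma smooth_on_imp_continuous_on:
  assumes "smooth_on S f"
  shows "continuous_on S f"
proof -
  from assms obtain U g where "S \<subseteq> U" "\<forall>k. Ck_on k g U" "\<forall>x\<in>S. g x = f x"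
    unfolding smooth_on_def by auto
  moreover from this have "continuous_on U g" using Ck_on.simps(1) by blast
  ultimately show ?thesis by (metis continuous_on_subset continuous_on_cong)
qed


subsection \<open>Differentiation along a sphere\<close>

lemma tproj_in_tangent: "x \<noteq> 0 \<Longrightarrow> tproj x v \<in> tangent x"
  by (simp add: tproj_def tangent_def inner_diff_right)

lemma tproj_tangent: "v \<in> tangent x \<Longrightarrow> tproj x v = v"
  by (simp add: tproj_def tangent_def)

text \<open>The sphere has empty interior, so a derivative within it is undetermined radially.
  Composition with the great circle through \<open>x\<close> in direction \<open>v\<close> reduces
  the tangential values to uniqueness of a derivative on the line.\<close>

lemma has_derivative_sphere_unique:
  fixes f :: "'a::euclidean_space \<Rightarrow> 'c::euclidean_space"
  assumes x: "x \<in> sphere 0 r" and r: "r > 0" and v: "v \<in> tangent x"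
    and f': "(f has_derivative f') (at x within sphere 0 r)"
    and f'': "(f has_derivative f'') (at x within sphere 0 r)"
  shows "f' v = f'' v"
proof (cases "v = 0")
  case True
  then show ?thesis using f' f'' by (simp add: has_derivative_bounded_linear linear_simps(3))
next
  case False
  \<comment> \<open>Length \<open>r\<close> makes \<open>c\<close> a curve on the sphere of radius
    \<open>r\<close>.\<close>
  define w where "w = (r / norm v) *\<^sub>R v"
  have w: "x \<bullet> w = 0" "norm w = r" "v = (norm v / r) *\<^sub>R w"
    using v False r by (auto simp: w_def tangent_def)
  define c where "c t = cos t *\<^sub>R x + sin t *\<^sub>R w" for t :: real
  have "(norm (c t))\<^sup>2 = r\<^sup>2" for t
  proof -
    have "x \<bullet> x = r\<^sup>2" "w \<bullet> w = r\<^sup>2" "w \<bullet> x = 0"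
      using w(1,2) x by (auto simp: dot_square_norm inner_commute)
    then have "(norm (c t))\<^sup>2 = (cos t)\<^sup>2 * r\<^sup>2 + (sin t)\<^sup>2 * r\<^sup>2"
      using w(1) unfolding power2_norm_eq_inner c_def
      by (simp add: inner_simps power2_eq_square)
    then show ?thesis by (simp flip: distrib_right)
  qed
  then have cS: "c ` UNIV \<subseteq> sphere 0 r"
    using r by (auto simp: power2_eq_iff_nonneg)
  have c': "(c has_derivative (\<lambda>s. s *\<^sub>R w)) (at 0)"
    unfolding c_def by (auto intro!: derivative_eq_intros)
  have c0: "c 0 = x" by (simp add: c_def)
  have "((\<lambda>t. f (c t)) has_derivative (\<lambda>s. g (s *\<^sub>R w))) (at 0)"
    if "(f has_derivative g) (at x within sphere 0 r)" for g
    using has_derivative_in_compose[OF c', of f g] has_derivative_subset[OF that, of "range c"] cS c0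
    by auto
  from has_derivative_unique[OF this[OF f'] this[OF f'']]
  have "f' (1 *\<^sub>R w) = f'' (1 *\<^sub>R w)" by metis
  then show ?thesis
    using f' f'' w(3) by (metis has_derivative_bounded_linear linear_simps(5) scaleR_one)
qed

text \<open>This ties the choice inside \<open>sderiv\<close> to ordinary calculus: any
  differentiable ambient extension computes it on tangent vectors.\<close>

lemma sderiv_eq:
  assumes "r > 0" "x \<in> sphere 0 r" "v \<in> tangent x"
    and g: "(g has_derivative g') (at x)" and eq: "\<And>y. y \<in> sphere 0 r \<Longrightarrow> f y = g y"
  shows "sderiv r f x v = g' v"
proof -
  have "(f has_derivative g') (at x within sphere 0 r)"
    using assms(2) eq by (intro has_derivative_transform[OF _ _ has_derivative_at_withinI[OF g]]) auto
  moreover from this have "(f has_derivative frechet_derivative f (at x within sphere 0 r)) (at x within sphere 0 r)"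
    using frechet_derivative_works differentiable_def by blast
  ultimately show ?thesis
    using has_derivative_sphere_unique assms(1-3) unfolding sderiv_def by blast
qed

lemma sderiv_cong:
  assumes "x \<in> sphere 0 r" "\<And>y. y \<in> sphere 0 r \<Longrightarrow> f y = g y"
  shows "sderiv r f x v = sderiv r g x v"
proof -
  have "(f has_derivative f') (at x within sphere 0 r) \<longleftrightarrow> (g has_derivative f') (at x within sphere 0 r)" for f'
    using assms has_derivative_transform[of x "sphere 0 r" f g f']
      has_derivative_transform[of x "sphere 0 r" g f f'] by metis
  then show ?thesis by (simp add: sderiv_def frechet_derivative_def)
qed

lemma smooth_on_sphereE:
  assumes "smooth_on (sphere 0 r) f"
  obtains U g where "open U" "sphere 0 r \<subseteq> U" "\<And>k. Ck_on k g U"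
    "\<And>x. x \<in> sphere 0 r \<Longrightarrow> f x = g x"
    "\<And>x. x \<in> U \<Longrightarrow> (g has_derivative frechet_derivative g (at x)) (at x)"
proof -
  from assms obtain U g where "open U" "sphere 0 r \<subseteq> U" "\<forall>k. Ck_on k g U" "\<forall>x\<in>sphere 0 r. g x = f x"
    unfolding smooth_on_def by blast
  then show ?thesis using that[of U g] Ck_on_SucD(1)[of 0 g U] by metis
qed

lemma sderiv_has_derivative:
  assumes "r > 0" "x \<in> sphere 0 r" "smooth_on (sphere 0 r) f"
  obtains g g' where "(g has_derivative g') (at x)" "\<And>y. y \<in> sphere 0 r \<Longrightarrow> f y = g y"
    "\<And>v. v \<in> tangent x \<Longrightarrow> sderiv r f x v = g' v"
proof -
  obtain U g where g: "sphere 0 r \<subseteq> U" "\<And>x. x \<in> sphere 0 r \<Longrightarrow> f x = g x"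
    "\<And>x. x \<in> U \<Longrightarrow> (g has_derivative frechet_derivative g (at x)) (at x)"
    by (rule smooth_on_sphereE[OF assms(3)]) (rule that)
  have d: "(g has_derivative frechet_derivative g (at x)) (at x)"
    using g assms(2) by auto
  show ?thesis
    by (rule that[OF d]) (auto intro!: g(2) sderiv_eq[OF assms(1,2) _ d])
qed

text \<open>Linearity holds on all vectors, although radial values are arbitrary: the chosen
  derivative is itself a linear map once some derivative exists.\<close>

lemma linear_sderiv:
  assumes "x \<in> sphere 0 r" "smooth_on (sphere 0 r) f"
  shows "linear (sderiv r f x)"
proof -
  obtain U g where g: "sphere 0 r \<subseteq> U" "\<And>x. x \<in> sphere 0 r \<Longrightarrow> f x = g x"
    "\<And>x. x \<in> U \<Longrightarrow> (g has_derivative frechet_derivative g (at x)) (at x)"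
    by (rule smooth_on_sphereE[OF assms(2)]) (rule that)
  have "(f has_derivative frechet_derivative g (at x)) (at x within sphere 0 r)"
    using assms(1) g by (intro has_derivative_transform[OF _ _ has_derivative_at_withinI[OF g(3)]]) auto
  then have "f differentiable (at x within sphere 0 r)" by (auto simp: differentiable_def)
  then show ?thesis
    unfolding sderiv_def[abs_def] eta_contract_eq using linear_frechet_derivative by blast
qed

text \<open>Projecting the direction removes the dependence on the choice in \<open>sderiv\<close>;
  keeping \<open>v\<close> fixed gives a derivation defined all over the sphere, which can be
  iterated.\<close>

definition sD :: "real \<Rightarrow> 'a::euclidean_space \<Rightarrow> ('a \<Rightarrow> 'c::euclidean_space) \<Rightarrow> 'a \<Rightarrow> 'c" where
  "sD r v f x = sderiv r f x (tproj x v)"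

text \<open>Nonnegative sign convention.  No orthonormal frame is needed, since \<open>sD r b\<close> is the
  \<open>b\<close>-component of the tangential gradient.\<close>

definition slap :: "real \<Rightarrow> ('a::euclidean_space \<Rightarrow> 'c::euclidean_space) \<Rightarrow> 'a \<Rightarrow> 'c" where
  "slap r f x = - (\<Sum>b\<in>Basis. sD r b (sD r b f) x)"

text \<open>\<open>m\<close> is the dimension of the sphere, kept real because it enters the
  eigenvalues, and \<open>\<kappa>\<close> is the sectional curvature of the sphere for
  \<open>m\<close> at least 2.\<close>

locale round_sphere =
  fixes S :: "'a::euclidean_space set" and r \<kappa> m :: real
  assumes r_pos: "r > 0" and S_def: "S = sphere 0 r" and \<kappa>_def: "\<kappa> = 1 / r\<^sup>2"
    and m_def: "m = real DIM('a) - 1" and m_ge: "1 \<le> m"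
begin

lemma \<kappa>_pos: "\<kappa> > 0"
  using r_pos by (simp add: \<kappa>_def)

lemma S_inner: "x \<in> S \<Longrightarrow> x \<bullet> x = r\<^sup>2"
  by (simp add: S_def dot_square_norm)

lemma S_inner': "x \<in> S \<Longrightarrow> \<kappa> * (x \<bullet> x) = 1"
  using r_pos by (simp add: S_inner \<kappa>_def)

lemma S_nonzero: "x \<in> S \<Longrightarrow> x \<noteq> 0"
  using r_pos by (auto simp: S_def)

lemma tproj_S: "x \<in> S \<Longrightarrow> tproj x v = v - (\<kappa> * (x \<bullet> v)) *\<^sub>R x"
  by (simp add: tproj_def S_inner \<kappa>_def)

lemma tproj_tangent_S: "x \<in> S \<Longrightarrow> tproj x v \<in> tangent x"
  by (simp add: tproj_in_tangent S_nonzero)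

lemma compact_S: "compact S"
  by (simp add: S_def)

lemma smooth_on_sD [intro]:
  assumes "smooth_on S f"
  shows "smooth_on S (sD r v f)"
proof -
  obtain U g where g: "open U" "S \<subseteq> U" "\<forall>k. Ck_on k g U" "\<forall>x\<in>S. g x = f x"
    using assms unfolding smooth_on_def by auto
  have g': "(g has_derivative frechet_derivative g (at x)) (at x)" if "x \<in> U" for x
    using Ck_on_SucD(1)[of 0 g U x] g(3) that by blast
  have w: "Ck_on k (\<lambda>x. v - (\<kappa> * (x \<bullet> v)) *\<^sub>R x) U" for k
  proof -
    have "Ck_on k (\<lambda>x. v + (x \<bullet> (-\<kappa> *\<^sub>R v)) *\<^sub>R x) U"
      by (rule Ck_on_add[OF g(1) Ck_on_const Ck_on_bounded_bilinear[OF bounded_bilinear_scaleR g(1)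
            Ck_on_linear[OF bounded_linear_inner_left] Ck_on_linear[OF bounded_linear_ident]]])
    then show ?thesis by (simp add: algebra_simps)
  qed
  have "\<forall>k. Ck_on k (\<lambda>x. frechet_derivative g (at x) (v - (\<kappa> * (x \<bullet> v)) *\<^sub>R x)) U"
    using Ck_on_frechet_derivative[OF g(1)] g(3) w by blast
  moreover have "frechet_derivative g (at x) (v - (\<kappa> * (x \<bullet> v)) *\<^sub>R x) = sD r v f x" if "x \<in> S" for x
  proof -
    have x: "x \<in> sphere 0 r" using that S_def by simp
    have "(g has_derivative frechet_derivative g (at x)) (at x)" using g(2) g' that by auto
    from sderiv_eq[OF r_pos x tproj_tangent_S[OF that, of v] this, of f] g(4) S_def that
    show ?thesis by (simp add: sD_def tproj_S)
  qed
  ultimately show ?thesis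
    unfolding smooth_on_def using g(1,2) by (intro exI[of _ U] exI conjI) auto
qed

lemma smooth_on_slap [intro]: "smooth_on S f \<Longrightarrow> smooth_on S (slap r f)"
  unfolding slap_def[abs_def] by (intro smooth_on_minus smooth_on_sum smooth_on_sD)

lemmas smooth_intros = smooth_on_sD smooth_on_slap smooth_on_sum smooth_on_diff smooth_on_minus
  smooth_on_add smooth_on_scaleR smooth_on_inner smooth_on_mult smooth_on_const smooth_on_id

lemma sD_cong: "x \<in> S \<Longrightarrow> (\<And>y. y \<in> S \<Longrightarrow> f y = g y) \<Longrightarrow> sD r v f x = sD r v g x"
  unfolding sD_def S_def by (rule sderiv_cong)

lemma slap_cong: "x \<in> S \<Longrightarrow> (\<And>y. y \<in> S \<Longrightarrow> f y = g y) \<Longrightarrow> slap r f x = slap r g x"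
  unfolding slap_def by (intro arg_cong[of _ _ uminus] sum.cong refl sD_cong) auto

lemma sD_eq:
  assumes "x \<in> S" "(g has_derivative g') (at x)" "\<And>y. y \<in> S \<Longrightarrow> f y = g y"
  shows "sD r v f x = g' (tproj x v)"
  using sderiv_eq[OF r_pos _ tproj_tangent_S[OF assms(1)] assms(2), of f v] assms(1,3)
  by (simp add: sD_def S_def)

lemma sD_has_derivative:
  assumes "x \<in> S" "smooth_on S f"
  obtains g g' where "(g has_derivative g') (at x)" "\<And>y. y \<in> S \<Longrightarrow> f y = g y"
    "\<And>v. sD r v f x = g' (tproj x v)"
proof -
  obtain g g' where "(g has_derivative g') (at x)" "\<And>y. y \<in> sphere 0 r \<Longrightarrow> f y = g y"
    by (rule sderiv_has_derivative[OF r_pos assms[unfolded S_def]]) (rule that)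
  then show ?thesis using that[of g g'] sD_eq[OF assms(1), of g g' f] by (simp add: S_def)
qed

lemma sD_bilinear:
  assumes "bounded_bilinear h" "x \<in> S" "smooth_on S f" "smooth_on S g"
  shows "sD r v (\<lambda>x. h (f x) (g x)) x = h (f x) (sD r v g x) + h (sD r v f x) (g x)"
proof -
  obtain F F' where F: "(F has_derivative F') (at x)" "\<And>y. y \<in> S \<Longrightarrow> f y = F y"
    "\<And>v. sD r v f x = F' (tproj x v)" by (rule sD_has_derivative[OF assms(2,3)]) (rule that)
  obtain G G' where G: "(G has_derivative G') (at x)" "\<And>y. y \<in> S \<Longrightarrow> g y = G y"
    "\<And>v. sD r v g x = G' (tproj x v)" by (rule sD_has_derivative[OF assms(2,4)]) (rule that)
  show ?thesis
    using sD_eq[OF assms(2) bounded_bilinear.FDERIV[OF assms(1) F(1) G(1)], of "\<lambda>x. h (f x) (g x)"]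
      F G assms(2) by simp
qed

lemmas sD_mult = sD_bilinear[OF bounded_bilinear_mult]
lemmas sD_scaleR = sD_bilinear[OF bounded_bilinear_scaleR]
lemmas sD_inner = sD_bilinear[OF bounded_bilinear_inner]

lemma sD_compose_linear:
  fixes h :: "'c::euclidean_space \<Rightarrow> 'd::euclidean_space"
  assumes "linear h" "x \<in> S" "smooth_on S f"
  shows "sD r v (\<lambda>x. h (f x)) x = h (sD r v f x)"
proof -
  obtain F F' where F: "(F has_derivative F') (at x)" "\<And>y. y \<in> S \<Longrightarrow> f y = F y"
    "\<And>v. sD r v f x = F' (tproj x v)" by (rule sD_has_derivative[OF assms(2,3)]) (rule that)
  note bl = iffD1[OF linear_conv_bounded_linear assms(1)]
  show ?thesis
    using sD_eq[OF assms(2) bounded_linear.has_derivative[OF bl F(1)], of "\<lambda>x. h (f x)"] F by simp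
qed

lemma sD_add:
  assumes "x \<in> S" "smooth_on S f" "smooth_on S g"
  shows "sD r v (\<lambda>x. f x + g x) x = sD r v f x + sD r v g x"
proof -
  obtain F F' where F: "(F has_derivative F') (at x)" "\<And>y. y \<in> S \<Longrightarrow> f y = F y"
    "\<And>v. sD r v f x = F' (tproj x v)" by (rule sD_has_derivative[OF assms(1,2)]) (rule that)
  obtain G G' where G: "(G has_derivative G') (at x)" "\<And>y. y \<in> S \<Longrightarrow> g y = G y"
    "\<And>v. sD r v g x = G' (tproj x v)" by (rule sD_has_derivative[OF assms(1,3)]) (rule that)
  show ?thesis
    using sD_eq[OF assms(1) has_derivative_add[OF F(1) G(1)], of "\<lambda>x. f x + g x"] F G by simp
qed

lemma sD_linear:
  fixes h :: "'a::euclidean_space \<Rightarrow> 'd::euclidean_space"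
  assumes "linear h" "x \<in> S"
  shows "sD r v h x = h (v - (\<kappa> * (x \<bullet> v)) *\<^sub>R x)"
  using sD_eq[OF assms(2) bounded_linear_imp_has_derivative[OF iffD1[OF linear_conv_bounded_linear
        assms(1)]], of h v] tproj_S[OF assms(2)] by simp

lemma sD_const [simp]: "x \<in> S \<Longrightarrow> sD r v (\<lambda>x. c) x = 0"
  by (rule sD_eq[OF _ has_derivative_const]) auto

lemma sD_minus: "x \<in> S \<Longrightarrow> smooth_on S f \<Longrightarrow> sD r v (\<lambda>x. - f x) x = - sD r v f x"
  by (rule sD_compose_linear) (auto intro: linearI)

lemma sD_diff:
  assumes "x \<in> S" "smooth_on S f" "smooth_on S g"
  shows "sD r v (\<lambda>x. f x - g x) x = sD r v f x - sD r v g x"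
  using sD_add[OF assms(1,2), of "\<lambda>x. - g x" v] sD_minus[OF assms(1,3), of v] assms(3)
  by (simp add: smooth_on_minus)

lemma sD_cmult: "x \<in> S \<Longrightarrow> smooth_on S f \<Longrightarrow> sD r v (\<lambda>x. c *\<^sub>R f x) x = c *\<^sub>R sD r v f x"
  by (rule sD_compose_linear) (auto intro!: linearI simp: algebra_simps)

lemma sD_sum:
  assumes "x \<in> S" "\<And>i. i \<in> I \<Longrightarrow> smooth_on S (f i)"
  shows "sD r v (\<lambda>x. \<Sum>i\<in>I. f i x) x = (\<Sum>i\<in>I. sD r v (f i) x)"
  using assms(2)
proof (induction I rule: infinite_finite_induct)
  case (insert i I)
  then show ?case using assms(1) sD_add[OF assms(1), of "f i" "\<lambda>x. \<Sum>i\<in>I. f i x" v]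
    by (simp add: smooth_on_sum)
qed (use assms in auto)

lemma linear_sD:
  assumes "x \<in> S" "smooth_on S f"
  shows "linear (\<lambda>v. sD r v f x)"
proof -
  interpret linear "sderiv r f x" using linear_sderiv[of x r f] assms S_def by simp
  show ?thesis
    using assms(1) by (auto intro!: linearI simp: sD_def tproj_S add diff scale algebra_simps)
qed

lemma sD_self:
  assumes "x \<in> S" "smooth_on S f"
  shows "sD r x f x = 0"
proof -
  interpret linear "sderiv r f x" using linear_sderiv[of x r f] assms S_def by simp
  show ?thesis using S_inner'[OF assms(1)] by (simp add: sD_def tproj_S[OF assms(1)] zero)
qed

lemma sD_expand:
  assumes "x \<in> S" "smooth_on S f"
  shows "sD r v f x = (\<Sum>b\<in>Basis. (v \<bullet> b) *\<^sub>R sD r b f x)"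
proof -
  interpret l: linear "\<lambda>v. sD r v f x" using linear_sD[OF assms] .
  have "sD r v f x = sD r (\<Sum>b\<in>Basis. (v \<bullet> b) *\<^sub>R b) f x" by (simp add: euclidean_representation)
  also have "\<dots> = (\<Sum>b\<in>Basis. (v \<bullet> b) *\<^sub>R sD r b f x)" by (simp add: l.sum l.scale)
  finally show ?thesis .
qed

text \<open>The gradient is tangential, so its contraction with the position vector vanishes. This
  discards the radial terms in most later computations.\<close>

lemma sum_coord_sD:
  assumes "x \<in> S" "smooth_on S f"
  shows "(\<Sum>b\<in>Basis. (x \<bullet> b) *\<^sub>R sD r b f x) = 0"
  by (rule trans[OF sD_expand[OF assms, symmetric] sD_self[OF assms]])

lemma sD_coord: "x \<in> S \<Longrightarrow> sD r v (\<lambda>x. x \<bullet> b) x = v \<bullet> b - \<kappa> * (x \<bullet> v) * (x \<bullet> b)"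
  by (subst sD_linear) (auto intro!: linearI simp: algebra_simps)

lemma smooth_on_coord [intro]: "smooth_on S (\<lambda>x. x \<bullet> b)"
  by auto

lemma slap_add:
  assumes "x \<in> S" "smooth_on S f" "smooth_on S g"
  shows "slap r (\<lambda>x. f x + g x) x = slap r f x + slap r g x"
proof -
  have "sD r b (sD r b (\<lambda>x. f x + g x)) x = sD r b (sD r b f) x + sD r b (sD r b g) x" for b
  proof -
    have "sD r b (sD r b (\<lambda>x. f x + g x)) x = sD r b (\<lambda>x. sD r b f x + sD r b g x) x"
      using assms by (intro sD_cong sD_add)
    then show ?thesis using assms by (simp add: sD_add smooth_on_sD)
  qed
  then show ?thesis by (simp add: slap_def sum.distrib)
qed

lemma slap_compose_linear:
  fixes h :: "'c::euclidean_space \<Rightarrow> 'd::euclidean_space"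
  assumes "linear h" "x \<in> S" "smooth_on S f"
  shows "slap r (\<lambda>x. h (f x)) x = h (slap r f x)"
proof -
  have "sD r b (sD r b (\<lambda>x. h (f x))) x = h (sD r b (sD r b f) x)" for b
  proof -
    have "sD r b (sD r b (\<lambda>x. h (f x))) x = sD r b (\<lambda>x. h (sD r b f x)) x"
      using assms by (intro sD_cong sD_compose_linear)
    then show ?thesis using assms by (simp add: sD_compose_linear smooth_on_sD)
  qed
  then show ?thesis using assms(1) by (simp add: slap_def linear_neg linear_sum)
qed

lemma slap_cmult: "x \<in> S \<Longrightarrow> smooth_on S f \<Longrightarrow> slap r (\<lambda>x. c *\<^sub>R f x) x = c *\<^sub>R slap r f x"
  by (rule slap_compose_linear) (auto intro!: linearI simp: algebra_simps)

lemma slap_minus: "x \<in> S \<Longrightarrow> smooth_on S f \<Longrightarrow> slap r (\<lambda>x. - f x) x = - slap r f x"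
  by (rule slap_compose_linear) (auto intro: linearI)

lemma slap_diff:
  assumes "x \<in> S" "smooth_on S f" "smooth_on S g"
  shows "slap r (\<lambda>x. f x - g x) x = slap r f x - slap r g x"
  using slap_add[OF assms(1,2), of "\<lambda>x. - g x"] slap_minus[OF assms(1,3)] assms(3)
  by (simp add: smooth_on_minus)

lemma slap_bilinear:
  assumes "bounded_bilinear h" "x \<in> S" "smooth_on S f" "smooth_on S g"
  shows "slap r (\<lambda>x. h (f x) (g x)) x =
    h (f x) (slap r g x) + h (slap r f x) (g x) - 2 *\<^sub>R (\<Sum>b\<in>Basis. h (sD r b f x) (sD r b g x))"
proof -
  interpret bounded_bilinear h by fact
  have "sD r b (sD r b (\<lambda>x. h (f x) (g x))) x =
      h (f x) (sD r b (sD r b g) x) + h (sD r b (sD r b f) x) (g x)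
      + 2 *\<^sub>R h (sD r b f x) (sD r b g x)" for b
  proof -
    have "sD r b (sD r b (\<lambda>x. h (f x) (g x))) x =
        sD r b (\<lambda>x. h (f x) (sD r b g x) + h (sD r b f x) (g x)) x"
      using sD_bilinear[OF assms(1)] assms by (intro sD_cong) auto
    also have "\<dots> = sD r b (\<lambda>x. h (f x) (sD r b g x)) x + sD r b (\<lambda>x. h (sD r b f x) (g x)) x"
      using assms by (intro sD_add smooth_on_bounded_bilinear[OF assms(1)] smooth_on_sD)
    finally show ?thesis
      using assms by (simp add: sD_bilinear[OF assms(1)] smooth_on_sD scaleR_2)
  qed
  then show ?thesis
    by (simp add: slap_def sum.distrib sum_right sum_left minus_right minus_left sum_distrib_left
        scaleR_sum_right)
qed

lemma slap_const [simp]: "x \<in> S \<Longrightarrow> slap r (\<lambda>x. c) x = 0"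
proof -
  assume x: "x \<in> S"
  have "sD r b (sD r b (\<lambda>x. c)) x = 0" for b
    using sD_cong[OF x, of "sD r b (\<lambda>x. c)" "\<lambda>x. 0" b] x by simp
  then show ?thesis by (simp add: slap_def)
qed

lemma slap_linear:
  fixes h :: "'a \<Rightarrow> 'd::euclidean_space"
  assumes "linear h" "x \<in> S"
  shows "slap r h x = (\<kappa> * m) *\<^sub>R h x"
proof -
  interpret linear h by fact
  have id: "sD r b (sD r b (\<lambda>x. x)) x = - (\<kappa> * (1 - \<kappa> * (x \<bullet> b) * (x \<bullet> b))) *\<^sub>R x
      - (\<kappa> * (x \<bullet> b)) *\<^sub>R (b - (\<kappa> * (x \<bullet> b)) *\<^sub>R x)" if "b \<in> Basis" for b
  proof -
    have "sD r b (sD r b (\<lambda>x. x)) x = sD r b (\<lambda>x. b - (\<kappa> *\<^sub>R (x \<bullet> b)) *\<^sub>R x) x"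
      using assms(2) by (intro sD_cong) (auto simp: sD_linear[OF linear_id[unfolded id_def]])
    also have "\<dots> = - (sD r b (\<lambda>x. (\<kappa> *\<^sub>R (x \<bullet> b)) *\<^sub>R x) x)"
      using assms(2) by (subst sD_diff) (auto intro!: smooth_on_scaleR smooth_on_mult)
    also have "sD r b (\<lambda>x. (\<kappa> *\<^sub>R (x \<bullet> b)) *\<^sub>R x) x = (\<kappa> * (x \<bullet> b)) *\<^sub>R sD r b (\<lambda>x. x) x
        + sD r b (\<lambda>x. \<kappa> *\<^sub>R (x \<bullet> b)) x *\<^sub>R x"
      using assms(2) by (subst sD_scaleR) (auto intro!: smooth_on_mult)
    finally show ?thesis
      using that assms(2) sD_cmult[OF assms(2) smooth_on_coord, of b \<kappa> b]
      by (simp add: sD_coord sD_linear[OF linear_id[unfolded id_def]])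
  qed
  have sq: "(\<Sum>b\<in>Basis. (x \<bullet> b) * (x \<bullet> b)) = x \<bullet> x" by (simp add: euclidean_inner[of x x])
  have "slap r (\<lambda>x. x) x = (\<Sum>b\<in>Basis. (\<kappa> - 2 * \<kappa> * (\<kappa> * ((x \<bullet> b) * (x \<bullet> b)))) *\<^sub>R x + \<kappa> *\<^sub>R (x \<bullet> b) *\<^sub>R b)"
    unfolding slap_def sum_negf[symmetric] by (intro sum.cong refl) (simp add: id algebra_simps scaleR_2 flip: scaleR_2 scaleR_add_left)
  \<comment> \<open>Counting multiples of \<open>\<kappa>\<close>: the dimension, minus 2 since
    \<open>\<kappa> * (x \<bullet> x) = 1\<close>, plus 1 from the expansion of \<open>x\<close> in
    the basis; the total is \<open>m\<close>.\<close>
  also have "\<dots> = (\<kappa> * real DIM('a) - 2 * \<kappa> * (\<kappa> * (x \<bullet> x))) *\<^sub>R x + \<kappa> *\<^sub>R x"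
    by (simp add: sum.distrib scaleR_sum_left[symmetric] scaleR_sum_right[symmetric] sum_subtractf
        sum_distrib_left[symmetric] sq euclidean_representation flip: scaleR_scaleR)
  also have "\<dots> = (\<kappa> * m) *\<^sub>R x"
    unfolding S_inner'[OF assms(2)] scaleR_add_left[symmetric] by (simp add: m_def algebra_simps)
  finally show ?thesis
    using slap_compose_linear[OF assms(1,2), of "\<lambda>x. x"] by (simp add: scale)
qed

end


subsection \<open>Rotation invariance of Lebesgue measure\<close>

lemma nn_integral_lborel_translate:
  fixes f :: "'a::euclidean_space \<Rightarrow> ennreal"
  assumes [measurable]: "f \<in> borel_measurable borel"
  shows "(\<integral>\<^sup>+ x. f (x + c) \<partial>lborel) = (\<integral>\<^sup>+ x. f x \<partial>lborel)"
proof -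
  have "(\<integral>\<^sup>+ x. f x \<partial>lborel) = (\<integral>\<^sup>+ x. f x \<partial>(distr lborel borel ((+) c)))"
    by (simp add: lborel_distr_plus)
  also have "\<dots> = (\<integral>\<^sup>+ x. f (c + x) \<partial>lborel)"
    by (subst nn_integral_distr) auto
  finally show ?thesis by (simp add: add.commute)
qed

text \<open>A shear is averaged over the translations along its own direction; for fixed \<open>x\<close> it becomes a
  translation of the averaging parameter.\<close>

lemma nn_integral_lborel_shear:
  fixes f :: "'a::euclidean_space \<Rightarrow> ennreal" and a b :: 'a
  assumes [measurable]: "f \<in> borel_measurable borel" and ab: "a \<bullet> b = 0"
  shows "(\<integral>\<^sup>+ x. f (x + (s * (x \<bullet> a)) *\<^sub>R b) \<partial>lborel) = (\<integral>\<^sup>+ x. f x \<partial>lborel)"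
proof -
  define w :: "real \<Rightarrow> ennreal" where "w = indicator {0..1}"
  have [measurable]: "w \<in> borel_measurable borel" by (simp add: w_def)
  have w1: "(\<integral>\<^sup>+ t. w (t + c) \<partial>lborel) = 1" for c
    by (subst nn_integral_lborel_translate) (simp_all add: w_def)
  have w1': "(\<integral>\<^sup>+ t. w (t - c) \<partial>lborel) = 1" for c
    using w1[of "- c"] by simp
  have ba: "b \<bullet> a = 0" using ab by (simp add: inner_commute)
  have swap: "(\<integral>\<^sup>+ x. (\<integral>\<^sup>+ t. h x t \<partial>lborel) \<partial>lborel) = (\<integral>\<^sup>+ t. (\<integral>\<^sup>+ x. h x t \<partial>lborel) \<partial>lborel)"
    if "case_prod h \<in> borel_measurable (lborel \<Otimes>\<^sub>M lborel)" for h :: "'a \<Rightarrow> real \<Rightarrow> ennreal"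
    using lborel_pair.Fubini'[OF that] by simp
  have "(\<integral>\<^sup>+ x. f (x + (s * (x \<bullet> a)) *\<^sub>R b) \<partial>lborel)
      = (\<integral>\<^sup>+ x. (\<integral>\<^sup>+ t. f (x + (s * (x \<bullet> a)) *\<^sub>R b) * w t \<partial>lborel) \<partial>lborel)"
    using w1[of 0] by (simp add: nn_integral_cmult)
  also have "\<dots> = (\<integral>\<^sup>+ t. (\<integral>\<^sup>+ x. f (x + (s * (x \<bullet> a)) *\<^sub>R b) * w t \<partial>lborel) \<partial>lborel)"
    by (intro swap) measurable
  also have "\<dots> = (\<integral>\<^sup>+ t. (\<integral>\<^sup>+ x. f ((x + t *\<^sub>R b) + (s * ((x + t *\<^sub>R b) \<bullet> a)) *\<^sub>R b) * w t \<partial>lborel) \<partial>lborel)"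
    by (intro nn_integral_cong nn_integral_lborel_translate[symmetric]) measurable
  also have "\<dots> = (\<integral>\<^sup>+ t. (\<integral>\<^sup>+ x. f (x + (t + s * (x \<bullet> a)) *\<^sub>R b) * w t \<partial>lborel) \<partial>lborel)"
    using ba by (intro nn_integral_cong) (simp add: inner_add_left algebra_simps)
  also have "\<dots> = (\<integral>\<^sup>+ x. (\<integral>\<^sup>+ t. f (x + (t + s * (x \<bullet> a)) *\<^sub>R b) * w t \<partial>lborel) \<partial>lborel)"
    by (intro swap[symmetric]) measurable
  also have "\<dots> = (\<integral>\<^sup>+ x. (\<integral>\<^sup>+ t. f (x + ((t + - (s * (x \<bullet> a))) + s * (x \<bullet> a)) *\<^sub>R b)
      * w (t + - (s * (x \<bullet> a))) \<partial>lborel) \<partial>lborel)"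
    by (intro nn_integral_cong nn_integral_lborel_translate[symmetric]) measurable
  also have "\<dots> = (\<integral>\<^sup>+ x. (\<integral>\<^sup>+ t. f (x + t *\<^sub>R b) * w (t + - (s * (x \<bullet> a))) \<partial>lborel) \<partial>lborel)"
    by simp
  also have "\<dots> = (\<integral>\<^sup>+ t. (\<integral>\<^sup>+ x. f (x + t *\<^sub>R b) * w (t + - (s * (x \<bullet> a))) \<partial>lborel) \<partial>lborel)"
    by (intro swap) measurable
  also have "\<dots> = (\<integral>\<^sup>+ t. (\<integral>\<^sup>+ x. f ((x + (- t) *\<^sub>R b) + t *\<^sub>R b)
      * w (t + - (s * ((x + (- t) *\<^sub>R b) \<bullet> a))) \<partial>lborel) \<partial>lborel)"
    by (intro nn_integral_cong nn_integral_lborel_translate[symmetric]) measurable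
  also have "\<dots> = (\<integral>\<^sup>+ t. (\<integral>\<^sup>+ x. f x * w (t + - (s * (x \<bullet> a))) \<partial>lborel) \<partial>lborel)"
    using ba by (intro nn_integral_cong) (simp add: inner_diff_left algebra_simps)
  also have "\<dots> = (\<integral>\<^sup>+ x. (\<integral>\<^sup>+ t. f x * w (t + - (s * (x \<bullet> a))) \<partial>lborel) \<partial>lborel)"
    by (intro swap[symmetric]) measurable
  also have "\<dots> = (\<integral>\<^sup>+ x. f x \<partial>lborel)"
    by (simp add: nn_integral_cmult w1')
  finally show ?thesis .
qed

definition plane_rotation :: "'a::euclidean_space \<Rightarrow> 'a \<Rightarrow> real \<Rightarrow> 'a \<Rightarrow> 'a" where
  "plane_rotation a b t x = x + ((cos t - 1) * (x \<bullet> a) - sin t * (x \<bullet> b)) *\<^sub>R a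
     + (sin t * (x \<bullet> a) + (cos t - 1) * (x \<bullet> b)) *\<^sub>R b"

context
  fixes a b :: "'a::euclidean_space"
  assumes ab: "a \<in> Basis" "b \<in> Basis" "a \<noteq> b"
begin

lemma plane_inner: "a \<bullet> a = 1" "b \<bullet> b = 1" "a \<bullet> b = 0" "b \<bullet> a = 0"
  using ab by (simp_all add: inner_Basis)

lemma plane_rotation_coord:
  "plane_rotation a b t x \<bullet> a = cos t * (x \<bullet> a) - sin t * (x \<bullet> b)"
  "plane_rotation a b t x \<bullet> b = sin t * (x \<bullet> a) + cos t * (x \<bullet> b)"
  by (simp_all add: plane_rotation_def inner_add_left plane_inner algebra_simps)

lemma norm_plane_rotation [simp]: "norm (plane_rotation a b t x) = norm x"
proof -
  define p q u v where "p = x \<bullet> a" "q = x \<bullet> b" "u = (cos t - 1) * p - sin t * q"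
    "v = sin t * p + (cos t - 1) * q"
  have "plane_rotation a b t x = x + u *\<^sub>R a + v *\<^sub>R b"
    by (simp add: plane_rotation_def p_q_u_v_def)
  then have "plane_rotation a b t x \<bullet> plane_rotation a b t x
      = x \<bullet> x + (2 * u * p + u\<^sup>2) + (2 * v * q + v\<^sup>2)"
    by (simp add: inner_simps plane_inner p_q_u_v_def(1,2) inner_commute algebra_simps power2_eq_square)
  also have "(2 * u * p + u\<^sup>2) + (2 * v * q + v\<^sup>2) = (p\<^sup>2 + q\<^sup>2) * ((cos t)\<^sup>2 + (sin t)\<^sup>2 - 1)"
    unfolding p_q_u_v_def(3,4) by algebra
  then have "x \<bullet> x + (2 * u * p + u\<^sup>2) + (2 * v * q + v\<^sup>2) = x \<bullet> x" by simp
  finally show ?thesis by (simp add: norm_eq_sqrt_inner)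
qed

lemma plane_rotation_scaleR: "plane_rotation a b t (c *\<^sub>R x) = c *\<^sub>R plane_rotation a b t x"
  by (simp add: plane_rotation_def algebra_simps)

lemma plane_rotation_continuous: "continuous_on UNIV (plane_rotation a b t)"
  unfolding plane_rotation_def by (intro continuous_intros)

lemma plane_rotation_measurable [measurable]: "plane_rotation a b t \<in> borel_measurable borel"
  using plane_rotation_continuous by (rule borel_measurable_continuous_onI)

text \<open>A rotation is a product of three shears, with parameters \<open>- tan (t/2)\<close>, \<open>sin t\<close> and
  \<open>- tan (t/2)\<close>.\<close>

lemma nn_integral_lborel_plane_rotation:
  assumes [measurable]: "f \<in> borel_measurable borel" and t: "\<bar>t\<bar> < pi"
  shows "(\<integral>\<^sup>+ x. f (plane_rotation a b t x) \<partial>lborel) = (\<integral>\<^sup>+ x. f x \<partial>lborel)"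
proof -
  define u where "u = - tan (t / 2)"
  have c: "cos (t / 2) \<noteq> 0"
    using less_imp_neq[OF cos_gt_zero_pi[of "t / 2"]] t by fastforce
  have st: "sin t = 2 * sin (t/2) * cos (t/2)" and ct: "cos t = 2 * (cos (t/2))\<^sup>2 - 1"
    using sin_double[of "t/2"] cos_double_cos[of "t/2"] by auto
  have 1: "1 + u * sin t = cos t"
    using c sin_squared_eq[of "t/2"] unfolding st ct u_def tan_def by (simp add: power2_eq_square)
  have 2: "u * (1 + cos t) = - sin t"
    using c unfolding st ct u_def tan_def by (simp add: power2_eq_square)
  define A B where "A x = x + (u * (x \<bullet> b)) *\<^sub>R a" and "B x = x + (sin t * (x \<bullet> a)) *\<^sub>R b" for x
  have [measurable]: "A \<in> borel_measurable borel" "B \<in> borel_measurable borel"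
    unfolding A_def[abs_def] B_def[abs_def] by measurable
  have rot: "A (B (A x)) = plane_rotation a b t x" for x
  proof -
    define p q where "p = x \<bullet> a" and "q = x \<bullet> b"
    have "A (B (A x)) = x + (u * q + u * (q + sin t * (p + u * q))) *\<^sub>R a + (sin t * (p + u * q)) *\<^sub>R b"
      by (simp add: A_def B_def inner_add_left plane_inner p_def q_def scaleR_add_left)
    moreover have "sin t * (p + u * q) = sin t * p + (cos t - 1) * q"
      unfolding 1[symmetric] by (simp add: algebra_simps)
    moreover have "u * q + u * (q + sin t * (p + u * q)) = (cos t - 1) * p - sin t * q"
    proof -
      have "u * q + u * (q + sin t * (p + u * q)) = (u * sin t) * p + (u * (1 + (1 + u * sin t))) * q"
        by (simp add: algebra_simps)
      then show ?thesis unfolding 1 2 by (simp add: 1[symmetric])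
    qed
    ultimately show ?thesis by (simp add: plane_rotation_def p_def q_def)
  qed
  have "(\<integral>\<^sup>+ x. f (plane_rotation a b t x) \<partial>lborel) = (\<integral>\<^sup>+ x. f (A (B (A x))) \<partial>lborel)"
    by (simp add: rot)
  also have "\<dots> = (\<integral>\<^sup>+ x. f (A (B x)) \<partial>lborel)"
    unfolding A_def[of x for x] by (rule nn_integral_lborel_shear[of "\<lambda>x. f (A (B x))", unfolded A_def[of "B x" for x]])
      (simp_all add: plane_inner)
  also have "\<dots> = (\<integral>\<^sup>+ x. f (A x) \<partial>lborel)"
    unfolding B_def by (rule nn_integral_lborel_shear[of "\<lambda>x. f (A x)"]) (simp_all add: plane_inner)
  also have "\<dots> = (\<integral>\<^sup>+ x. f x \<partial>lborel)"
    unfolding A_def by (rule nn_integral_lborel_shear) (simp_all add: plane_inner)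
  finally show ?thesis .
qed

lemma distr_lborel_plane_rotation:
  assumes "\<bar>t\<bar> < pi"
  shows "distr lborel borel (plane_rotation a b t) = lborel"
proof (rule measure_eqI)
  fix A assume "A \<in> sets (distr lborel borel (plane_rotation a b t))"
  then have [measurable]: "A \<in> sets borel" by simp
  have "emeasure (distr lborel borel (plane_rotation a b t)) A
      = (\<integral>\<^sup>+ x. indicator A x \<partial>distr lborel borel (plane_rotation a b t))"
    by simp
  also have "\<dots> = (\<integral>\<^sup>+ x. indicator A (plane_rotation a b t x) \<partial>lborel)"
    by (rule nn_integral_distr) auto
  also have "\<dots> = (\<integral>\<^sup>+ x. indicator A x \<partial>lborel)"
    using assms by (intro nn_integral_lborel_plane_rotation) auto
  finally show "emeasure (distr lborel borel (plane_rotation a b t)) A = emeasure lborel A" by simp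
qed simp

lemma has_derivative_plane_rotation:
  "((\<lambda>t. plane_rotation a b t x) has_vector_derivative
     ((plane_rotation a b t x \<bullet> a) *\<^sub>R b - (plane_rotation a b t x \<bullet> b) *\<^sub>R a)) (at t)"
  unfolding plane_rotation_coord unfolding plane_rotation_def
  by (auto intro!: derivative_eq_intros simp: has_vector_derivative_def algebra_simps)

end


subsection \<open>Integration by parts on the sphere\<close>

text \<open>As a constant density, the scaling can be moved into the integrand by
  \<open>integral_density\<close>.\<close>

lemma sphere_measure_eq_density:
  "sphere_measure r = density (distr (restrict_space lborel (ball 0 r - {0::'a::euclidean_space}))
     (restrict_space borel (sphere 0 r)) (\<lambda>x. (r / norm x) *\<^sub>R x)) (\<lambda>_. ennreal (real DIM('a) / r))"
  unfolding sphere_measure_def by (rule measure_eqI) (auto simp: emeasure_density_const)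

context round_sphere
begin

abbreviation \<mu> :: "'a measure" where "\<mu> \<equiv> sphere_measure r"

abbreviation sint :: "('a \<Rightarrow> 'c::euclidean_space) \<Rightarrow> 'c" where "sint f \<equiv> integral\<^sup>L \<mu> f"

lemma space_\<mu> [simp]: "space \<mu> = S"
  by (simp add: sphere_measure_def space_scale_measure space_restrict_space S_def)

lemma sets_\<mu> [simp, measurable_cong]: "sets \<mu> = sets (restrict_space borel S)"
  by (simp add: sphere_measure_def S_def)

lemma radial_measurable:
  "(\<lambda>x. (r / norm x) *\<^sub>R x) \<in> restrict_space lborel (ball 0 r - {0}) \<rightarrow>\<^sub>M restrict_space borel S"
  using r_pos by (intro measurable_restrict_space2 measurable_restrict_space1)
    (auto simp: space_restrict_space S_def)

lemma emeasure_\<mu>_S: "emeasure \<mu> S = ennreal (real DIM('a) / r) * emeasure lborel (ball (0::'a) r - {0})"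
proof -
  have "emeasure \<mu> S = ennreal (real DIM('a) / r) *
      emeasure (distr (restrict_space lborel (ball 0 r - {0::'a})) (restrict_space borel S)
        (\<lambda>x. (r / norm x) *\<^sub>R x)) S"
    by (simp add: sphere_measure_def S_def)
  also have "emeasure (distr (restrict_space lborel (ball 0 r - {0::'a})) (restrict_space borel S)
        (\<lambda>x. (r / norm x) *\<^sub>R x)) S
      = emeasure (restrict_space lborel (ball 0 r - {0::'a})) (ball 0 r - {0})"
    using r_pos by (subst emeasure_distr[OF radial_measurable])
      (auto simp: space_restrict_space S_def sets_restrict_space intro!: arg_cong[of _ _ "emeasure _"])
  also have "\<dots> = emeasure lborel (ball (0::'a) r - {0})"
    by (subst emeasure_restrict_space) auto
  finally show ?thesis .
qed

lemma finite_\<mu>: "finite_measure \<mu>"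
proof
  have "emeasure lborel (ball (0::'a) r - {0}) \<le> emeasure lborel (ball (0::'a) r)"
    by (intro emeasure_mono) auto
  also have "\<dots> < \<infinity>" by (rule emeasure_lborel_ball_finite)
  finally show "emeasure \<mu> (space \<mu>) \<noteq> \<infinity>"
    by (simp add: emeasure_\<mu>_S ennreal_mult_eq_top_iff)
qed

lemma measure_\<mu>_pos: "measure \<mu> S > 0"
proof -
  interpret finite_measure \<mu> by (rule finite_\<mu>)
  have "emeasure lborel (ball (0::'a) r - {0}) > 0"
  proof -
    have "emeasure lborel (ball (0::'a) r) > 0"
      using content_ball_pos[OF r_pos, of "0::'a"] by (simp add: measure_def enn2real_positive_iff)
    then show ?thesis by (subst emeasure_Diff_null_set) (auto simp: null_sets_def)
  qed
  then have "emeasure \<mu> S > 0"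
    using r_pos by (simp add: emeasure_\<mu>_S ennreal_zero_less_mult_iff)
  then show ?thesis by (simp add: emeasure_eq_measure)
qed

lemma borel_measurable_\<mu>:
  fixes f :: "'a \<Rightarrow> 'c::euclidean_space"
  shows "continuous_on S f \<Longrightarrow> f \<in> borel_measurable \<mu>"
  using borel_measurable_continuous_on_restrict measurable_cong_sets[OF sets_\<mu> refl] by blast

lemma integrable_continuous:
  fixes f :: "'a \<Rightarrow> 'c::euclidean_space"
  assumes "continuous_on S f"
  shows "integrable \<mu> f"
proof -
  interpret finite_measure \<mu> by (rule finite_\<mu>)
  have "bounded (f ` S)"
    using assms compact_S compact_continuous_image compact_imp_bounded by blast
  then obtain B where "\<forall>x\<in>S. norm (f x) \<le> B" by (auto simp: bounded_iff)
  then show ?thesis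
    using assms by (intro integrable_const_bound[of _ B] borel_measurable_\<mu> AE_I2) auto
qed

lemma integrable_smooth [intro, simp]: "smooth_on S f \<Longrightarrow> integrable \<mu> f"
  by (intro integrable_continuous smooth_on_imp_continuous_on)

lemma sint_cong: "(\<And>x. x \<in> S \<Longrightarrow> f x = g x) \<Longrightarrow> sint f = sint g"
  by (intro Bochner_Integration.integral_cong) auto

lemma sint_eq_lborel:
  fixes f :: "'a \<Rightarrow> real"
  assumes "continuous_on S f"
  shows "sint f = (LINT x|lborel. (real DIM('a) / r) * (indicator (ball 0 r - {0}) x * f ((r / norm x) *\<^sub>R x)))"
    and "(\<lambda>x. indicator (ball 0 r - {0}) x * f ((r / norm x) *\<^sub>R x)) \<in> borel_measurable borel"
proof -
  have f: "f \<in> borel_measurable (restrict_space borel S)"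
    using assms by (rule borel_measurable_continuous_on_restrict)
  have m: "(\<lambda>x. f ((r / norm x) *\<^sub>R x)) \<in> borel_measurable (restrict_space lborel (ball 0 r - {0}))"
    using measurable_compose[OF radial_measurable f] .
  have "sint f = integral\<^sup>L (distr (restrict_space lborel (ball 0 r - {0})) (restrict_space borel S)
      (\<lambda>x. (r / norm x) *\<^sub>R x)) (\<lambda>x. (real DIM('a) / r) *\<^sub>R f x)"
    unfolding sphere_measure_eq_density S_def[symmetric]
    using r_pos f by (subst integral_density) auto
  also have "\<dots> = integral\<^sup>L (restrict_space lborel (ball 0 r - {0})) (\<lambda>x. (real DIM('a) / r) *\<^sub>R f ((r / norm x) *\<^sub>R x))"
    using f by (intro integral_distr radial_measurable) auto
  also have "\<dots> = (LINT x|lborel. indicator (ball 0 r - {0}) x *\<^sub>R ((real DIM('a) / r) *\<^sub>R f ((r / norm x) *\<^sub>R x)))"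
    by (intro integral_restrict_space) auto
  finally show "sint f = (LINT x|lborel. (real DIM('a) / r) * (indicator (ball 0 r - {0}) x * f ((r / norm x) *\<^sub>R x)))"
    by (simp add: ac_simps)
  show "(\<lambda>x. indicator (ball 0 r - {0}) x * f ((r / norm x) *\<^sub>R x)) \<in> borel_measurable borel"
    using m by (subst (asm) borel_measurable_restrict_space_iff) (auto simp: ac_simps)
qed

text \<open>A rotation preserves the ball and commutes with radial projection, so invariance of
  Lebesgue measure descends to the sphere.\<close>

lemma sint_plane_rotation:
  fixes f :: "'a \<Rightarrow> real"
  assumes ab: "a \<in> Basis" "b \<in> Basis" "a \<noteq> b" and t: "\<bar>t\<bar> < pi" and f: "continuous_on S f"
  shows "sint (\<lambda>x. f (plane_rotation a b t x)) = sint f"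
proof -
  note [simp] = norm_plane_rotation[OF ab] plane_rotation_scaleR[OF ab]
  let ?g = "\<lambda>x. (real DIM('a) / r) * (indicator (ball 0 r - {0}) x * f ((r / norm x) *\<^sub>R x))"
  have "continuous_on S (\<lambda>x. f (plane_rotation a b t x))"
    by (rule continuous_on_compose2[OF f continuous_on_subset[OF plane_rotation_continuous[OF ab]]])
       (auto simp: S_def)
  then have "sint (\<lambda>x. f (plane_rotation a b t x)) =
      (LINT x|lborel. (real DIM('a) / r) * (indicator (ball 0 r - {0}) x * f (plane_rotation a b t ((r / norm x) *\<^sub>R x))))"
    by (rule sint_eq_lborel)
  also have "\<dots> = (LINT x|lborel. ?g (plane_rotation a b t x))"
  proof (intro Bochner_Integration.integral_cong refl)
    fix x :: 'a
    have "plane_rotation a b t x = 0 \<longleftrightarrow> x = 0"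
      using norm_plane_rotation[OF ab, of t x] by (metis norm_eq_zero)
    then show "(real DIM('a) / r) * (indicator (ball 0 r - {0}) x * f (plane_rotation a b t ((r / norm x) *\<^sub>R x)))
        = ?g (plane_rotation a b t x)"
      by (auto simp: indicator_def)
  qed
  also have "\<dots> = (LINT x|distr lborel borel (plane_rotation a b t). ?g x)"
    using sint_eq_lborel(2)[OF f] plane_rotation_measurable[OF ab]
    by (intro integral_distr[symmetric]) auto
  also have "\<dots> = sint f"
    unfolding distr_lborel_plane_rotation[OF ab t] by (rule sint_eq_lborel(1)[OF f, symmetric])
  finally show ?thesis .
qed

lemma bounded_smooth:
  assumes "smooth_on S f"
  obtains B where "B > 0" "\<And>x. x \<in> S \<Longrightarrow> norm (f x) \<le> B"
proof -
  have "bounded (f ` S)"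
    using assms compact_S compact_continuous_image compact_imp_bounded smooth_on_imp_continuous_on by blast
  then show ?thesis using that by (auto simp: bounded_pos)
qed

text \<open>Obtained as the derivative at \<open>0\<close> of the integral of a function along the rotations in the plane of
  \<open>a\<close> and \<open>b\<close>.\<close>

lemma sint_rotation_field:
  fixes f :: "'a \<Rightarrow> real"
  assumes ab: "a \<in> Basis" "b \<in> Basis" "a \<noteq> b" and f: "smooth_on S f"
  shows "sint (\<lambda>x. (x \<bullet> a) * sD r b f x - (x \<bullet> b) * sD r a f x) = 0"
proof -
  interpret finite_measure \<mu> by (rule finite_\<mu>)
  define F where "F x = (x \<bullet> a) * sD r b f x - (x \<bullet> b) * sD r a f x" for x
  define R where "R = plane_rotation a b"
  have RS: "R t x \<in> S \<longleftrightarrow> x \<in> S" for t x by (simp add: S_def R_def norm_plane_rotation[OF ab])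
  have R0: "R 0 x = x" for x by (simp add: R_def plane_rotation_def)
  have smF: "smooth_on S F" unfolding F_def[abs_def] by (intro smooth_intros f)
  obtain B where B: "B > 0" "\<And>x. x \<in> S \<Longrightarrow> norm (F x) \<le> B" using bounded_smooth[OF smF] by blast
  have der: "((\<lambda>t. f (R t x)) has_real_derivative F (R t x)) (at t)" if x: "x \<in> S" for t x
  proof -
    have ySS: "R t x \<in> S" using x RS by simp
    obtain g g' where g: "(g has_derivative g') (at (R t x))" "\<And>y. y \<in> S \<Longrightarrow> f y = g y"
      "\<And>v. sD r v f (R t x) = g' (tproj (R t x) v)"
      by (rule sD_has_derivative[OF ySS f]) (rule that)
    define v where "v = (R t x \<bullet> a) *\<^sub>R b - (R t x \<bullet> b) *\<^sub>R a"
    have vt: "v \<in> tangent (R t x)" by (simp add: v_def tangent_def inner_diff_right)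
    have "((\<lambda>t. R t x) has_derivative (\<lambda>s. s *\<^sub>R v)) (at t)"
      using has_derivative_plane_rotation[OF ab, of x t] by (simp add: R_def v_def has_vector_derivative_def)
    from diff_chain_at[OF this g(1)] have "((\<lambda>t. g (R t x)) has_derivative (\<lambda>s. g' (s *\<^sub>R v))) (at t)"
      by (simp add: o_def)
    then have "((\<lambda>t. f (R t x)) has_derivative (\<lambda>s. g' (s *\<^sub>R v))) (at t)"
      using g(2) x RS by simp
    moreover have "g' (s *\<^sub>R v) = F (R t x) * s" for s
    proof -
      interpret l: linear "\<lambda>v. sD r v f (R t x)" by (rule linear_sD[OF ySS f])
      have "g' (s *\<^sub>R v) = s *\<^sub>R g' v"
        using g(1) by (simp add: has_derivative_linear linear_scale)
      also have "g' v = sD r v f (R t x)" by (simp add: g(3) tproj_tangent[OF vt])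
      also have "\<dots> = F (R t x)" by (simp add: v_def l.diff l.scale F_def)
      finally show ?thesis by (simp add: mult.commute)
    qed
    ultimately show ?thesis by (simp add: has_field_derivative_def)
  qed
  define e :: "nat \<Rightarrow> real" where "e n = 1 / real (Suc n)" for n
  have e: "e n > 0" "e n \<le> 1" for n by (auto simp: e_def)
  have epi: "\<bar>e n\<bar> < pi" for n using e[of n] pi_gt3 by auto
  have e0: "e \<longlonglongrightarrow> 0" unfolding e_def[abs_def] by (rule LIMSEQ_Suc[OF lim_1_over_n])
  define s where "s n x = (f (R (e n) x) - f x) / e n" for n x
  have cf: "continuous_on S f" using f by (rule smooth_on_imp_continuous_on)
  have cRf: "continuous_on S (\<lambda>x. f (R t x))" for t
    unfolding R_def
    by (rule continuous_on_compose2[OF cf continuous_on_subset[OF plane_rotation_continuous[OF ab]]])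
       (auto simp: S_def norm_plane_rotation[OF ab])
  \<comment> \<open>The difference quotients tend to \<open>F\<close> pointwise and are dominated by
    \<open>B\<close> through the mean value inequality, while each has integral zero by
    invariance.\<close>
  have "(\<lambda>n. sint (s n)) \<longlonglongrightarrow> sint F"
  proof (rule integral_dominated_convergence[where w = "\<lambda>_. B"])
    show "F \<in> borel_measurable \<mu>" using smF by (intro borel_measurable_\<mu> smooth_on_imp_continuous_on)
    show "s n \<in> borel_measurable \<mu>" for n
      unfolding s_def[abs_def] using e[of n]
      by (intro borel_measurable_\<mu> continuous_intros cRf cf) auto
    show "AE x in \<mu>. (\<lambda>n. s n x) \<longlonglongrightarrow> F x"
    proof (rule AE_I2)
      fix x assume "x \<in> space \<mu>"
      then have "((\<lambda>t. (f (R t x) - f x) / t) \<longlongrightarrow> F x) (at 0)"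
        using der[of x 0] by (simp add: has_field_derivative_iff R0)
      moreover have "filterlim e (at 0) sequentially"
        using e0 e(1) by (auto simp: filterlim_at intro!: always_eventually) (metis less_irrefl)
      ultimately show "(\<lambda>n. s n x) \<longlonglongrightarrow> F x"
        unfolding s_def using filterlim_compose by fast
    qed
    show "AE x in \<mu>. norm (s n x) \<le> B" for n
    proof (rule AE_I2)
      fix x assume "x \<in> space \<mu>"
      then have x: "x \<in> S" by simp
      have "norm (f (R (e n) x) - f (R 0 x)) \<le> B * norm (e n - 0)"
        by (rule field_differentiable_bound[of UNIV "\<lambda>t. f (R t x)" "\<lambda>t. F (R t x)"])
           (use B RS x in \<open>auto intro!: der[OF x] DERIV_subset[OF der[OF x]]\<close>)
      then show "norm (s n x) \<le> B" using e[of n] by (simp add: s_def R0 field_simps)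
    qed
  qed auto
  moreover have "sint (s n) = 0" for n
  proof -
    have "sint (s n) = (sint (\<lambda>x. f (R (e n) x)) - sint f) / e n"
      unfolding s_def[abs_def] using integrable_continuous[OF cRf] integrable_continuous[OF cf] by simp
    then show ?thesis using sint_plane_rotation[OF ab epi[of n] cf] by (simp add: R_def)
  qed
  ultimately have "sint F = 0" by (simp add: LIMSEQ_const_iff)
  then show ?thesis by (simp add: F_def[abs_def])
qed

text \<open>Since \<open>\<kappa> * (x \<bullet> x) = 1\<close>, applying the rotation fields
  \<open>\<Lambda> a\<close> to \<open>(x \<bullet> a) * f x\<close> and summing over
  \<open>a\<close> recovers \<open>sD r b f\<close>, up to the mean curvature term on the
  right.\<close>

theorem sint_sD:
  fixes f :: "'a \<Rightarrow> real"
  assumes f: "smooth_on S f" and b: "b \<in> Basis"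
  shows "sint (sD r b f) = \<kappa> * m * sint (\<lambda>x. (x \<bullet> b) * f x)"
proof -
  define h where "h a x = (x \<bullet> a) * f x" for a x
  have h: "smooth_on S (h a)" for a using f by (auto simp: h_def[abs_def])
  define \<Lambda> where "\<Lambda> a g x = (x \<bullet> a) * sD r b g x - (x \<bullet> b) * sD r a g x" for a g and x :: 'a
  have sm\<Lambda>: "smooth_on S (\<Lambda> a g)" if "smooth_on S g" for a g
    unfolding \<Lambda>_def[abs_def] by (intro smooth_intros that)
  have \<Lambda>0: "sint (\<Lambda> a g) = 0" if "a \<in> Basis" "smooth_on S g" for a g
    using sint_rotation_field[OF that(1) b _ that(2)] by (cases "a = b") (auto simp: \<Lambda>_def[abs_def])
  have eq: "sD r b f x = \<kappa> * (\<Sum>a\<in>Basis. \<Lambda> a (h a) x) + \<kappa> * m * h b x" if x: "x \<in> S" for x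
  proof -
    have 1: "\<Lambda> a (h a) x = (x \<bullet> a) * (x \<bullet> a) * sD r b f x - (x \<bullet> b) * ((x \<bullet> a) * sD r a f x)
        + f x * ((x \<bullet> a) * (b \<bullet> a)) - f x * (x \<bullet> b)" if "a \<in> Basis" for a
    proof -
      have hv: "sD r v (h a) x = (x \<bullet> a) * sD r v f x + (v \<bullet> a - \<kappa> * (x \<bullet> v) * (x \<bullet> a)) * f x" for v
        unfolding h_def using x f by (simp add: sD_mult sD_coord smooth_on_coord)
      show ?thesis using that unfolding \<Lambda>_def hv by (simp add: algebra_simps)
    qed
    have "(\<Sum>a\<in>Basis. \<Lambda> a (h a) x) = (\<Sum>a\<in>Basis. (x \<bullet> a) * (x \<bullet> a)) * sD r b f x
        - (x \<bullet> b) * (\<Sum>a\<in>Basis. (x \<bullet> a) *\<^sub>R sD r a f x) + f x * (\<Sum>a\<in>Basis. (x \<bullet> a) * (b \<bullet> a))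
        - real DIM('a) * (f x * (x \<bullet> b))"
      by (simp add: 1 sum.distrib sum_subtractf sum_distrib_left sum_distrib_right)
    also have "\<dots> = (x \<bullet> x) * sD r b f x - m * h b x"
      using sum_coord_sD[OF x f]
      by (simp add: euclidean_inner[symmetric] m_def h_def algebra_simps inner_commute[of b x])
    finally have e: "(\<Sum>a\<in>Basis. \<Lambda> a (h a) x) = (x \<bullet> x) * sD r b f x - m * h b x" .
    show ?thesis
      unfolding e using S_inner'[OF x] by (simp add: right_diff_distrib flip: mult.assoc)
  qed
  have "sint (sD r b f) = sint (\<lambda>x. \<kappa> * (\<Sum>a\<in>Basis. \<Lambda> a (h a) x) + \<kappa> * m * h b x)"
    by (rule sint_cong) (rule eq)
  also have "\<dots> = \<kappa> * (\<Sum>a\<in>Basis. sint (\<Lambda> a (h a))) + \<kappa> * m * sint (h b)"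
    using h sm\<Lambda> by (simp add: integrable_smooth)
  finally show ?thesis using \<Lambda>0 h by (simp add: h_def[abs_def])
qed

text \<open>\<open>sint_sD\<close> is applied to each \<open>sD r b f x \<bullet> g x\<close>. The
  sum of the mean curvature terms contracts the gradient with \<open>x\<close> and vanishes.\<close>

theorem sint_slap:
  assumes f: "smooth_on S f" and g: "smooth_on S g"
  shows "sint (\<lambda>x. slap r f x \<bullet> g x) = sint (\<lambda>x. \<Sum>b\<in>Basis. sD r b f x \<bullet> sD r b g x)"
proof -
  have "sint (\<lambda>x. (\<Sum>b\<in>Basis. sD r b f x \<bullet> sD r b g x) - slap r f x \<bullet> g x)
      = sint (\<lambda>x. \<Sum>b\<in>Basis. sD r b (\<lambda>x. sD r b f x \<bullet> g x) x)"
    using f g by (intro sint_cong)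
      (simp add: sD_inner smooth_on_sD slap_def inner_sum_left sum.distrib)
  also have "\<dots> = (\<Sum>b\<in>Basis. sint (sD r b (\<lambda>x. sD r b f x \<bullet> g x)))"
    by (intro Bochner_Integration.integral_sum integrable_smooth smooth_intros f g)
  also have "\<dots> = (\<Sum>b\<in>Basis. \<kappa> * m * sint (\<lambda>x. (x \<bullet> b) * (sD r b f x \<bullet> g x)))"
    by (intro sum.cong refl sint_sD smooth_intros f g)
  also have "\<dots> = \<kappa> * m * sint (\<lambda>x. \<Sum>b\<in>Basis. (x \<bullet> b) * (sD r b f x \<bullet> g x))"
    unfolding sum_distrib_left[symmetric]
    by (subst Bochner_Integration.integral_sum) (intro integrable_smooth smooth_intros f g refl)+
  also have "sint (\<lambda>x. \<Sum>b\<in>Basis. (x \<bullet> b) * (sD r b f x \<bullet> g x))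
      = sint (\<lambda>x. (\<Sum>b\<in>Basis. (x \<bullet> b) *\<^sub>R sD r b f x) \<bullet> g x)"
    by (simp add: inner_sum_left)
  also have "\<dots> = sint (\<lambda>x. 0)" using f by (intro sint_cong) (simp add: sum_coord_sD)
  finally have "sint (\<lambda>x. (\<Sum>b\<in>Basis. sD r b f x \<bullet> sD r b g x) - slap r f x \<bullet> g x) = 0" by simp
  moreover have "smooth_on S (\<lambda>x. \<Sum>b\<in>Basis. sD r b f x \<bullet> sD r b g x)" "smooth_on S (\<lambda>x. slap r f x \<bullet> g x)"
    by (intro smooth_intros f g)+
  ultimately show ?thesis by (simp add: integrable_smooth)
qed

corollary sint_slap_symmetric:
  assumes f: "smooth_on S f" and g: "smooth_on S g"
  shows "sint (\<lambda>x. slap r f x \<bullet> g x) = sint (\<lambda>x. f x \<bullet> slap r g x)"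
  using sint_slap[OF f g] sint_slap[OF g f] by (simp add: inner_commute)

end


subsection \<open>The inner product of square-integrable functions\<close>

context round_sphere
begin

definition ip :: "('a \<Rightarrow> 'c::euclidean_space) \<Rightarrow> ('a \<Rightarrow> 'c) \<Rightarrow> real" where
  "ip f g = sint (\<lambda>x. f x \<bullet> g x)"

lemma ip_commute: "ip f g = ip g f"
  by (simp add: ip_def inner_commute)

lemma ip_cong: "(\<And>x. x \<in> S \<Longrightarrow> f x = f' x) \<Longrightarrow> (\<And>x. x \<in> S \<Longrightarrow> g x = g' x) \<Longrightarrow> ip f g = ip f' g'"
  unfolding ip_def by (rule sint_cong) simp

lemma ip_add_left:
  "smooth_on S f \<Longrightarrow> smooth_on S g \<Longrightarrow> smooth_on S h \<Longrightarrow> ip (\<lambda>x. f x + g x) h = ip f h + ip g h"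
  by (simp add: ip_def inner_add_left integrable_smooth smooth_on_inner)

lemma ip_diff_left:
  "smooth_on S f \<Longrightarrow> smooth_on S g \<Longrightarrow> smooth_on S h \<Longrightarrow> ip (\<lambda>x. f x - g x) h = ip f h - ip g h"
  by (simp add: ip_def inner_diff_left integrable_smooth smooth_on_inner)

lemma ip_scaleR_left: "ip (\<lambda>x. c *\<^sub>R f x) h = c * ip f h"
  by (simp add: ip_def)

lemma ip_mult_left: "ip (\<lambda>x. c * f x) h = c * ip f h"
  by (simp add: ip_def mult.assoc)

lemma ip_sum_left:
  "(\<And>i. i \<in> I \<Longrightarrow> smooth_on S (f i)) \<Longrightarrow> smooth_on S h \<Longrightarrow> ip (\<lambda>x. \<Sum>i\<in>I. f i x) h = (\<Sum>i\<in>I. ip (f i) h)"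
  unfolding ip_def inner_sum_left by (intro Bochner_Integration.integral_sum integrable_smooth smooth_on_inner)

lemma ip_add_right:
  "smooth_on S f \<Longrightarrow> smooth_on S g \<Longrightarrow> smooth_on S h \<Longrightarrow> ip h (\<lambda>x. f x + g x) = ip h f + ip h g"
  using ip_add_left[of f g h] by (simp add: ip_commute)

lemma ip_diff_right:
  "smooth_on S f \<Longrightarrow> smooth_on S g \<Longrightarrow> smooth_on S h \<Longrightarrow> ip h (\<lambda>x. f x - g x) = ip h f - ip h g"
  using ip_diff_left[of f g h] by (simp add: ip_commute)

lemma ip_scaleR_right: "ip h (\<lambda>x. c *\<^sub>R f x) = c * ip h f"
  by (simp add: ip_def)

lemma ip_mult_right: "ip h (\<lambda>x. c * f x) = c * ip h f"
  using ip_mult_left[of c f h] by (simp add: ip_commute)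

lemma ip_self_nonneg: "ip f f \<ge> 0"
  by (simp add: ip_def)

lemma ip_square_diff:
  assumes "smooth_on S f" "smooth_on S g"
  shows "ip (\<lambda>x. s *\<^sub>R f x - t *\<^sub>R g x) (\<lambda>x. s *\<^sub>R f x - t *\<^sub>R g x)
    = s\<^sup>2 * ip f f - 2 * s * t * ip f g + t\<^sup>2 * ip g g"
  using assms by (simp add: ip_diff_left ip_diff_right smooth_intros ip_scaleR_left ip_scaleR_right
      ip_commute[of g f] power2_eq_square algebra_simps)

lemma ip_Cauchy_Schwarz:
  assumes "smooth_on S f" "smooth_on S g"
  shows "(ip f g)\<^sup>2 \<le> ip f f * ip g g"
proof (cases "ip g g = 0")
  case True
  have "ip f g = 0"
  proof (rule ccontr)
    assume "ip f g \<noteq> 0"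
    moreover have "0 \<le> ip f f - 2 * t * ip f g" for t
      using ip_self_nonneg[of "\<lambda>x. 1 *\<^sub>R f x - t *\<^sub>R g x"] unfolding ip_square_diff[OF assms]
      by (simp add: True)
    \<comment> \<open>For this \<open>t\<close> the expression equals -1.\<close>
    from this[of "(ip f f + 1) / (2 * ip f g)"] calculation show False by simp
  qed
  then show ?thesis by (simp add: True)
next
  case False
  then have g: "ip g g > 0" using ip_self_nonneg[of g] by simp
  have "0 \<le> (ip g g)\<^sup>2 * ip f f - 2 * ip g g * ip f g * ip f g + (ip f g)\<^sup>2 * ip g g"
    using ip_self_nonneg unfolding ip_square_diff[OF assms, symmetric] .
  then have "0 \<le> ip g g * (ip f f * ip g g - (ip f g)\<^sup>2)"
    by (simp add: power2_eq_square algebra_simps)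
  then show ?thesis using g by (simp add: zero_le_mult_iff)
qed

text \<open>A substitute for definiteness: zero norm implies orthogonality to every smooth function,
  so identities can be kept in weak form instead of being proved pointwise.\<close>

lemma ip_null:
  assumes "smooth_on S f" "smooth_on S g" "ip g g = 0"
  shows "ip f g = 0" "ip g f = 0"
proof -
  show "ip f g = 0" using ip_Cauchy_Schwarz[OF assms(1,2)] assms(3) by simp
  then show "ip g f = 0" using ip_commute[of g f] by simp
qed

lemma ip_slap: "smooth_on S f \<Longrightarrow> smooth_on S g \<Longrightarrow> ip (slap r f) g = ip f (slap r g)"
  unfolding ip_def by (rule sint_slap_symmetric)

text \<open>Gram-Schmidt by induction on \<open>B\<close>: the new vector \<open>b\<close> is first
  replaced by its part \<open>c\<close> orthogonal to \<open>span B\<close>, which may have zero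
  norm.\<close>

lemma exists_projection:
  fixes f :: "'a \<Rightarrow> real"
  assumes "finite B" "\<And>q. q \<in> B \<Longrightarrow> smooth_on S q" "smooth_on S f"
  shows "\<exists>p\<in>span B. \<forall>q\<in>span B. ip (\<lambda>x. f x - p x) q = 0"
  using assms
proof (induction B arbitrary: f)
  case empty
  then show ?case by (auto simp: ip_def)
next
  case (insert b B)
  have sm: "smooth_on S q" if "q \<in> span (insert b B)" for q
    using that
  proof (induction rule: span_induct_alt)
    case (step c x y)
    then show ?case using insert.prems(1)[of x] smooth_on_add[of S "\<lambda>z. c *\<^sub>R x z" y]
      by (simp add: scaleR_fun_def plus_fun_def smooth_intros)
  qed (simp add: zero_fun_def)
  have smB: "smooth_on S q" if "q \<in> span B" for q
    using sm that span_mono[of B "insert b B"] by auto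
  have b: "smooth_on S b" using insert.prems by auto
  obtain p where p: "p \<in> span B" "\<And>q. q \<in> span B \<Longrightarrow> ip (\<lambda>x. f x - p x) q = 0"
    using insert.IH[of f] insert.prems by auto
  obtain pb where pb: "pb \<in> span B" "\<And>q. q \<in> span B \<Longrightarrow> ip (\<lambda>x. b x - pb x) q = 0"
    using insert.IH[of b] insert.prems b by auto
  define c where "c x = b x - pb x" for x
  have c: "smooth_on S c" unfolding c_def[abs_def] by (intro smooth_intros b smB pb(1))
  \<comment> \<open>If \<open>c\<close> has zero norm, division by zero gives \<open>t = 0\<close>,
    and \<open>ip_null\<close> supplies the orthogonality to \<open>c\<close>.\<close>
  define t where "t = ip (\<lambda>x. f x - p x) c / ip c c"
  define p' where "p' = p + t *\<^sub>R (b - pb)"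
  have p'x: "p' x = p x + t * c x" for x
    by (simp add: p'_def scaleR_fun_def c_def)
  have p'_span: "p' \<in> span (insert b B)"
    unfolding p'_def using p(1) pb(1) span_mono[of B "insert b B"]
    by (intro span_add span_scale span_diff) (auto intro: span_base)
  have smfp: "smooth_on S (\<lambda>x. f x - p x)"
    by (intro smooth_intros insert.prems smB p(1))
  have orthc: "ip (\<lambda>x. f x - p' x) c = 0"
  proof -
    have "ip (\<lambda>x. f x - p' x) c = ip (\<lambda>x. (f x - p x) - t * c x) c"
      by (simp add: p'x algebra_simps)
    also have "\<dots> = ip (\<lambda>x. f x - p x) c - t * ip c c"
      using smfp c by (simp add: ip_diff_left ip_mult_left smooth_intros)
    also have "\<dots> = 0"
      using ip_null(1)[OF smfp c] by (cases "ip c c = 0") (auto simp: t_def)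
    finally show ?thesis .
  qed
  have orthB: "ip (\<lambda>x. f x - p' x) q = 0" if "q \<in> span B" for q
  proof -
    have "ip (\<lambda>x. f x - p' x) q = ip (\<lambda>x. (f x - p x) - t * c x) q"
      by (simp add: p'x algebra_simps)
    also have "\<dots> = ip (\<lambda>x. f x - p x) q - t * ip c q"
      using smfp c smB[OF that] by (simp add: ip_diff_left ip_mult_left smooth_intros)
    also have "\<dots> = 0" using p(2)[OF that] pb(2)[OF that] by (simp add: c_def[abs_def])
    finally show ?thesis .
  qed
  have "ip (\<lambda>x. f x - p' x) q = 0" if q: "q \<in> span (insert b B)" for q
  proof -
    obtain k where k: "q - k *\<^sub>R b \<in> span B" using q by (auto simp: span_breakdown_eq)
    define q' where "q' = q - k *\<^sub>R b + k *\<^sub>R pb"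
    have q': "q' \<in> span B" unfolding q'_def using k pb(1) by (intro span_add span_scale)
    have "q x = q' x + k * c x" for x by (simp add: q'_def c_def scaleR_fun_def algebra_simps)
    then have "ip (\<lambda>x. f x - p' x) q = ip (\<lambda>x. f x - p' x) (\<lambda>x. q' x + k * c x)" by presburger
    also have "\<dots> = ip (\<lambda>x. f x - p' x) q' + k * ip (\<lambda>x. f x - p' x) c"
      using c smB[OF q'] insert.prems sm[OF p'_span]
      by (simp add: ip_add_right ip_mult_right smooth_intros)
    finally show ?thesis using orthc orthB[OF q'] by simp
  qed
  then show ?case using p'_span by blast
qed


subsection \<open>Homogeneous polynomials on the sphere\<close>

text \<open>Restrictions to the sphere of homogeneous polynomials of degree \<open>d\<close>; for \<open>d < 0\<close> only zero.
  Since \<open>norm x\<close> is constant on \<open>S\<close>, degree \<open>d\<close> is contained in degree \<open>d + 2\<close>.\<close>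

inductive hpoly :: "int \<Rightarrow> ('a \<Rightarrow> real) \<Rightarrow> bool" where
  hpoly_zero: "(\<And>x. x \<in> S \<Longrightarrow> p x = 0) \<Longrightarrow> hpoly d p"
| hpoly_const: "hpoly 0 (\<lambda>x. c)"
| hpoly_coord: "hpoly d p \<Longrightarrow> b \<in> Basis \<Longrightarrow> hpoly (d + 1) (\<lambda>x. (x \<bullet> b) * p x)"
| hpoly_add: "hpoly d p \<Longrightarrow> hpoly d q \<Longrightarrow> hpoly d (\<lambda>x. p x + q x)"
| hpoly_cong: "hpoly d p \<Longrightarrow> (\<And>x. x \<in> S \<Longrightarrow> p x = q x) \<Longrightarrow> hpoly d q"

lemma hpoly_smooth: "hpoly d p \<Longrightarrow> smooth_on S p"
proof (induction rule: hpoly.induct)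
  case (hpoly_zero p d)
  then show ?case using smooth_on_cong[of S "\<lambda>x. 0" p] by auto
next
  case (hpoly_cong d p q)
  then show ?case using smooth_on_cong by blast
qed (intro smooth_intros; assumption)+

lemma hpoly_neg: "hpoly d p \<Longrightarrow> d < 0 \<Longrightarrow> x \<in> S \<Longrightarrow> p x = 0"
  by (induction rule: hpoly.induct) auto

lemma hpoly_cmult: "hpoly d p \<Longrightarrow> hpoly d (\<lambda>x. c * p x)"
proof (induction rule: hpoly.induct)
  case (hpoly_zero p d)
  then show ?case by (intro hpoly.hpoly_zero) simp
next
  case (hpoly_const c')
  then show ?case by (rule hpoly.hpoly_const)
next
  case (hpoly_coord d p b)
  have "hpoly (d + 1) (\<lambda>x. (x \<bullet> b) * (c * p x))" by (intro hpoly.hpoly_coord hpoly_coord)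
  then show ?case by (simp add: mult.left_commute)
next
  case (hpoly_add d p q)
  have "hpoly d (\<lambda>x. c * p x + c * q x)" by (intro hpoly.hpoly_add hpoly_add)
  then show ?case by (simp add: distrib_left)
next
  case (hpoly_cong d p q)
  show ?case by (rule hpoly.hpoly_cong[OF hpoly_cong(3)]) (simp add: hpoly_cong(2))
qed

lemma hpoly_diff: "hpoly d p \<Longrightarrow> hpoly d q \<Longrightarrow> hpoly d (\<lambda>x. p x - q x)"
  using hpoly_add[of d p "\<lambda>x. (-1) * q x"] hpoly_cmult[of d q "-1"] by simp

lemma hpoly_sum:
  "(\<And>i. i \<in> I \<Longrightarrow> hpoly d (f i)) \<Longrightarrow> hpoly d (\<lambda>x. \<Sum>i\<in>I. f i x)"
  by (induction I rule: infinite_finite_induct) (auto intro: hpoly_zero hpoly_add)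

lemma hpoly_shift:
  assumes "hpoly d p"
  shows "hpoly (d + 2) p"
proof (rule hpoly_cong)
  show "hpoly (d + 2) (\<lambda>x. \<kappa> * (\<Sum>b\<in>Basis. (x \<bullet> b) * ((x \<bullet> b) * p x)))"
    using hpoly_coord[OF hpoly_coord[OF assms]] by (intro hpoly_cmult hpoly_sum) (simp add: add.assoc)
  fix x assume "x \<in> S"
  have "\<kappa> * (\<Sum>b\<in>Basis. (x \<bullet> b) * ((x \<bullet> b) * p x)) = \<kappa> * (x \<bullet> x) * p x"
    by (simp add: euclidean_inner[of x x] sum_distrib_right mult.assoc)
  then show "\<kappa> * (\<Sum>b\<in>Basis. (x \<bullet> b) * ((x \<bullet> b) * p x)) = p x" using S_inner'[OF \<open>x \<in> S\<close>] by simp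
qed

lemma hpoly_mult: "hpoly d p \<Longrightarrow> hpoly e q \<Longrightarrow> hpoly (d + e) (\<lambda>x. p x * q x)"
proof (induction rule: hpoly.induct)
  case (hpoly_zero p d)
  then show ?case by (intro hpoly.hpoly_zero) simp
next
  case (hpoly_const c)
  then show ?case by (simp add: hpoly_cmult)
next
  case (hpoly_coord d p b)
  have "hpoly (d + e + 1) (\<lambda>x. (x \<bullet> b) * (p x * q x))"
    using hpoly_coord by (intro hpoly.hpoly_coord) auto
  then show ?case by (simp add: mult.assoc add.commute add.left_commute)
next
  case (hpoly_add d p p')
  have "hpoly (d + e) (\<lambda>x. p x * q x + p' x * q x)" using hpoly_add by (intro hpoly.hpoly_add) auto
  then show ?case by (simp add: distrib_right)
next
  case (hpoly_cong d p p')
  show ?case by (rule hpoly.hpoly_cong[OF hpoly_cong(3)]) (simp_all add: hpoly_cong)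
qed

text \<open>The leading part of the tangential derivative: a homogeneous \<open>p\<close> of degree \<open>d\<close> has radial
  derivative \<open>d * p\<close>.\<close>

lemma hpoly_sD:
  "hpoly d p \<Longrightarrow> b \<in> Basis \<Longrightarrow> hpoly (d - 1) (\<lambda>x. sD r b p x + \<kappa> * of_int d * (x \<bullet> b) * p x)"
proof (induction rule: hpoly.induct)
  case (hpoly_zero p d)
  have "sD r b p x = 0" if "x \<in> S" for x
    using sD_cong[OF that, of p "\<lambda>x. 0" b] hpoly_zero(1) that by simp
  then show ?case using hpoly_zero by (intro hpoly.hpoly_zero) simp
next
  case (hpoly_const c)
  then show ?case by (intro hpoly.hpoly_zero) simp
next
  case (hpoly_coord d p c)
  have p: "smooth_on S p" using hpoly_coord(1) by (rule hpoly_smooth)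
  have "hpoly (d - 1 + 1) (\<lambda>x. (x \<bullet> c) * (sD r b p x + \<kappa> * of_int d * (x \<bullet> b) * p x))"
    using hpoly_coord by (intro hpoly.hpoly_coord) auto
  then have "hpoly d (\<lambda>x. (x \<bullet> c) * (sD r b p x + \<kappa> * of_int d * (x \<bullet> b) * p x) + (b \<bullet> c) * p x)"
    using hpoly_coord by (intro hpoly_add hpoly_cmult) auto
  then have "hpoly d (\<lambda>x. sD r b (\<lambda>x. (x \<bullet> c) * p x) x + \<kappa> * of_int (d + 1) * (x \<bullet> b) * ((x \<bullet> c) * p x))"
    by (rule hpoly_cong) (use p in \<open>simp add: sD_mult smooth_on_coord sD_coord algebra_simps\<close>)
  then show ?case by simp
next
  case (hpoly_add d p q)
  have pq: "smooth_on S p" "smooth_on S q" by (auto intro: hpoly_smooth hpoly_add)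
  have "hpoly (d - 1) (\<lambda>x. (sD r b p x + \<kappa> * of_int d * (x \<bullet> b) * p x) + (sD r b q x + \<kappa> * of_int d * (x \<bullet> b) * q x))"
    by (rule hpoly.hpoly_add[OF hpoly_add(3,4)]) fact+
  then show ?case
    by (rule hpoly_cong) (use pq in \<open>simp add: sD_add algebra_simps\<close>)
next
  case (hpoly_cong d p q)
  have "sD r b p x = sD r b q x" if "x \<in> S" for x
    using sD_cong[OF that hpoly_cong(2)] by simp
  with hpoly_cong show ?case by (intro hpoly.hpoly_cong[OF hpoly_cong(3)]) auto
qed

text \<open>The eigenvalue of the Laplacian on spherical harmonics of degree \<open>d\<close>, that
  is d (d + m - 1) / r^2.\<close>

definition lam :: "int \<Rightarrow> real" where "lam d = \<kappa> * of_int d * (of_int d + m - 1)"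

lemma lam_Suc: "lam (d + 1) = lam d + \<kappa> * (2 * of_int d + m)"
  by (simp add: lam_def algebra_simps)

text \<open>The gradient of a coordinate is the projection of its basis vector, so the cross term of
  the product rule is \<open>sD r c p\<close>. Both the degree count for \<open>slap\<close> and the
  raising of harmonics rest on this.\<close>

lemma slap_coord_mult:
  assumes x: "x \<in> S" and p: "smooth_on S p" and c: "c \<in> Basis"
  shows "slap r (\<lambda>x. (x \<bullet> c) * p x) x = (x \<bullet> c) * slap r p x + \<kappa> * m * (x \<bullet> c) * p x - 2 * sD r c p x"
proof -
  have l: "linear (\<lambda>x. x \<bullet> c)" by (auto intro!: linearI simp: inner_add_left)
  have "(\<Sum>b\<in>Basis. sD r b (\<lambda>x. x \<bullet> c) x * sD r b p x)
      = (\<Sum>b\<in>Basis. (c \<bullet> b) *\<^sub>R sD r b p x) - \<kappa> * (x \<bullet> c) * (\<Sum>b\<in>Basis. (x \<bullet> b) *\<^sub>R sD r b p x)"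
    using x by (simp add: sD_coord sum_distrib_left flip: sum_subtractf)
      (simp add: inner_commute algebra_simps)
  also have "\<dots> = sD r c p x"
    using sD_expand[OF x p, of c] sum_coord_sD[OF x p] by simp
  finally show ?thesis
    using slap_bilinear[OF bounded_bilinear_mult x smooth_on_coord p, of c] slap_linear[OF l x]
    by (simp add: algebra_simps)
qed

text \<open>In polar coordinates the difference is minus the ambient Laplacian of a homogeneous
  representative, which lowers the degree by 2. Induction over \<open>hpoly\<close> avoids choosing
  a representative.\<close>

lemma hpoly_slap: "hpoly d p \<Longrightarrow> hpoly (d - 2) (\<lambda>x. slap r p x - lam d * p x)"
proof (induction rule: hpoly.induct)
  case (hpoly_zero p d)
  have "slap r p x = 0" if "x \<in> S" for x
    using slap_cong[OF that, of p "\<lambda>x. 0"] hpoly_zero(1) that by simp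
  then show ?case using hpoly_zero by (intro hpoly.hpoly_zero) simp
next
  case (hpoly_const c)
  then show ?case by (intro hpoly.hpoly_zero) (simp add: lam_def)
next
  case (hpoly_coord d p c)
  have p: "smooth_on S p" using hpoly_coord(1) by (rule hpoly_smooth)
  have "hpoly (d - 2 + 1) (\<lambda>x. (x \<bullet> c) * (slap r p x - lam d * p x))"
    using hpoly_coord by (intro hpoly.hpoly_coord) auto
  then have "hpoly (d - 1) (\<lambda>x. (x \<bullet> c) * (slap r p x - lam d * p x)
      - 2 * (sD r c p x + \<kappa> * of_int d * (x \<bullet> c) * p x))"
    using hpoly_coord by (intro hpoly_diff hpoly_cmult hpoly_sD) auto
  then have "hpoly (d - 1) (\<lambda>x. slap r (\<lambda>x. (x \<bullet> c) * p x) x - lam (d + 1) * ((x \<bullet> c) * p x))"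
  proof (rule hpoly_cong)
    fix x assume x: "x \<in> S"
    show "(x \<bullet> c) * (slap r p x - lam d * p x) - 2 * (sD r c p x + \<kappa> * of_int d * (x \<bullet> c) * p x)
        = slap r (\<lambda>x. (x \<bullet> c) * p x) x - lam (d + 1) * ((x \<bullet> c) * p x)"
      unfolding slap_coord_mult[OF x p hpoly_coord(2)] lam_Suc by (simp add: algebra_simps)
  qed
  then show ?case by simp
next
  case (hpoly_add d p q)
  have pq: "smooth_on S p" "smooth_on S q" by (auto intro: hpoly_smooth hpoly_add)
  have "hpoly (d - 2) (\<lambda>x. (slap r p x - lam d * p x) + (slap r q x - lam d * q x))"
    by (rule hpoly.hpoly_add[OF hpoly_add(3,4)])
  then show ?case
    by (rule hpoly_cong) (use pq in \<open>simp add: slap_add algebra_simps\<close>)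
next
  case (hpoly_cong d p q)
  have "slap r p x = slap r q x" if "x \<in> S" for x
    using slap_cong[OF that hpoly_cong(2)] by simp
  with hpoly_cong show ?case by (intro hpoly.hpoly_cong[OF hpoly_cong(3)]) auto
qed

lemma hpoly_slap': "hpoly d p \<Longrightarrow> hpoly d (slap r p)"
  using hpoly_add[of d "\<lambda>x. slap r p x - lam d * p x" "\<lambda>x. lam d * p x"] hpoly_shift[OF hpoly_slap, of d p]
    hpoly_cmult[of d p "lam d"] by simp

section \<open>Orthogonal projection onto the polynomials of one degree\<close>

primrec monomials :: "nat \<Rightarrow> ('a \<Rightarrow> real) set" where
  "monomials 0 = {\<lambda>x. 1}"
| "monomials (Suc k) = (\<Union>b\<in>Basis. (\<lambda>p x. (x \<bullet> b) * p x) ` monomials k)"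

lemma finite_monomials: "finite (monomials k)"
  by (induction k) auto

lemma hpoly_monomials: "p \<in> monomials k \<Longrightarrow> hpoly (int k) p"
proof (induction k arbitrary: p)
  case (Suc k)
  then show ?case using hpoly_coord[of "int k"] by (auto simp: add.commute)
qed (simp add: hpoly_const)

lemma hpoly_span_monomials: "p \<in> span (monomials k) \<Longrightarrow> hpoly (int k) p"
proof (induction rule: span_induct_alt)
  case base
  then show ?case by (rule hpoly_zero) simp
next
  case (step c x y)
  have "hpoly (int k) (\<lambda>z. c * x z + y z)"
    by (intro hpoly_add hpoly_cmult step hpoly_monomials)
  then show ?case by (simp add: scaleR_fun_def plus_fun_def)
qed

lemma hpoly_imp_span_monomials:
  "hpoly d p \<Longrightarrow> 0 \<le> d \<Longrightarrow> \<exists>p'\<in>span (monomials (nat d)). \<forall>x\<in>S. p x = p' x"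
proof (induction rule: hpoly.induct)
  case (hpoly_zero p d)
  then show ?case by (intro bexI[of _ 0]) (auto simp: span_zero)
next
  case (hpoly_const c)
  have "c *\<^sub>R (\<lambda>x. 1) \<in> span (monomials 0)" by (intro span_scale span_base) simp
  then show ?case by (auto simp: scaleR_fun_def intro!: bexI[of _ "\<lambda>x. c"])
next
  case (hpoly_coord d p b)
  show ?case
  proof (cases "d < 0")
    case True
    then have "p x = 0" if "x \<in> S" for x using hpoly_neg[OF hpoly_coord(1)] that by simp
    then show ?thesis by (intro bexI[of _ 0]) (auto simp: span_zero)
  next
    case False
    then obtain p' where p': "p' \<in> span (monomials (nat d))" "\<forall>x\<in>S. p x = p' x"
      using hpoly_coord by auto
    have "linear (\<lambda>(p::'a \<Rightarrow> real) x. (x \<bullet> b) * p x)"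
      by (intro linearI) (auto simp: scaleR_fun_def fun_eq_iff algebra_simps)
    from linear_span_image[OF this, of "monomials (nat d)"] p'(1)
    have "(\<lambda>x. (x \<bullet> b) * p' x) \<in> span ((\<lambda>p x. (x \<bullet> b) * p x) ` monomials (nat d))" by auto
    moreover have "(\<lambda>p x. (x \<bullet> b) * p x) ` monomials (nat d) \<subseteq> monomials (nat (d + 1))"
      using False hpoly_coord(2) by (auto simp: Suc_nat_eq_nat_zadd1[symmetric] add.commute)
    ultimately have "(\<lambda>x. (x \<bullet> b) * p' x) \<in> span (monomials (nat (d + 1)))"
      using span_mono by blast
    then show ?thesis using p'(2) by (intro bexI[of _ "\<lambda>x. (x \<bullet> b) * p' x"]) auto
  qed
next
  case (hpoly_add d p q)
  then obtain p' q' where "p' \<in> span (monomials (nat d))" "\<forall>x\<in>S. p x = p' x"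
    "q' \<in> span (monomials (nat d))" "\<forall>x\<in>S. q x = q' x" by auto
  then show ?case by (intro bexI[of _ "p' + q'"]) (auto intro: span_add)
next
  case (hpoly_cong d p q)
  then show ?case by auto
qed

lemma exists_hpoly_projection:
  assumes "smooth_on S f"
  shows "\<exists>p. hpoly d p \<and> (\<forall>q. hpoly d q \<longrightarrow> ip (\<lambda>x. f x - p x) q = 0)"
proof (cases "d < 0")
  case True
  have "ip (\<lambda>x. f x - 0) q = 0" if "hpoly d q" for q
  proof -
    have "ip (\<lambda>x. f x - 0) q = ip f (\<lambda>x. 0)" using hpoly_neg[OF that True] by (intro ip_cong) auto
    then show ?thesis by (simp add: ip_def)
  qed
  then show ?thesis by (intro exI[of _ "\<lambda>x. 0"]) (auto intro: hpoly_zero)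
next
  case False
  have "\<exists>p\<in>span (monomials (nat d)). \<forall>q\<in>span (monomials (nat d)). ip (\<lambda>x. f x - p x) q = 0"
    by (intro exists_projection finite_monomials assms hpoly_smooth[OF hpoly_monomials])
  then obtain p where p: "p \<in> span (monomials (nat d))"
    "\<And>q. q \<in> span (monomials (nat d)) \<Longrightarrow> ip (\<lambda>x. f x - p x) q = 0" by blast
  have "hpoly d p" using hpoly_span_monomials[OF p(1)] False by simp
  moreover have "ip (\<lambda>x. f x - p x) q = 0" if q: "hpoly d q" for q
  proof -
    obtain q' where q': "q' \<in> span (monomials (nat d))" "\<And>x. x \<in> S \<Longrightarrow> q x = q' x"
      using hpoly_imp_span_monomials[OF q] False by auto
    have "ip (\<lambda>x. f x - p x) q = ip (\<lambda>x. f x - p x) q'" by (rule ip_cong[OF refl q'(2)])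
    then show ?thesis using p(2)[OF q'(1)] by simp
  qed
  ultimately show ?thesis by (intro exI[of _ p]) simp
qed

definition hproj :: "int \<Rightarrow> ('a \<Rightarrow> real) \<Rightarrow> 'a \<Rightarrow> real" where
  "hproj d f = (SOME p. hpoly d p \<and> (\<forall>q. hpoly d q \<longrightarrow> ip (\<lambda>x. f x - p x) q = 0))"

lemma hproj:
  assumes "smooth_on S f"
  shows "hpoly d (hproj d f)" "hpoly d q \<Longrightarrow> ip (hproj d f) q = ip f q"
proof -
  note * = someI_ex[OF exists_hpoly_projection[OF assms], of d, folded hproj_def]
  then show h: "hpoly d (hproj d f)" by simp
  assume q: "hpoly d q"
  then have "ip (\<lambda>x. f x - hproj d f x) q = 0" using * by blast
  then show "ip (hproj d f) q = ip f q"
    using assms hpoly_smooth[OF q] hpoly_smooth[OF h] by (simp add: ip_diff_left)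
qed


subsection \<open>Spherical harmonics\<close>

text \<open>Homogeneous polynomials of degree d split into the harmonic ones and the multiples of
  |x|^2; on \<open>S\<close> the latter are the polynomials of degree \<open>d - 2\<close>.
  Orthogonality to them thus encodes harmonicity without an ambient Laplacian.\<close>

definition harmonics :: "int \<Rightarrow> ('a \<Rightarrow> real) \<Rightarrow> bool" where
  "harmonics d p \<longleftrightarrow> hpoly d p \<and> (\<forall>q. hpoly (d - 2) q \<longrightarrow> ip p q = 0)"

lemma harmonics_smooth: "harmonics d p \<Longrightarrow> smooth_on S p"
  using hpoly_smooth by (auto simp: harmonics_def)

lemma harmonics_zero: "harmonics d (\<lambda>x. 0)"
  by (auto simp: harmonics_def ip_def intro: hpoly_zero)

lemma harmonics_add: "harmonics d p \<Longrightarrow> harmonics d q \<Longrightarrow> harmonics d (\<lambda>x. p x + q x)"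
  using hpoly_smooth[of d p] hpoly_smooth[of d q] hpoly_smooth[of "d - 2"]
  by (simp add: harmonics_def hpoly_add ip_add_left)

lemma harmonics_cmult: "harmonics d p \<Longrightarrow> harmonics d (\<lambda>x. c * p x)"
  by (auto simp: harmonics_def hpoly_cmult ip_mult_left)

text \<open>The error \<open>e\<close> has degree \<open>d - 2\<close>. As \<open>slap\<close> is
  symmetric and keeps that degree, \<open>e\<close> is orthogonal to itself, and
  \<open>ip_null\<close> yields the eigenvalue equation tested against any smooth
  \<open>g\<close>.\<close>

lemma harmonics_slap:
  assumes p: "harmonics d p" and g: "smooth_on S g"
  shows "ip (slap r p) g = lam d * ip p g"
proof -
  define e where "e x = slap r p x - lam d * p x" for x
  have sp: "smooth_on S p" using p by (rule harmonics_smooth)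
  have e: "hpoly (d - 2) e" using p hpoly_slap[of d p] by (simp add: e_def[abs_def] harmonics_def)
  have eip: "ip e q = ip (slap r p) q - lam d * ip p q" if "smooth_on S q" for q
    unfolding e_def[abs_def] using sp that by (simp add: ip_diff_left ip_mult_left smooth_intros)
  have "ip e e = ip p (slap r e) - lam d * ip p e"
    using eip[of e] hpoly_smooth[OF e] sp by (simp add: ip_slap)
  also have "\<dots> = 0" using p e hpoly_slap'[OF e] by (simp add: harmonics_def)
  finally have "ip e g = 0" using ip_null(2)[OF g hpoly_smooth[OF e]] by simp
  then show ?thesis using eip[OF g] by simp
qed

lemma lam_strict_mono:
  assumes "0 \<le> i" "i < j"
  shows "lam i < lam j"
proof -
  have "lam j - lam i = \<kappa> * (of_int j - of_int i) * (of_int i + of_int j + m - 1)"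
    by (simp add: lam_def algebra_simps)
  moreover have "of_int j - of_int i > (0::real)" using assms by simp
  moreover have "of_int i + of_int j + m - 1 > 0"
    using assms m_ge of_int_0_le_iff[of i, where 'a = real] of_int_0_less_iff[of j, where 'a = real] by linarith
  ultimately have "lam j - lam i > 0" using \<kappa>_pos by simp
  then show ?thesis by simp
qed

text \<open>The definition compares degrees of equal parity only; symmetry of \<open>slap\<close>
  with distinct eigenvalues covers all pairs.\<close>

lemma harmonics_orthogonal:
  assumes "harmonics (int i) p" "harmonics (int j) q" "i \<noteq> j"
  shows "ip p q = 0"
proof -
  have "lam (int i) * ip p q = lam (int j) * ip p q"
    using harmonics_slap[OF assms(1) harmonics_smooth[OF assms(2)]]
      harmonics_slap[OF assms(2) harmonics_smooth[OF assms(1)]]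
      ip_slap[OF harmonics_smooth[OF assms(1)] harmonics_smooth[OF assms(2)]]
    by (simp add: ip_commute)
  moreover have "lam (int i) \<noteq> lam (int j)"
    using assms(3) lam_strict_mono[of "int i" "int j"] lam_strict_mono[of "int j" "int i"] by linarith
  ultimately show ?thesis by simp
qed

text \<open>Degree \<open>k - 2\<close> lies inside degree \<open>k\<close> on \<open>S\<close>, so
  the difference is the projection onto the complement, the harmonics. For \<open>k < 2\<close> the
  integer degree is negative and the subtracted term vanishes on \<open>S\<close>.\<close>

definition pr :: "nat \<Rightarrow> ('a \<Rightarrow> real) \<Rightarrow> 'a \<Rightarrow> real" where
  "pr k f x = hproj (int k) f x - hproj (int k - 2) f x"

lemma pr_harmonics:
  assumes "smooth_on S f"
  shows "harmonics (int k) (pr k f)"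
  unfolding harmonics_def pr_def[abs_def]
proof (intro conjI allI impI)
  have s: "hpoly (int k) (hproj (int k - 2) f)"
    using hpoly_shift[OF hproj(1)[OF assms, of "int k - 2"]] by simp
  show "hpoly (int k) (\<lambda>x. hproj (int k) f x - hproj (int k - 2) f x)"
    by (intro hpoly_diff hproj assms s)
  fix q assume q: "hpoly (int k - 2) q"
  have "hpoly (int k) q" using hpoly_shift[OF q] by simp
  then show "ip (\<lambda>x. hproj (int k) f x - hproj (int k - 2) f x) q = 0"
    using q s hproj[OF assms] by (simp add: ip_diff_left hpoly_smooth[OF hproj(1)[OF assms]] hpoly_smooth)
qed

lemma pr_smooth: "smooth_on S f \<Longrightarrow> smooth_on S (pr k f)"
  using harmonics_smooth pr_harmonics by blast

lemma ip_pr_harmonics: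
  assumes f: "smooth_on S f" and q: "harmonics (int k) q"
  shows "ip (pr k f) q = ip f q"
proof -
  have "ip (hproj (int k - 2) f) q = 0"
    using q hproj(1)[OF f, of "int k - 2"] ip_commute[of _ q] by (simp add: harmonics_def)
  then show ?thesis
    using hproj(2)[OF f, of "int k" q] q hpoly_smooth[OF hproj(1)[OF f]] harmonics_smooth[OF q]
    by (simp add: pr_def[abs_def] ip_diff_left harmonics_def)
qed

lemma ip_pr:
  assumes "smooth_on S f" "smooth_on S g"
  shows "ip (pr k f) (pr k g) = ip f (pr k g)" "ip f (pr k g) = ip (pr k f) g"
  using ip_pr_harmonics[OF assms(1) pr_harmonics[OF assms(2)], of k]
    ip_pr_harmonics[OF assms(2) pr_harmonics[OF assms(1)], of k]
  by (simp_all add: ip_commute)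

lemma ip_slap_pr:
  assumes "smooth_on S f" "smooth_on S g"
  shows "ip (slap r f) (pr k g) = lam (int k) * ip f (pr k g)"
  using harmonics_slap[OF pr_harmonics[OF assms(2)] assms(1), of k] ip_slap[OF assms(1) pr_smooth[OF assms(2)], of k]
  by (simp add: ip_commute)

section \<open>Polynomials as finite sums of harmonics\<close>

definition harmonic_sum :: "('a \<Rightarrow> real) \<Rightarrow> bool" where
  "harmonic_sum p \<longleftrightarrow> (\<exists>N e. (\<forall>k. harmonics (int k) (e k)) \<and> (\<forall>x\<in>S. p x = (\<Sum>k<N. e k x)))"

lemma harmonic_sumI:
  "(\<And>k. harmonics (int k) (e k)) \<Longrightarrow> (\<And>x. x \<in> S \<Longrightarrow> p x = (\<Sum>k<N. e k x)) \<Longrightarrow> harmonic_sum p"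
  unfolding harmonic_sum_def by blast

lemma harmonic_sum_add:
  assumes "harmonic_sum p" "harmonic_sum q"
  shows "harmonic_sum (\<lambda>x. p x + q x)"
proof -
  obtain N e where e: "\<And>k. harmonics (int k) (e k)" "\<And>x. x \<in> S \<Longrightarrow> p x = (\<Sum>k<N. e k x)"
    using assms(1) unfolding harmonic_sum_def by blast
  obtain M f where f: "\<And>k. harmonics (int k) (f k)" "\<And>x. x \<in> S \<Longrightarrow> q x = (\<Sum>k<M. f k x)"
    using assms(2) unfolding harmonic_sum_def by blast
  define h where "h k x = (if k < N then e k x else 0) + (if k < M then f k x else 0)" for k x
  show ?thesis
  proof (rule harmonic_sumI)
    show "harmonics (int k) (h k)" for k
      unfolding h_def[abs_def] using e(1)[of k] f(1)[of k]
      by (cases "k < N"; cases "k < M") (simp_all add: harmonics_zero harmonics_add)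
    fix x assume "x \<in> S"
    have "(\<Sum>k<max N M. h k x) = (\<Sum>k\<in>{..<max N M} \<inter> {k. k < N}. e k x) + (\<Sum>k\<in>{..<max N M} \<inter> {k. k < M}. f k x)"
      by (simp add: h_def sum.distrib sum.inter_restrict)
    also have "{..<max N M} \<inter> {k. k < N} = {..<N}" by auto
    also have "{..<max N M} \<inter> {k. k < M} = {..<M}" by auto
    finally show "p x + q x = (\<Sum>k<max N M. h k x)" using e f \<open>x \<in> S\<close> by simp
  qed
qed

lemma harmonics_harmonic_sum:
  assumes "harmonics (int d) p"
  shows "harmonic_sum p"
proof (rule harmonic_sumI)
  show "harmonics (int k) (if k = d then p else (\<lambda>x. 0))" for k
    using assms by (simp add: harmonics_zero)
  show "p x = (\<Sum>k<Suc d. (if k = d then p else (\<lambda>x. 0)) x)" for x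
    by (simp add: if_distrib[of "\<lambda>f. f x"] cong: if_cong)
qed

lemma hpoly_harmonic_sum: "hpoly d p \<Longrightarrow> harmonic_sum p"
proof (induction "nat d" arbitrary: d p rule: less_induct)
  case less
  show ?case
  proof (cases "d < 0")
    case True
    then show ?thesis
      using hpoly_neg[OF less.prems True] harmonics_zero by (intro harmonic_sumI[of "\<lambda>k x. 0"]) auto
  next
    case False
    define q where "q = hproj (d - 2) p"
    have p: "smooth_on S p" using less.prems by (rule hpoly_smooth)
    have q: "hpoly (d - 2) q" unfolding q_def by (rule hproj(1)[OF p])
    have "harmonics d (\<lambda>x. p x - q x)"
      unfolding harmonics_def using less.prems hpoly_shift[OF q] q p hproj(2)[OF p, of "d - 2"]
        hpoly_smooth[OF q] hpoly_smooth[of "d - 2"]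
      by (simp add: hpoly_diff ip_diff_left flip: q_def)
    then have "harmonic_sum (\<lambda>x. p x - q x)"
      using harmonics_harmonic_sum[of "nat d"] False by simp
    moreover have "harmonic_sum q"
    \<comment> \<open>For \<open>d = 0\<close> the induction measure \<open>nat (d - 2)\<close> does
      not drop, but \<open>q\<close> then has negative degree and vanishes on
      \<open>S\<close>.\<close>
    proof (cases "d = 0")
      case True
      then show ?thesis
        using hpoly_neg[OF q] harmonics_zero by (intro harmonic_sumI[of "\<lambda>k x. 0"]) auto
    next
      case False
      then show ?thesis using q less.hyps[of "d - 2"] \<open>\<not> d < 0\<close> by simp
    qed
    ultimately show ?thesis using harmonic_sum_add[of "\<lambda>x. p x - q x" q] by simp
  qed
qed

section \<open>Completeness of the spherical harmonics\<close>

inductive hpolys :: "('a \<Rightarrow> real) \<Rightarrow> bool" where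
  hpolys_base: "hpoly d p \<Longrightarrow> hpolys p"
| hpolys_add: "hpolys p \<Longrightarrow> hpolys q \<Longrightarrow> hpolys (\<lambda>x. p x + q x)"

lemma hpolys_mult: "hpolys p \<Longrightarrow> hpolys q \<Longrightarrow> hpolys (\<lambda>x. p x * q x)"
proof (induction rule: hpolys.induct)
  case (hpolys_base d p)
  from hpolys_base(2,1) show ?case
  proof (induction rule: hpolys.induct)
    case (hpolys_base e q)
    then show ?case using hpoly_mult hpolys.hpolys_base by blast
  next
    case (hpolys_add q q')
    then show ?case using hpolys.hpolys_add by (simp add: distrib_left)
  qed
next
  case (hpolys_add p p')
  then show ?case using hpolys.hpolys_add by (simp add: distrib_right)
qed

lemma polynomial_hpolys: "real_polynomial_function p \<Longrightarrow> hpolys p"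
proof (induction rule: real_polynomial_function.induct)
  case (linear f)
  interpret bounded_linear f by fact
  have "hpoly (0 + 1) (\<lambda>x. \<Sum>b\<in>Basis. (x \<bullet> b) * f b)"
    by (intro hpoly_sum hpoly_coord hpoly_const)
  moreover have "(\<Sum>b\<in>Basis. (x \<bullet> b) * f b) = f x" for x
    using sum[of "\<lambda>b. (x \<bullet> b) *\<^sub>R b" Basis] by (simp add: euclidean_representation scaleR)
  ultimately show ?case by (auto intro: hpolys_base)
qed (auto intro: hpolys_mult hpolys_add hpolys_base hpoly_const)

lemma polynomial_harmonic_sum: "real_polynomial_function p \<Longrightarrow> harmonic_sum p"
proof (drule polynomial_hpolys, induction rule: hpolys.induct)
qed (auto intro: hpoly_harmonic_sum harmonic_sum_add)

text \<open>The remainder \<open>R N\<close> is orthogonal to all degrees below \<open>N\<close>,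
  hence is no longer than the error of any approximation by such harmonics. Stone-Weierstrass makes
  that error small, and Cauchy-Schwarz transfers the limit to \<open>ip f\<close>.\<close>

theorem Parseval:
  assumes f: "smooth_on S f" and g: "smooth_on S g"
  shows "(\<lambda>k. ip f (pr k g)) sums ip f g"
proof -
  interpret finite_measure \<mu> by (rule finite_\<mu>)
  define R where "R N x = g x - (\<Sum>k<N. pr k g x)" for N x
  have sR: "smooth_on S (R N)" for N
    unfolding R_def[abs_def] by (intro smooth_intros g pr_smooth)
  have R_orth: "ip (R N) e = 0" if "k < N" and e: "harmonics (int k) e" for N k e
  proof -
    have "(\<Sum>i<N. ip (pr i g) e) = (\<Sum>i<N. if i = k then ip g e else 0)"
      using harmonics_orthogonal[OF pr_harmonics[OF g] e] ip_pr_harmonics[OF g e]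
      by (intro sum.cong) auto
    then show ?thesis
      unfolding R_def[abs_def] using that harmonics_smooth[OF e] g pr_smooth[OF g]
      by (simp add: ip_diff_left ip_sum_left smooth_intros)
  qed
  \<comment> \<open>Pythagoras: \<open>g - p\<close> is \<open>R N + q\<close>, where
    \<open>q\<close> combines harmonics of degree below \<open>N\<close> and is orthogonal to
    \<open>R N\<close>.\<close>
  have R_min: "ip (R N) (R N) \<le> ip (\<lambda>x. g x - p x) (\<lambda>x. g x - p x)"
    if N: "M \<le> N" and e: "\<And>k. harmonics (int k) (e k)" "\<And>x. x \<in> S \<Longrightarrow> p x = (\<Sum>k<M. e k x)"
    for M N e p
  proof -
    define q where "q x = (\<Sum>k<N. pr k g x) - (\<Sum>k<M. e k x)" for x
    have sq: "smooth_on S q"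
      unfolding q_def[abs_def] by (intro smooth_intros pr_smooth g harmonics_smooth[OF e(1)])
    have "ip q (R N) = 0"
    proof -
      have "ip q (R N) = (\<Sum>k<N. ip (pr k g) (R N)) - (\<Sum>k<M. ip (e k) (R N))"
        unfolding q_def[abs_def] using sR[of N] pr_smooth[OF g] harmonics_smooth[OF e(1)]
        by (simp add: ip_diff_left ip_sum_left smooth_intros)
      moreover have "ip (pr k g) (R N) = 0" if "k < N" for k
        using R_orth[OF that pr_harmonics[OF g]] by (simp add: ip_commute)
      moreover have "ip (e k) (R N) = 0" if "k < M" for k
        using R_orth[OF _ e(1), of k N] that N by (simp add: ip_commute)
      ultimately show ?thesis by simp
    qed
    then have "ip (\<lambda>x. R N x + q x) (\<lambda>x. R N x + q x) = ip (R N) (R N) + ip q q"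
      using sR[of N] sq by (simp add: ip_add_left ip_add_right smooth_intros ip_commute[of "R N" q])
    moreover have "ip (\<lambda>x. R N x + q x) (\<lambda>x. R N x + q x) = ip (\<lambda>x. g x - p x) (\<lambda>x. g x - p x)"
      using e(2) by (intro ip_cong) (auto simp: R_def q_def)
    ultimately show ?thesis using ip_self_nonneg[of q] by simp
  qed
  have "(\<lambda>N. ip (R N) (R N)) \<longlonglongrightarrow> 0"
  proof (rule LIMSEQ_I)
    fix \<epsilon> :: real assume \<epsilon>: "\<epsilon> > 0"
    define \<delta> where "\<delta> = sqrt (\<epsilon> / (2 * measure \<mu> S))"
    have \<delta>: "\<delta> > 0" "\<delta>\<^sup>2 * measure \<mu> S = \<epsilon> / 2" using \<epsilon> measure_\<mu>_pos by (auto simp: \<delta>_def)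
    obtain p where p: "real_polynomial_function p" "\<And>x. x \<in> S \<Longrightarrow> \<bar>g x - p x\<bar> < \<delta>"
      using Stone_Weierstrass_real_polynomial_function[OF compact_S smooth_on_imp_continuous_on[OF g] \<delta>(1)] by blast
    obtain M e where e: "\<And>k. harmonics (int k) (e k)" "\<And>x. x \<in> S \<Longrightarrow> p x = (\<Sum>k<M. e k x)"
      using polynomial_harmonic_sum[OF p(1)] unfolding harmonic_sum_def by blast
    have smp: "smooth_on S (\<lambda>x. g x - p x)"
      by (rule smooth_on_cong[of S "\<lambda>x. g x - (\<Sum>k<M. e k x)"])
         (intro smooth_intros g harmonics_smooth[OF e(1)], simp add: e(2))
    have "ip (\<lambda>x. g x - p x) (\<lambda>x. g x - p x) \<le> sint (\<lambda>x. \<delta>\<^sup>2)"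
      unfolding ip_def
    proof (rule integral_mono)
      show "integrable \<mu> (\<lambda>x. (g x - p x) \<bullet> (g x - p x))"
        by (intro integrable_smooth smooth_intros smp)
      fix x assume "x \<in> space \<mu>"
      then have "\<bar>g x - p x\<bar> \<le> \<delta>" using p(2)[of x] by simp
      then have "\<bar>g x - p x\<bar>\<^sup>2 \<le> \<delta>\<^sup>2" by (intro power_mono) auto
      then show "(g x - p x) \<bullet> (g x - p x) \<le> \<delta>\<^sup>2" by (simp add: power2_eq_square)
    qed simp
    also have "\<dots> < \<epsilon>" using \<delta>(2) \<epsilon> by (simp add: mult.commute)
    finally have "norm (ip (R N) (R N) - 0) < \<epsilon>" if "N \<ge> M" for N
      using R_min[OF that e] ip_self_nonneg[of "R N"] by simp
    then show "\<exists>no. \<forall>n\<ge>no. norm (ip (R n) (R n) - 0) < \<epsilon>" by blast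
  qed
  then have "(\<lambda>N. ip f f * ip (R N) (R N)) \<longlonglongrightarrow> 0" using tendsto_mult_right_zero by blast
  then have "(\<lambda>N. (ip f (R N))\<^sup>2) \<longlonglongrightarrow> 0"
    by (rule Lim_null_comparison[rotated]) (use ip_Cauchy_Schwarz[OF f sR] in \<open>auto intro!: always_eventually\<close>)
  then have "(\<lambda>N. ip f (R N)) \<longlonglongrightarrow> 0"
    using tendsto_real_sqrt[of "\<lambda>N. (ip f (R N))\<^sup>2" 0] by (simp add: tendsto_rabs_zero_iff)
  moreover have "ip f (R N) = ip f g - (\<Sum>k<N. ip f (pr k g))" for N
    using f g pr_smooth[OF g] unfolding R_def[abs_def]
    by (simp add: ip_diff_right smooth_intros ip_commute[of f "\<lambda>x. \<Sum>k<N. pr k g x"] ip_sum_left)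
      (simp add: ip_commute)
  ultimately show ?thesis
    unfolding sums_def using tendsto_diff[OF tendsto_const, of "\<lambda>N. ip f g - (\<Sum>k<N. ip f (pr k g))" 0 _ "ip f g"]
    by simp
qed

end


subsection \<open>The stability inequality\<close>

text \<open>The left side is 4 * 2 times the norm factor of the raised field for \<kappa> = 2; the
  right side is the coefficient of \<Delta> (\<Delta> - 2 m) in degree \<open>k + 1\<close>. At
  \<open>k = 1\<close> the bound fails for \<open>m > 2\<close>.\<close>

lemma divergence_coefficient_bound:
  assumes "2 \<le> (k::real)" "1 \<le> (m::real)"
  shows "16 * (k + m - 1) * (2 * k + m - 1) \<le> 4 * k * (k + 1) * (k + m) * (k + m + 1)"
proof -
  have "4 * (2 * k + m - 1) \<le> k * (k + 1) * (k + m + 1)"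
  proof -
    have "4 * (2 * k + m - 1) \<le> 3 * k * (k + m + 1)"
    proof -
      have "4 * (2 * k + m - 1) \<le> 3 * (2 * k) + 3 * (2 * m) + 3 * k" using assms by simp
      also have "\<dots> \<le> 3 * (k * k) + 3 * (k * m) + 3 * k"
        using assms by (intro add_mono mult_left_mono mult_right_mono) auto
      finally show ?thesis by (simp add: algebra_simps)
    qed
    also have "\<dots> \<le> k * (k + 1) * (k + m + 1)" using assms by (intro mult_right_mono) auto
    finally show ?thesis .
  qed
  from mult_mono[OF _ this, of "k + m - 1" "k + m"] assms
  have "(k + m - 1) * (4 * (2 * k + m - 1)) \<le> (k + m) * (k * (k + 1) * (k + m + 1))"
    by simp
  then show ?thesis by (simp add: algebra_simps)
qed

text \<open>The right side is half the coefficient of \<Delta> (\<Delta> - 2 m) in degree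
  \<open>k\<close>, the share contributed by the last component of a section.\<close>

lemma radial_coefficient_bound:
  assumes "2 \<le> (k::real)" "1 \<le> (m::real)"
  shows "8 * (k - 1)\<^sup>2 \<le> 2 * k * (k - 1) * (k + m - 1) * (k + m)"
proof -
  have "4 * (k - 1) \<le> k * 2 * 2" using assms by simp
  also have "\<dots> \<le> k * (k + m - 1) * (k + m)" using assms by (intro mult_mono) auto
  finally have "2 * (k - 1) * (4 * (k - 1)) \<le> 2 * (k - 1) * (k * (k + m - 1) * (k + m))"
    using assms by (intro mult_left_mono) auto
  then show ?thesis by (simp add: power2_eq_square algebra_simps)
qed

context round_sphere
begin

text \<open>For harmonic \<open>g\<close> of degree \<open>d\<close> the functions \<open>\<kappa> (d + m - 1) x\<^sub>b g - \<partial>\<^sub>b g\<close> are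
  \<open>(\<Delta> - \<lambda>\<^bsub>d-1\<^esub>)(x\<^sub>b g) / 2\<close>, which is the component of \<open>x\<^sub>b g\<close> of degree \<open>d + 1\<close> up to a factor.\<close>

lemma harmonics_raise:
  assumes g: "harmonics d g" and b: "b \<in> Basis"
  shows "harmonics (d + 1) (\<lambda>x. \<kappa> * (of_int d + m - 1) * ((x \<bullet> b) * g x) - sD r b g x)"
proof -
  have hg: "hpoly d g" and sg: "smooth_on S g"
    using g harmonics_smooth by (auto simp: harmonics_def)
  define xg where "xg x = (x \<bullet> b) * g x" for x
  define G where "G x = \<kappa> * (of_int d + m - 1) * xg x - sD r b g x" for x
  have hxg: "hpoly (d + 1) xg" unfolding xg_def[abs_def] by (rule hpoly_coord[OF hg b])
  have sxg: "smooth_on S xg" by (rule hpoly_smooth[OF hxg])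
  have "hpoly (d - 1 + 2) (\<lambda>x. sD r b g x + \<kappa> * of_int d * (x \<bullet> b) * g x)"
    by (rule hpoly_shift[OF hpoly_sD[OF hg b]])
  moreover have "d - 1 + 2 = d + 1" by simp
  ultimately have "hpoly (d + 1) (\<lambda>x. sD r b g x + \<kappa> * of_int d * (x \<bullet> b) * g x)" by metis
  from hpoly_diff[OF hpoly_cmult[OF hxg, of "\<kappa> * (of_int d + m - 1) + \<kappa> * of_int d"] this]
  have hG: "hpoly (d + 1) G"
    by (rule hpoly_cong) (simp add: G_def xg_def algebra_simps)
  have "ip G q = 0" if q: "hpoly (d - 1) q" for q
  proof -
    have sq: "smooth_on S q" using q by (rule hpoly_smooth)
    define xq where "xq x = (x \<bullet> b) * q x" for x
    have sxq: "smooth_on S xq" unfolding xq_def[abs_def] by (intro smooth_intros sq)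
    define e where "e x = slap r q x - lam (d - 1) * q x" for x
    have se: "smooth_on S e" unfolding e_def[abs_def] by (intro smooth_intros sq)
    have "hpoly (d - 1 - 2 + 1) (\<lambda>x. (x \<bullet> b) * e x)"
      unfolding e_def by (intro hpoly_coord hpoly_slap q b)
    then have xe: "ip g (\<lambda>x. (x \<bullet> b) * e x) = 0" using g by (simp add: harmonics_def)
    \<comment> \<open>The second summand vanishes only weakly, by \<open>harmonics_slap\<close>. In
      the first, \<open>slap\<close> minus \<open>lam (d - 1)\<close> is moved onto
      \<open>q\<close>, giving \<open>e\<close> of degree \<open>d - 3\<close>; a coordinate times
      \<open>e\<close> has degree \<open>d - 2\<close> and is orthogonal to
      \<open>g\<close>.\<close>
    have "ip G q = ip (\<lambda>x. (1/2) * (slap r xg x - lam (d - 1) * xg x)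
        + (1/2) * (lam d * ((x \<bullet> b) * g x) - (x \<bullet> b) * slap r g x)) q"
    proof (rule ip_cong[OF _ refl])
      fix x assume x: "x \<in> S"
      have l: "lam d = lam (d - 1) + \<kappa> * (2 * of_int (d - 1) + m)"
        using lam_Suc[of "d - 1"] by simp
      show "G x = (1/2) * (slap r xg x - lam (d - 1) * xg x)
        + (1/2) * (lam d * ((x \<bullet> b) * g x) - (x \<bullet> b) * slap r g x)"
        unfolding G_def xg_def slap_coord_mult[OF x sg b] l by (simp add: field_simps)
    qed
    also have "\<dots> = (1/2) * (ip (slap r xg) q - lam (d - 1) * ip xg q)
        + (1/2) * (lam d * ip (\<lambda>x. (x \<bullet> b) * g x) q - ip (\<lambda>x. (x \<bullet> b) * slap r g x) q)"
    proof -
      have 1: "smooth_on S (\<lambda>x. lam (d - 1) * xg x)" "smooth_on S (slap r xg)"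
        "smooth_on S (\<lambda>x. lam d * ((x \<bullet> b) * g x))" "smooth_on S (\<lambda>x. (x \<bullet> b) * slap r g x)"
        by (intro smooth_intros sxg sg)+
      have "smooth_on S (\<lambda>x. slap r xg x - lam (d - 1) * xg x)"
        "smooth_on S (\<lambda>x. lam d * ((x \<bullet> b) * g x) - (x \<bullet> b) * slap r g x)"
        by (rule smooth_on_diff[OF 1(2,1)], rule smooth_on_diff[OF 1(3,4)])
      with 1 sq show ?thesis
        by (simp only: ip_add_left ip_diff_left ip_mult_left smooth_on_mult smooth_on_const)
    qed
    also have "ip (slap r xg) q - lam (d - 1) * ip xg q = ip xg e"
      unfolding e_def[abs_def] using sxg sq
      by (simp add: ip_slap ip_diff_right ip_mult_right smooth_intros)
    also have "ip xg e = ip g (\<lambda>x. (x \<bullet> b) * e x)"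
      by (simp add: ip_def xg_def mult_ac)
    also have "ip (\<lambda>x. (x \<bullet> b) * g x) q = ip g xq" by (simp add: ip_def xq_def mult_ac)
    also have "ip (\<lambda>x. (x \<bullet> b) * slap r g x) q = ip (slap r g) xq" by (simp add: ip_def xq_def mult_ac)
    finally show ?thesis using xe harmonics_slap[OF g sxq] by simp
  qed
  then show ?thesis using hG by (simp add: harmonics_def G_def[abs_def] xg_def)
qed

text \<open>The multiple of \<open>x\<close> and the gradient are pointwise orthogonal. With
  \<open>c = \<kappa> * (d + m - 1)\<close> their squared norms contribute
  \<open>c\<^sup>2 / \<kappa>\<close> and \<open>lam d\<close> times \<open>ip g g\<close>.\<close>

lemma harmonics_raise_norm:
  assumes g: "harmonics d g"
  shows "(\<Sum>b\<in>Basis. ip (\<lambda>x. \<kappa> * (of_int d + m - 1) * ((x \<bullet> b) * g x) - sD r b g x)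
      (\<lambda>x. \<kappa> * (of_int d + m - 1) * ((x \<bullet> b) * g x) - sD r b g x))
    = \<kappa> * (of_int d + m - 1) * (2 * of_int d + m - 1) * ip g g"
proof -
  have sg: "smooth_on S g" using g by (rule harmonics_smooth)
  define c where "c = \<kappa> * (of_int d + m - 1)"
  define G where "G b x = c * ((x \<bullet> b) * g x) - sD r b g x" for b x
  have sG: "smooth_on S (G b)" for b unfolding G_def[abs_def] by (intro smooth_intros sg)
  have "(\<Sum>b\<in>Basis. ip (G b) (G b)) = sint (\<lambda>x. \<Sum>b\<in>Basis. G b x \<bullet> G b x)"
    unfolding ip_def by (intro Bochner_Integration.integral_sum[symmetric] integrable_smooth smooth_intros sG)
  also have "\<dots> = sint (\<lambda>x. (c\<^sup>2 / \<kappa>) * (g x \<bullet> g x) + (\<Sum>b\<in>Basis. sD r b g x \<bullet> sD r b g x))"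
  proof (rule sint_cong)
    fix x assume x: "x \<in> S"
    have "(\<Sum>b\<in>Basis. G b x \<bullet> G b x) = c\<^sup>2 * (g x)\<^sup>2 * (\<Sum>b\<in>Basis. (x \<bullet> b) * (x \<bullet> b))
        - 2 * c * g x * (\<Sum>b\<in>Basis. (x \<bullet> b) *\<^sub>R sD r b g x) + (\<Sum>b\<in>Basis. sD r b g x \<bullet> sD r b g x)"
      by (simp add: G_def sum_distrib_left flip: sum_subtractf sum.distrib)
        (simp add: algebra_simps power2_eq_square)
    also have "(\<Sum>b\<in>Basis. (x \<bullet> b) * (x \<bullet> b)) = 1 / \<kappa>"
      using S_inner[OF x] by (simp add: \<kappa>_def flip: euclidean_inner)
    finally show "(\<Sum>b\<in>Basis. G b x \<bullet> G b x) = (c\<^sup>2 / \<kappa>) * (g x \<bullet> g x) + (\<Sum>b\<in>Basis. sD r b g x \<bullet> sD r b g x)"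
      unfolding sum_coord_sD[OF x sg] by (simp add: power2_eq_square)
  qed
  also have "\<dots> = (c\<^sup>2 / \<kappa>) * ip g g + ip (slap r g) g"
  proof -
    have *: "smooth_on S (\<lambda>x. (c\<^sup>2 / \<kappa>) * (g x \<bullet> g x))" "smooth_on S (\<lambda>x. \<Sum>b\<in>Basis. sD r b g x \<bullet> sD r b g x)"
      by (intro smooth_intros sg)+
    show ?thesis
      unfolding ip_def sint_slap[OF sg sg]
        Bochner_Integration.integral_add[OF *[THEN integrable_smooth]]
      by (simp only: integral_mult_right_zero)
  qed
  also have "\<dots> = \<kappa> * (of_int d + m - 1) * (2 * of_int d + m - 1) * ip g g"
    unfolding harmonics_slap[OF g sg] c_def lam_def using \<kappa>_pos by (simp add: field_simps power2_eq_square)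
  finally show ?thesis unfolding G_def c_def .
qed

text \<open>Here \<open>w\<close> need not be tangent: its divergence contains \<open>m\<close> times its radial component.\<close>

definition sdiv :: "('a \<Rightarrow> 'a) \<Rightarrow> 'a \<Rightarrow> real" where
  "sdiv w x = (\<Sum>b\<in>Basis. sD r b (\<lambda>y. w y \<bullet> b) x)"

text \<open>Normalised so that the radial part of \<open>w\<close> is
  \<open>srad w x *\<^sub>R x\<close>. For the projected section it is the normal component
  f.\<close>

definition srad :: "('a \<Rightarrow> 'a) \<Rightarrow> 'a \<Rightarrow> real" where
  "srad w x = \<kappa> * (x \<bullet> w x)"

lemma smooth_sdiv: "smooth_on S w \<Longrightarrow> smooth_on S (sdiv w)"
  unfolding sdiv_def[abs_def] by (intro smooth_intros)

lemma smooth_srad: "smooth_on S w \<Longrightarrow> smooth_on S (srad w)"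
  unfolding srad_def[abs_def] by (intro smooth_intros)

lemma ip_srad:
  assumes w: "smooth_on S w" and g: "smooth_on S g"
  shows "ip (srad w) g = \<kappa> * (\<Sum>b\<in>Basis. ip (\<lambda>x. w x \<bullet> b) (\<lambda>x. (x \<bullet> b) * g x))"
proof -
  have "(\<Sum>b\<in>Basis. ip (\<lambda>x. w x \<bullet> b) (\<lambda>x. (x \<bullet> b) * g x))
      = sint (\<lambda>x. \<Sum>b\<in>Basis. (w x \<bullet> b) \<bullet> ((x \<bullet> b) * g x))"
    unfolding ip_def by (intro Bochner_Integration.integral_sum[symmetric] integrable_smooth smooth_intros w g)
  also have "\<kappa> * \<dots> = sint (\<lambda>x. \<kappa> * (\<Sum>b\<in>Basis. (w x \<bullet> b) \<bullet> ((x \<bullet> b) * g x)))" by simp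
  also have "\<dots> = ip (srad w) g"
    by (simp add: ip_def srad_def euclidean_inner[of _ "w _"] sum_distrib_right sum_distrib_left mult_ac)
  finally show ?thesis by simp
qed

text \<open>The divergence theorem for an ambient field, obtained from \<open>sint_sD\<close> for
  each \<open>(w x \<bullet> b) * g x\<close>; the mean curvature terms add up to the radial
  part.\<close>

lemma ip_sdiv:
  assumes w: "smooth_on S w" and g: "smooth_on S g"
  shows "ip (sdiv w) g = m * ip (srad w) g - (\<Sum>b\<in>Basis. ip (\<lambda>x. w x \<bullet> b) (sD r b g))"
proof -
  have sw: "smooth_on S (\<lambda>x. w x \<bullet> b)" for b by (intro smooth_intros w)
  have "ip (sdiv w) g = (\<Sum>b\<in>Basis. ip (sD r b (\<lambda>y. w y \<bullet> b)) g)"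
    unfolding sdiv_def[abs_def] by (intro ip_sum_left smooth_intros w g)
  also have "\<dots> = (\<Sum>b\<in>Basis. \<kappa> * m * sint (\<lambda>x. (x \<bullet> b) * ((w x \<bullet> b) * g x)) - ip (\<lambda>x. w x \<bullet> b) (sD r b g))"
  proof (intro sum.cong refl)
    fix b :: 'a assume b: "b \<in> Basis"
    have "\<kappa> * m * sint (\<lambda>x. (x \<bullet> b) * ((w x \<bullet> b) * g x)) = sint (sD r b (\<lambda>x. (w x \<bullet> b) * g x))"
      by (intro sint_sD[symmetric] smooth_intros w g b)
    also have "\<dots> = sint (\<lambda>x. (w x \<bullet> b) \<bullet> sD r b g x + sD r b (\<lambda>x. w x \<bullet> b) x \<bullet> g x)"
      by (intro sint_cong) (simp add: sD_mult[OF _ sw g])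
    also have "\<dots> = ip (\<lambda>x. w x \<bullet> b) (sD r b g) + ip (sD r b (\<lambda>x. w x \<bullet> b)) g"
      unfolding ip_def by (intro Bochner_Integration.integral_add integrable_smooth smooth_intros w g)
    finally show "ip (sD r b (\<lambda>y. w y \<bullet> b)) g
        = \<kappa> * m * sint (\<lambda>x. (x \<bullet> b) * ((w x \<bullet> b) * g x)) - ip (\<lambda>x. w x \<bullet> b) (sD r b g)"
      by simp
  qed
  also have "\<dots> = m * ip (srad w) g - (\<Sum>b\<in>Basis. ip (\<lambda>x. w x \<bullet> b) (sD r b g))"
    unfolding ip_srad[OF w g] by (simp add: ip_def sum_subtractf sum_distrib_left mult_ac)
  finally show ?thesis .
qed

text \<open>Adding \<open>d - 1\<close> times \<open>srad w\<close> turns the coefficient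
  \<open>m\<close> of \<open>ip_sdiv\<close> into \<open>d + m - 1\<close>, the one for which the
  test functions are harmonics of degree \<open>d + 1\<close>.\<close>

lemma ip_sdiv_harmonics:
  assumes w: "smooth_on S w" and g: "harmonics d g"
  shows "ip (\<lambda>x. sdiv w x + (of_int d - 1) * srad w x) g =
    (\<Sum>b\<in>Basis. ip (\<lambda>x. w x \<bullet> b) (\<lambda>x. \<kappa> * (of_int d + m - 1) * ((x \<bullet> b) * g x) - sD r b g x))"
proof -
  have sg: "smooth_on S g" using g by (rule harmonics_smooth)
  have sw: "smooth_on S (\<lambda>x. w x \<bullet> b)" for b by (intro smooth_intros w)
  have 1: "ip (\<lambda>x. w x \<bullet> b) (\<lambda>x. \<kappa> * (of_int d + m - 1) * ((x \<bullet> b) * g x) - sD r b g x)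
      = \<kappa> * (of_int d + m - 1) * ip (\<lambda>x. w x \<bullet> b) (\<lambda>x. (x \<bullet> b) * g x) - ip (\<lambda>x. w x \<bullet> b) (sD r b g)" for b
  proof -
    have "smooth_on S (\<lambda>x. \<kappa> * (of_int d + m - 1) * ((x \<bullet> b) * g x))" "smooth_on S (sD r b g)"
      by (intro smooth_intros sg)+
    then show ?thesis using sw by (simp only: ip_diff_right ip_mult_right)
  qed
  note 2 = ip_srad[OF w sg, symmetric]
  have "ip (\<lambda>x. sdiv w x + (of_int d - 1) * srad w x) g = ip (sdiv w) g + (of_int d - 1) * ip (srad w) g"
    using smooth_sdiv[OF w] smooth_srad[OF w] sg
    by (simp only: ip_add_left ip_mult_left smooth_on_mult smooth_on_const)
  also have "\<dots> = (of_int d + m - 1) * ip (srad w) g - (\<Sum>b\<in>Basis. ip (\<lambda>x. w x \<bullet> b) (sD r b g))"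
    unfolding ip_sdiv[OF w sg] by (simp add: algebra_simps)
  also have "\<dots> = (\<Sum>b\<in>Basis. ip (\<lambda>x. w x \<bullet> b) (\<lambda>x. \<kappa> * (of_int d + m - 1) * ((x \<bullet> b) * g x) - sD r b g x))"
    unfolding 1 2[symmetric] sum_subtractf by (simp add: sum_distrib_left mult_ac)
  finally show ?thesis .
qed

text \<open>\<open>U\<close> is the squared norm of the degree \<open>j\<close> part
  \<open>u\<close> of div w + (j - 1) f, estimated by testing \<open>u\<close> against itself.
  Recovering div w from \<open>u\<close> costs a factor 2, except for \<open>j = 1\<close>, where
  the two coincide.\<close>

lemma sdiv_component_bound:
  assumes w: "smooth_on S w" and j: "1 \<le> j"
  defines "D \<equiv> ip (pr j (sdiv w)) (pr j (sdiv w))"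
    and "F \<equiv> ip (pr j (srad w)) (pr j (srad w))"
    and "A \<equiv> \<Sum>b\<in>Basis. ip (pr (Suc j) (\<lambda>x. w x \<bullet> b)) (pr (Suc j) (\<lambda>x. w x \<bullet> b))"
    and "K \<equiv> \<kappa> * (real j + m - 1) * (2 * real j + m - 1)"
  obtains U where "U \<le> K * A" "D \<le> 2 * U + 2 * (real j - 1)\<^sup>2 * F" "j = 1 \<Longrightarrow> D = U"
proof -
  note sd = smooth_sdiv[OF w] and sf = smooth_srad[OF w]
  have sw: "smooth_on S (\<lambda>x. w x \<bullet> b)" for b by (intro smooth_intros w)
  define dj fj where "dj = pr j (sdiv w)" and "fj = pr j (srad w)"
  have hd: "harmonics (int j) dj" and hf: "harmonics (int j) fj"
    unfolding dj_def fj_def by (intro pr_harmonics sd sf)+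
  define u where "u x = dj x + (real j - 1) * fj x" for x
  have hu: "harmonics (int j) u"
    unfolding u_def[abs_def] by (intro harmonics_add harmonics_cmult hd hf)
  have su: "smooth_on S u" and sdj: "smooth_on S dj" and sfj: "smooth_on S fj"
    using hu hd hf by (auto intro: harmonics_smooth)
  define G where "G b x = \<kappa> * (of_int (int j) + m - 1) * ((x \<bullet> b) * u x) - sD r b u x" for b x
  have hG: "harmonics (int (Suc j)) (G b)" if "b \<in> Basis" for b
    using harmonics_raise[OF hu that] by (simp add: G_def[abs_def] add.commute)
  have sG: "smooth_on S (G b)" if "b \<in> Basis" for b using hG[OF that] by (rule harmonics_smooth)
  have Kpos: "K > 0" using \<kappa>_pos m_ge j by (auto simp: K_def intro!: mult_pos_pos)
  have "ip u u = ip (\<lambda>x. dj x + (real j - 1) * fj x) u" by (simp add: u_def[abs_def])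
  also have "\<dots> = ip dj u + (real j - 1) * ip fj u"
    using sdj sfj su by (simp only: ip_add_left ip_mult_left smooth_on_mult smooth_on_const)
  also have "\<dots> = ip (sdiv w) u + (real j - 1) * ip (srad w) u"
    unfolding dj_def fj_def using ip_pr_harmonics[OF sd hu] ip_pr_harmonics[OF sf hu] by simp
  also have "\<dots> = ip (\<lambda>x. sdiv w x + (of_int (int j) - 1) * srad w x) u"
    using sd sf su by (simp only: ip_add_left ip_mult_left smooth_on_mult smooth_on_const of_int_of_nat_eq)
  also have "\<dots> = (\<Sum>b\<in>Basis. ip (\<lambda>x. w x \<bullet> b) (G b))"
    unfolding ip_sdiv_harmonics[OF w hu] G_def[abs_def] by simp
  also have "\<dots> = (\<Sum>b\<in>Basis. ip (pr (Suc j) (\<lambda>x. w x \<bullet> b)) (G b))"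
    by (intro sum.cong refl ip_pr_harmonics[OF sw hG, symmetric])
  finally have uu: "ip u u = (\<Sum>b\<in>Basis. ip (pr (Suc j) (\<lambda>x. w x \<bullet> b)) (G b))" .
  have GG: "(\<Sum>b\<in>Basis. ip (G b) (G b)) = K * ip u u"
    using harmonics_raise_norm[OF hu] by (simp add: G_def[abs_def] K_def)
  \<comment> \<open>Cauchy-Schwarz for the whole sum over \<open>b\<close>, as a completed square;
    the weight \<open>K\<close> is the ratio between the norms in \<open>GG\<close>.\<close>
  have "0 \<le> (\<Sum>b\<in>Basis. ip (\<lambda>x. K *\<^sub>R pr (Suc j) (\<lambda>x. w x \<bullet> b) x - 1 *\<^sub>R G b x)
      (\<lambda>x. K *\<^sub>R pr (Suc j) (\<lambda>x. w x \<bullet> b) x - 1 *\<^sub>R G b x))"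
    by (intro sum_nonneg ip_self_nonneg)
  also have "\<dots> = (\<Sum>b\<in>Basis. K\<^sup>2 * ip (pr (Suc j) (\<lambda>x. w x \<bullet> b)) (pr (Suc j) (\<lambda>x. w x \<bullet> b))
      - 2 * K * 1 * ip (pr (Suc j) (\<lambda>x. w x \<bullet> b)) (G b) + 1\<^sup>2 * ip (G b) (G b))"
    by (intro sum.cong refl ip_square_diff pr_smooth sw sG)
  also have "\<dots> = K\<^sup>2 * A - 2 * K * ip u u + K * ip u u"
    unfolding A_def uu GG[symmetric, unfolded uu] by (simp add: sum.distrib sum_subtractf sum_distrib_left)
  finally have "0 \<le> K * (K * A - ip u u)" by (simp add: power2_eq_square algebra_simps)
  then have 1: "ip u u \<le> K * A" using Kpos by (simp add: zero_le_mult_iff)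
  have 2: "D \<le> 2 * ip u u + 2 * (real j - 1)\<^sup>2 * F"
  proof -
    have 3: "ip dj dj = ip u u - 2 * (real j - 1) * ip u fj + (real j - 1)\<^sup>2 * ip fj fj"
      using ip_square_diff[OF su sfj, of 1 "real j - 1"] by (simp add: u_def)
    define c where "c = - (real j - 1)"
    have "0 \<le> ip u u - 2 * c * ip u fj + c\<^sup>2 * ip fj fj"
      using ip_self_nonneg[of "\<lambda>x. 1 *\<^sub>R u x - c *\<^sub>R fj x"] unfolding ip_square_diff[OF su sfj] by simp
    also have "\<dots> = ip u u + 2 * (real j - 1) * ip u fj + (real j - 1)\<^sup>2 * ip fj fj"
      by (simp add: c_def power2_eq_square algebra_simps)
    finally have "0 \<le> ip u u + 2 * (real j - 1) * ip u fj + (real j - 1)\<^sup>2 * ip fj fj" .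
    then show ?thesis unfolding D_def F_def dj_def[symmetric] fj_def[symmetric] using 3 by linarith
  qed
  have "D = ip u u" if "j = 1"
  proof -
    have "u = dj" using that by (simp add: u_def fun_eq_iff)
    then show ?thesis by (simp add: D_def dj_def)
  qed
  with 1 2 show ?thesis by (rule that)
qed

text \<open>Degree 0 consists of constants on \<open>S\<close>, and the divergence theorem makes the
  mean of div w equal to \<open>m\<close> times that of \<open>srad w\<close>. The mean-zero
  condition enters the stability inequality here.\<close>

lemma pr_0_sdiv:
  assumes w: "smooth_on S w" and "sint (srad w) = 0"
  shows "ip (pr 0 (sdiv w)) (pr 0 (sdiv w)) = 0"
proof -
  have "hpoly 0 (pr 0 (sdiv w))"
    using pr_harmonics[OF smooth_sdiv[OF w], of 0] by (simp add: harmonics_def)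
  from hpoly_imp_span_monomials[OF this] obtain c where c: "\<And>x. x \<in> S \<Longrightarrow> pr 0 (sdiv w) x = c"
    by (auto simp: span_singleton scaleR_fun_def)
  have "ip (pr 0 (sdiv w)) (pr 0 (sdiv w)) = ip (sdiv w) (pr 0 (sdiv w))"
    using ip_pr[OF smooth_sdiv[OF w] smooth_sdiv[OF w]] by simp
  also have "\<dots> = ip (sdiv w) (\<lambda>x. c)" using c by (intro ip_cong) auto
  also have "\<dots> = m * ip (srad w) (\<lambda>x. c) - (\<Sum>b\<in>Basis. ip (\<lambda>x. w x \<bullet> b) (sD r b (\<lambda>x. c)))"
    by (rule ip_sdiv[OF w smooth_on_const])
  also have "ip (srad w) (\<lambda>x. c) = sint (srad w) * c" by (simp add: ip_def)
  also have "(\<Sum>b\<in>Basis. ip (\<lambda>x. w x \<bullet> b) (sD r b (\<lambda>x. c))) = 0"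
  proof (rule sum.neutral, rule ballI)
    fix b :: 'a
    have "ip (\<lambda>x. w x \<bullet> b) (sD r b (\<lambda>x. c)) = ip (\<lambda>x. w x \<bullet> b) (\<lambda>x. 0)" by (intro ip_cong) auto
    then show "ip (\<lambda>x. w x \<bullet> b) (sD r b (\<lambda>x. c)) = 0" by (simp add: ip_def)
  qed
  finally show ?thesis using assms by simp
qed

text \<open>The quadratic form of \<Delta> (\<Delta> - \<kappa> m). Here \<kappa> m is
  \<open>lam 1\<close>, the first positive eigenvalue, so the form is nonnegative and blind to
  degrees 0 and 1.\<close>

definition gap_form :: "('a \<Rightarrow> 'c::euclidean_space) \<Rightarrow> real" where
  "gap_form F = ip (slap r F) (slap r F) - \<kappa> * m * ip (slap r F) F"

lemma lam_gap_sums: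
  assumes f: "smooth_on S f"
  shows "(\<lambda>k. lam (int k) * (lam (int k) - c) * ip (pr k f) (pr k f)) sums
    (ip (slap r f) (slap r f) - c * ip (slap r f) f)"
proof -
  have sf: "smooth_on S (slap r f)" by (intro smooth_intros f)
  have 1: "ip (slap r f) (pr k f) = lam (int k) * ip (pr k f) (pr k f)" for k
    using ip_slap_pr[OF f f] ip_pr(1)[OF f f] by simp
  have 2: "ip (slap r f) (pr k (slap r f)) = (lam (int k))\<^sup>2 * ip (pr k f) (pr k f)" for k
    using ip_slap_pr[OF f sf, of k] ip_pr(2)[OF f sf, of k] 1[of k] ip_commute[of "pr k f" "slap r f"]
    by (simp add: power2_eq_square)
  have "(\<lambda>k. ip (slap r f) (pr k (slap r f)) - c * ip (slap r f) (pr k f)) sums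
    (ip (slap r f) (slap r f) - c * ip (slap r f) f)"
    by (intro sums_diff sums_mult Parseval sf f)
  then show ?thesis unfolding 1 2 by (simp add: power2_eq_square algebra_simps)
qed

lemma lam_gap_nonneg: "lam (int k) * (lam (int k) - \<kappa> * m) \<ge> 0"
proof (cases "k = 0")
  case False
  have "lam (int k) * (lam (int k) - \<kappa> * m) = \<kappa>\<^sup>2 * (real k * (real k + m - 1) * ((real k - 1) * (real k + m)))"
    by (simp add: lam_def power2_eq_square algebra_simps)
  also have "\<dots> \<ge> 0" using False m_ge by (intro mult_nonneg_nonneg) auto
  finally show ?thesis .
qed (simp add: lam_def)

lemma gap_form_nonneg_real:
  fixes f :: "'a \<Rightarrow> real"
  assumes f: "smooth_on S f"
  shows "gap_form f \<ge> 0"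
  unfolding gap_form_def
  by (rule sums_le[OF _ sums_zero lam_gap_sums[OF f]]) (intro mult_nonneg_nonneg lam_gap_nonneg ip_self_nonneg)

text \<open>All three terms become series over the degree, compared term by term: degree
  \<open>k\<close> of the divergence against degree \<open>k + 1\<close> of \<open>w\<close> and
  degree \<open>k\<close> of \<open>srad w\<close>. The factor 1/2 is r^2, since a section has last
  component -r f.\<close>

theorem stability_inequality:
  assumes w: "smooth_on S w" and mean: "sint (srad w) = 0" and \<kappa>2: "\<kappa> = 2"
  shows "4 * ip (sdiv w) (sdiv w) \<le> (\<Sum>b\<in>Basis. gap_form (\<lambda>x. w x \<bullet> b)) + gap_form (srad w) / 2"
proof -
  note sd = smooth_sdiv[OF w] and sf = smooth_srad[OF w]
  have sw: "smooth_on S (\<lambda>x. w x \<bullet> b)" for b by (intro smooth_intros w)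
  define \<gamma> where "\<gamma> k = lam (int k) * (lam (int k) - \<kappa> * m)" for k
  have \<gamma>: "\<gamma> k = 4 * real k * (real k - 1) * (real k + m - 1) * (real k + m)" for k
    unfolding \<gamma>_def lam_def by (simp add: \<kappa>2 algebra_simps)
  define A where "A k = (\<Sum>b\<in>Basis. ip (pr k (\<lambda>x. w x \<bullet> b)) (pr k (\<lambda>x. w x \<bullet> b)))" for k
  define D where "D k = ip (pr k (sdiv w)) (pr k (sdiv w))" for k
  define F where "F k = ip (pr k (srad w)) (pr k (srad w))" for k
  have A0: "A k \<ge> 0" and F0: "F k \<ge> 0" for k
    unfolding A_def F_def by (intro sum_nonneg ip_self_nonneg)+
  have sumA: "(\<lambda>k. \<gamma> k * A k) sums (\<Sum>b\<in>Basis. gap_form (\<lambda>x. w x \<bullet> b))"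
    unfolding gap_form_def A_def \<gamma>_def sum_distrib_left by (intro sums_sum lam_gap_sums sw)
  \<comment> \<open>The index shift loses nothing because \<open>\<gamma> 0 = 0\<close>.\<close>
  then have sumA': "(\<lambda>k. \<gamma> (Suc k) * A (Suc k)) sums (\<Sum>b\<in>Basis. gap_form (\<lambda>x. w x \<bullet> b))"
    by (subst sums_Suc_iff) (simp add: \<gamma>)
  have sumF: "(\<lambda>k. \<gamma> k * F k / 2) sums (gap_form (srad w) / 2)"
    unfolding gap_form_def F_def \<gamma>_def by (intro sums_divide lam_gap_sums sf)
  have sumD: "(\<lambda>k. 4 * D k) sums (4 * ip (sdiv w) (sdiv w))"
    unfolding D_def using Parseval[OF sd sd] ip_pr(1)[OF sd sd] by (intro sums_mult) simp
  have "4 * D k \<le> \<gamma> (Suc k) * A (Suc k) + \<gamma> k * F k / 2" for k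
  proof (cases "k = 0")
    case True
    then show ?thesis using pr_0_sdiv[OF w mean] by (simp add: D_def \<gamma>)
  next
    case False
    obtain U where U: "U \<le> 2 * (real k + m - 1) * (2 * real k + m - 1) * A (Suc k)"
      "D k \<le> 2 * U + 2 * (real k - 1)\<^sup>2 * F k" "k = 1 \<Longrightarrow> D k = U"
      using sdiv_component_bound[OF w, of k] False unfolding D_def F_def A_def \<kappa>2 by auto
    show ?thesis
    \<comment> \<open>Degree 1 needs the exact identity \<open>D k = U\<close>: doubling would
      require 16 m (m + 1) to be at most 8 (m + 1) (m + 2), false for \<open>m > 2\<close>, and
      \<open>\<gamma> 1 = 0\<close> gives no help from \<open>F\<close>.\<close>
    proof (cases "k = 1")
      case True
      have "4 * D k \<le> 4 * (2 * m * (m + 1) * A (Suc k))" using U(1,3) True by (simp add: algebra_simps)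
      also have "\<dots> \<le> (8 * (m + 1) * (m + 2)) * A (Suc k)"
      proof -
        have "m * (m + 1) \<le> (m + 2) * (m + 1)" using m_ge by (intro mult_right_mono) auto
        then have "8 * (m * (m + 1)) * A (Suc k) \<le> 8 * ((m + 2) * (m + 1)) * A (Suc k)"
          using A0 by (intro mult_right_mono) auto
        then show ?thesis by (simp add: algebra_simps)
      qed
      finally show ?thesis using True by (simp add: \<gamma> algebra_simps)
    next
      case False
      then have k: "2 \<le> real k" using \<open>k \<noteq> 0\<close> by simp
      have "4 * D k \<le> 8 * U + 8 * (real k - 1)\<^sup>2 * F k" using U(2) by simp
      also have "\<dots> \<le> (16 * (real k + m - 1) * (2 * real k + m - 1)) * A (Suc k) + 8 * (real k - 1)\<^sup>2 * F k"
        using mult_left_mono[OF U(1), of 8] by (simp add: algebra_simps)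
      also have "\<dots> \<le> (4 * real k * (real k + 1) * (real k + m) * (real k + m + 1)) * A (Suc k)
          + (2 * real k * (real k - 1) * (real k + m - 1) * (real k + m)) * F k"
        by (intro add_mono mult_right_mono divergence_coefficient_bound radial_coefficient_bound k m_ge A0 F0)
      also have "\<dots> = \<gamma> (Suc k) * A (Suc k) + \<gamma> k * F k / 2" by (simp add: \<gamma> field_simps)
      finally show ?thesis .
    qed
  qed
  then show ?thesis using sums_le[OF _ sumD sums_add[OF sumA' sumF]] by blast
qed

end


subsection \<open>Maps into a unit sphere\<close>

lemma onb:
  fixes x :: "'a::euclidean_space"
  shows "pairwise orthogonal (onb x)" "e \<in> onb x \<Longrightarrow> norm e = 1" "span (onb x) = tangent x"
    "finite (onb x)"
proof -
  have "subspace (tangent x)"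
    by (auto simp: subspace_def tangent_def inner_add_right)
  then obtain B where "B \<subseteq> tangent x" "pairwise orthogonal B" "\<And>e. e \<in> B \<Longrightarrow> norm e = 1"
    "span B = tangent x"
    by (rule orthonormal_basis_subspace) blast
  then have "\<exists>B. pairwise orthogonal B \<and> (\<forall>e\<in>B. norm e = 1) \<and> span B = tangent x" by blast
  from someI_ex[OF this, folded onb_def]
  show 1: "pairwise orthogonal (onb x)" and 2: "e \<in> onb x \<Longrightarrow> norm e = 1"
    and "span (onb x) = tangent x" for e by auto
  have "independent (onb x)"
    using 2[of 0] by (intro pairwise_orthogonal_independent 1) auto
  then show "finite (onb x)" by (rule independent_imp_finite)
qed

lemma onb_tangent: "e \<in> onb x \<Longrightarrow> e \<in> tangent x"
  using onb(3) span_base by blast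

lemma tproj_unit: "p \<bullet> p = 1 \<Longrightarrow> tproj p v = v - (p \<bullet> v) *\<^sub>R p"
  by (simp add: tproj_def)

lemma linear_tproj: "linear (tproj p)"
  by (intro linearI) (auto simp: tproj_def inner_add_right algebra_simps add_divide_distrib)

lemma tproj_orthogonal: "p \<bullet> v = 0 \<Longrightarrow> tproj p v = v"
  by (simp add: tproj_def)

section \<open>Traces over orthonormal frames as sums over ambient coordinates\<close>

context round_sphere
begin

lemma sum_onb_inner:
  assumes x: "x \<in> S"
  shows "(\<Sum>e\<in>onb x. (e \<bullet> a) * (e \<bullet> b)) = a \<bullet> b - \<kappa> * (x \<bullet> a) * (x \<bullet> b)"
proof -
  have e: "tproj x a \<bullet> e = e \<bullet> a" if "e \<in> onb x" for e
    using onb_tangent[OF that] x by (simp add: tproj_S tangent_def inner_diff_left inner_commute[of a e])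
  have "tproj x a \<in> span (onb x)" using tproj_tangent_S[OF x] by (simp add: onb(3))
  from orthonormal_basis_expand[OF onb(1) onb(2) this onb(4)]
  have "tproj x a \<bullet> b = (\<Sum>e\<in>onb x. ((tproj x a \<bullet> e) *\<^sub>R e) \<bullet> b)"
    by (simp only: inner_sum_left[symmetric])
  also have "\<dots> = (\<Sum>e\<in>onb x. (e \<bullet> a) * (e \<bullet> b))"
    by (intro sum.cong refl) (simp add: e)
  finally show ?thesis using x by (simp add: tproj_S inner_diff_left)
qed

text \<open>The completeness relation of the frame replaces it by the ambient basis minus the radial
  direction; where \<open>M\<close> consists of derivatives along \<open>S\<close>, the radial term
  vanishes.\<close>

lemma tr_bilinear:
  fixes M :: "'a \<Rightarrow> 'a \<Rightarrow> 'c::real_vector"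
  assumes x: "x \<in> S"
  shows "tr x (\<lambda>e. \<Sum>b\<in>Basis. \<Sum>c\<in>Basis. ((e \<bullet> b) * (e \<bullet> c)) *\<^sub>R M b c)
    = (\<Sum>b\<in>Basis. M b b) - \<kappa> *\<^sub>R (\<Sum>b\<in>Basis. \<Sum>c\<in>Basis. ((x \<bullet> b) * (x \<bullet> c)) *\<^sub>R M b c)"
proof -
  have "tr x (\<lambda>e. \<Sum>b\<in>Basis. \<Sum>c\<in>Basis. ((e \<bullet> b) * (e \<bullet> c)) *\<^sub>R M b c)
      = (\<Sum>b\<in>Basis. \<Sum>c\<in>Basis. (\<Sum>e\<in>onb x. (e \<bullet> b) * (e \<bullet> c)) *\<^sub>R M b c)"
    unfolding tr_def scaleR_sum_left
    by (rule trans[OF sum.swap sum.cong[OF refl sum.swap]])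
  also have "\<dots> = (\<Sum>b\<in>Basis. \<Sum>c\<in>Basis. (if b = c then M b c else 0) - \<kappa> *\<^sub>R ((x \<bullet> b) * (x \<bullet> c)) *\<^sub>R M b c)"
    using x by (intro sum.cong refl) (auto simp: sum_onb_inner inner_Basis algebra_simps)
  also have "\<dots> = (\<Sum>b\<in>Basis. M b b) - \<kappa> *\<^sub>R (\<Sum>b\<in>Basis. \<Sum>c\<in>Basis. ((x \<bullet> b) * (x \<bullet> c)) *\<^sub>R M b c)"
    by (simp add: sum_subtractf scaleR_sum_right)
  finally show ?thesis .
qed

lemma sderiv_onb: "e \<in> onb x \<Longrightarrow> sderiv r f x e = sD r e f x"
  by (simp add: sD_def tproj_tangent onb_tangent)

lemma tr_cong: "(\<And>e. e \<in> onb x \<Longrightarrow> F e = G e) \<Longrightarrow> tr x F = tr x G"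
  unfolding tr_def by (rule sum.cong) auto

lemma tr_sD_bilinear:
  assumes h: "bounded_bilinear h" and x: "x \<in> S" and f: "smooth_on S f" and g: "smooth_on S g"
  shows "tr x (\<lambda>e. h (sD r e f x) (sD r e g x)) = (\<Sum>b\<in>Basis. h (sD r b f x) (sD r b g x))"
proof -
  interpret bounded_bilinear h by fact
  have exp: "h (sD r u f x) (sD r v g x)
      = (\<Sum>b\<in>Basis. \<Sum>c\<in>Basis. ((u \<bullet> b) * (v \<bullet> c)) *\<^sub>R h (sD r b f x) (sD r c g x))" for u v
    unfolding sD_expand[OF x f, of u] sD_expand[OF x g, of v]
    unfolding sum_left sum_right by (subst sum.swap) (simp add: scaleR_left scaleR_right mult.commute)
  have "tr x (\<lambda>e. h (sD r e f x) (sD r e g x))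
      = tr x (\<lambda>e. \<Sum>b\<in>Basis. \<Sum>c\<in>Basis. ((e \<bullet> b) * (e \<bullet> c)) *\<^sub>R h (sD r b f x) (sD r c g x))"
    by (intro tr_cong exp)
  also have "\<dots> = (\<Sum>b\<in>Basis. h (sD r b f x) (sD r b g x)) - \<kappa> *\<^sub>R h (sD r x f x) (sD r x g x)"
    by (subst exp[of x x]) (rule tr_bilinear[OF x])
  finally show ?thesis by (simp add: sD_self[OF x f] zero_left)
qed

lemma tr_sD_sD:
  assumes x: "x \<in> S" and f: "smooth_on S f"
  shows "tr x (\<lambda>e. sD r e (sD r e f) x) = - slap r f x"
proof -
  have exp: "sD r u (sD r v f) x
      = (\<Sum>b\<in>Basis. \<Sum>c\<in>Basis. ((u \<bullet> b) * (v \<bullet> c)) *\<^sub>R sD r b (sD r c f) x)" for u v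
  proof -
    have "sD r u (sD r v f) x = sD r u (\<lambda>y. \<Sum>c\<in>Basis. (v \<bullet> c) *\<^sub>R sD r c f y) x"
      by (intro sD_cong x sD_expand f)
    also have "\<dots> = (\<Sum>c\<in>Basis. (v \<bullet> c) *\<^sub>R sD r u (sD r c f) x)"
      using x f by (subst sD_sum) (auto simp: sD_cmult smooth_on_sD[OF f] intro!: smooth_intros)
    also have "\<dots> = (\<Sum>c\<in>Basis. (v \<bullet> c) *\<^sub>R (\<Sum>b\<in>Basis. (u \<bullet> b) *\<^sub>R sD r b (sD r c f) x))"
      using sD_expand[OF x smooth_on_sD[OF f], of u] by simp
    also have "\<dots> = (\<Sum>b\<in>Basis. \<Sum>c\<in>Basis. ((u \<bullet> b) * (v \<bullet> c)) *\<^sub>R sD r b (sD r c f) x)"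
      unfolding scaleR_sum_right by (subst sum.swap) (simp add: mult.commute)
    finally show ?thesis .
  qed
  have 0: "(\<Sum>b\<in>Basis. \<Sum>c\<in>Basis. ((x \<bullet> b) * (x \<bullet> c)) *\<^sub>R sD r b (sD r c f) x) = 0"
  proof -
    have "(\<Sum>b\<in>Basis. \<Sum>c\<in>Basis. ((x \<bullet> b) * (x \<bullet> c)) *\<^sub>R sD r b (sD r c f) x)
        = (\<Sum>c\<in>Basis. (x \<bullet> c) *\<^sub>R (\<Sum>b\<in>Basis. (x \<bullet> b) *\<^sub>R sD r b (sD r c f) x))"
      unfolding scaleR_sum_right by (subst sum.swap) (simp add: mult.commute)
    also have "\<dots> = 0" using sum_coord_sD[OF x smooth_on_sD[OF f]] by simp
    finally show ?thesis .
  qed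
  have "tr x (\<lambda>e. sD r e (sD r e f) x)
      = tr x (\<lambda>e. \<Sum>b\<in>Basis. \<Sum>c\<in>Basis. ((e \<bullet> b) * (e \<bullet> c)) *\<^sub>R sD r b (sD r c f) x)"
    by (intro tr_cong exp)
  also have "\<dots> = - slap r f x" unfolding tr_bilinear[OF x] 0 by (simp add: slap_def)
  finally show ?thesis .
qed

text \<open>At \<open>x\<close> the derivative of the field \<open>tproj y e\<close> is a multiple
  of \<open>x\<close>, hence normal. The correction terms in \<open>cov2\<close> and
  \<open>second_ff\<close> therefore drop out of the traces.\<close>

lemma levi_civita_tproj:
  assumes x: "x \<in> S" and e: "e \<in> tangent x"
  shows "levi_civita r (\<lambda>y. tproj y e) x e = 0"
proof -
  have "sderiv r (\<lambda>y. tproj y e) x e = sD r e (\<lambda>y. tproj y e) x"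
    by (simp add: sD_def tproj_tangent e)
  also have "\<dots> = sD r e (\<lambda>y. e - (\<kappa> *\<^sub>R (y \<bullet> e)) *\<^sub>R y) x"
    by (rule sD_cong[OF x]) (simp add: tproj_S)
  also have "\<dots> = - sD r e (\<lambda>y. (\<kappa> *\<^sub>R (y \<bullet> e)) *\<^sub>R y) x"
    using x by (subst sD_diff) (auto intro!: smooth_intros)
  also have "sD r e (\<lambda>y. (\<kappa> *\<^sub>R (y \<bullet> e)) *\<^sub>R y) x = (\<kappa> * (x \<bullet> e)) *\<^sub>R sD r e (\<lambda>y. y) x
      + sD r e (\<lambda>y. \<kappa> *\<^sub>R (y \<bullet> e)) x *\<^sub>R x"
    using x by (subst sD_scaleR) (auto intro!: smooth_intros)
  also have "\<dots> = sD r e (\<lambda>y. \<kappa> *\<^sub>R (y \<bullet> e)) x *\<^sub>R x" using e by (simp add: tangent_def)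
  finally show ?thesis
    using S_nonzero[OF x] by (simp add: levi_civita_def tproj_def)
qed

end

text \<open>General sphere-valued maps are treated because biharmonicity evaluates the bienergy on
  every map of a variation.\<close>

locale sphere_valued = round_sphere S r \<kappa> m
  for S :: "'a::euclidean_space set" and r \<kappa> m :: real +
  fixes \<psi> :: "'a \<Rightarrow> 'c::euclidean_space"
  assumes \<psi>: "smooth_on S \<psi>" and \<psi>1: "x \<in> S \<Longrightarrow> \<psi> x \<bullet> \<psi> x = 1"
begin

lemma \<psi>_sD: "x \<in> S \<Longrightarrow> \<psi> x \<bullet> sD r v \<psi> x = 0"
  using sD_inner[OF _ \<psi> \<psi>, of x v] sD_cong[of x "\<lambda>x. \<psi> x \<bullet> \<psi> x" "\<lambda>x. 1" v] \<psi>1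
  by (simp add: inner_commute)

lemma tension_eq:
  assumes x: "x \<in> S"
  shows "tension r \<psi> x = - tproj (\<psi> x) (slap r \<psi> x)"
proof -
  interpret tp: linear "tproj (\<psi> x)" by (rule linear_tproj)
  interpret sd: linear "sderiv r \<psi> x" using linear_sderiv[of x r \<psi>] \<psi> x S_def by simp
  have "second_ff r \<psi> x e e = tproj (\<psi> x) (sD r e (sD r e \<psi>) x)" if e: "e \<in> onb x" for e
    unfolding second_ff_def levi_civita_tproj[OF x onb_tangent[OF e]] pb_conn_def sderiv_onb[OF e]
    by (simp add: sd.zero flip: sD_def)
  then have "tension r \<psi> x = tr x (\<lambda>e. tproj (\<psi> x) (sD r e (sD r e \<psi>) x))"
    unfolding tension_def by (rule tr_cong)
  also have "\<dots> = tproj (\<psi> x) (tr x (\<lambda>e. sD r e (sD r e \<psi>) x))"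
    by (simp add: tr_def tp.sum)
  finally show ?thesis by (simp add: tr_sD_sD[OF x \<psi>] tp.neg)
qed

lemma norm_tension:
  assumes x: "x \<in> S"
  shows "(norm (tension r \<psi> x))\<^sup>2 = slap r \<psi> x \<bullet> slap r \<psi> x - (\<psi> x \<bullet> slap r \<psi> x)\<^sup>2"
  unfolding tension_eq[OF x] tproj_unit[OF \<psi>1[OF x]] norm_minus_cancel power2_norm_eq_inner
  using \<psi>1[OF x] by (simp add: inner_simps inner_commute power2_eq_square)

definition along :: "('a \<Rightarrow> 'c) \<Rightarrow> 'a \<Rightarrow> 'c" where
  "along V x = (\<Sum>b\<in>Basis. (V x \<bullet> sD r b \<psi> x) *\<^sub>R sD r b \<psi> x)"

lemma smooth_along: "smooth_on S V \<Longrightarrow> smooth_on S (along V)"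
  unfolding along_def[abs_def] by (intro smooth_intros \<psi>)

lemma tr_along_eq:
  assumes x: "x \<in> S"
  shows "tr_along r \<psi> V x = along V x"
proof -
  have "bounded_bilinear (\<lambda>u v. (V x \<bullet> u) *\<^sub>R v)"
    by (rule bounded_bilinear.comp1[OF bounded_bilinear_scaleR bounded_linear_inner_right])
  from tr_sD_bilinear[OF this x \<psi> \<psi>] show ?thesis
    by (simp add: tr_along_def along_def sderiv_onb cong: tr_cong)
qed

lemma energy_density_eq:
  assumes x: "x \<in> S"
  shows "energy_density r \<psi> x = (\<Sum>b\<in>Basis. sD r b \<psi> x \<bullet> sD r b \<psi> x)"
  using tr_sD_bilinear[OF bounded_bilinear_inner x \<psi> \<psi>]
  by (simp add: energy_density_def sderiv_onb power2_norm_eq_inner cong: tr_cong)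

lemma dinner_eq:
  assumes x: "x \<in> S" and V: "smooth_on S V"
  shows "dinner r \<psi> V x = (\<Sum>b\<in>Basis. sD r b V x \<bullet> sD r b \<psi> x)"
proof -
  have "pb_conn r \<psi> V x e \<bullet> sderiv r \<psi> x e = sD r e V x \<bullet> sD r e \<psi> x" if "e \<in> onb x" for e
    using \<psi>_sD[OF x, of e] that
    by (simp add: pb_conn_def sderiv_onb tproj_unit[OF \<psi>1[OF x]] inner_diff_left)
  then have "dinner r \<psi> V x = tr x (\<lambda>e. sD r e V x \<bullet> sD r e \<psi> x)"
    unfolding dinner_def by (rule tr_cong)
  then show ?thesis using tr_sD_bilinear[OF bounded_bilinear_inner x V \<psi>] by simp
qed

text \<open>Differentiating the projection of \<open>W = sD r e V\<close> brings in
  \<open>- (\<psi> x \<bullet> W x)\<close> times the derivative of \<open>\<psi>\<close>. By \<psi>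
  \<bullet> V = 0 this factor is \<open>V x \<bullet> sD r e \<psi> x\<close>, and the trace of the
  extra term is \<open>along V x\<close>.\<close>

lemma laplacian_eq:
  assumes x: "x \<in> S" and V: "smooth_on S V" and \<psi>V: "\<And>x. x \<in> S \<Longrightarrow> \<psi> x \<bullet> V x = 0"
  shows "laplacian r \<psi> V x = tproj (\<psi> x) (slap r V x) - along V x"
proof -
  interpret tp: linear "tproj (\<psi> x)" by (rule linear_tproj)
  have "cov2 r \<psi> V x e e = tproj (\<psi> x) (sD r e (sD r e V) x) + (V x \<bullet> sD r e \<psi> x) *\<^sub>R sD r e \<psi> x"
    if e: "e \<in> onb x" for e
  proof -
    interpret sd: linear "sderiv r V x" using linear_sderiv[of x r V] V x S_def by simp
    define W where "W = sD r e V"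
    have W: "smooth_on S W" unfolding W_def by (intro smooth_intros V)
    have "cov2 r \<psi> V x e e = tproj (\<psi> x) (sD r e (\<lambda>y. tproj (\<psi> y) (W y)) x)"
      unfolding cov2_def levi_civita_tproj[OF x onb_tangent[OF e]] pb_conn_def sderiv_onb[OF e]
      by (simp add: sd.zero tp.zero W_def flip: sD_def)
    also have "sD r e (\<lambda>y. tproj (\<psi> y) (W y)) x = sD r e (\<lambda>y. W y - (\<psi> y \<bullet> W y) *\<^sub>R \<psi> y) x"
      by (intro sD_cong x tproj_unit \<psi>1)
    also have "\<dots> = sD r e W x - ((\<psi> x \<bullet> W x) *\<^sub>R sD r e \<psi> x + sD r e (\<lambda>y. \<psi> y \<bullet> W y) x *\<^sub>R \<psi> x)"
    proof -
      have s: "smooth_on S (\<lambda>y. \<psi> y \<bullet> W y)" by (intro smooth_intros \<psi> W)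
      have "smooth_on S (\<lambda>y. (\<psi> y \<bullet> W y) *\<^sub>R \<psi> y)" by (rule smooth_on_scaleR[OF s \<psi>])
      then show ?thesis unfolding sD_scaleR[OF x s \<psi>, symmetric] by (rule sD_diff[OF x W])
    qed
    also have "tproj (\<psi> x) \<dots> = tproj (\<psi> x) (sD r e W x) - (\<psi> x \<bullet> W x) *\<^sub>R sD r e \<psi> x"
      using \<psi>_sD[OF x, of e] \<psi>1[OF x]
      by (simp add: tp.diff tp.add tp.scale tproj_orthogonal) (simp add: tproj_unit)
    also have "\<psi> x \<bullet> W x = - (V x \<bullet> sD r e \<psi> x)"
      using sD_inner[OF x \<psi> V, of e] sD_cong[OF x, of "\<lambda>x. \<psi> x \<bullet> V x" "\<lambda>x. 0" e] \<psi>V x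
      by (simp add: W_def inner_commute)
    finally show ?thesis by (simp add: W_def)
  qed
  then have "laplacian r \<psi> V x = - tr x (\<lambda>e. tproj (\<psi> x) (sD r e (sD r e V) x)
      + (V x \<bullet> sD r e \<psi> x) *\<^sub>R sD r e \<psi> x)"
    unfolding laplacian_def by (simp cong: tr_cong)
  also have "tr x (\<lambda>e. tproj (\<psi> x) (sD r e (sD r e V) x) + (V x \<bullet> sD r e \<psi> x) *\<^sub>R sD r e \<psi> x)
      = tproj (\<psi> x) (tr x (\<lambda>e. sD r e (sD r e V) x)) + tr x (\<lambda>e. (V x \<bullet> sD r e \<psi> x) *\<^sub>R sD r e \<psi> x)"
    by (simp add: tr_def sum.distrib tp.sum)
  also have "tr x (\<lambda>e. (V x \<bullet> sD r e \<psi> x) *\<^sub>R sD r e \<psi> x) = along V x"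
    using tr_along_eq[OF x, of V] by (simp add: tr_along_def sderiv_onb cong: tr_cong)
  finally show ?thesis by (simp add: tr_sD_sD[OF x V] tp.neg)
qed

section \<open>Sections along a sphere-valued map\<close>

definition section_along :: "('a \<Rightarrow> 'c) \<Rightarrow> bool" where
  "section_along V \<longleftrightarrow> smooth_on S V \<and> (\<forall>x\<in>S. \<psi> x \<bullet> V x = 0)"

lemma section_alongD: "section_along V \<Longrightarrow> smooth_on S V" "section_along V \<Longrightarrow> x \<in> S \<Longrightarrow> \<psi> x \<bullet> V x = 0"
  by (auto simp: section_along_def)

lemma section_along_cong:
  assumes "section_along V" "\<And>x. x \<in> S \<Longrightarrow> V x = W x"
  shows "section_along W"
  using assms smooth_on_cong[of S V W] unfolding section_along_def by simp

lemma section_along_along: "smooth_on S V \<Longrightarrow> section_along (along V)"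
  using smooth_along \<psi>_sD by (simp add: section_along_def along_def inner_sum_right)

lemma section_along_diff: "section_along V \<Longrightarrow> section_along W \<Longrightarrow> section_along (\<lambda>x. V x - W x)"
  by (auto simp: section_along_def inner_diff_right)

lemma section_along_cmult: "section_along V \<Longrightarrow> section_along (\<lambda>x. c *\<^sub>R V x)"
  by (auto simp: section_along_def)

lemma laplacian_eq':
  assumes V: "section_along V" and x: "x \<in> S"
  shows "laplacian r \<psi> V x = slap r V x - (\<psi> x \<bullet> slap r V x) *\<^sub>R \<psi> x - along V x"
  using laplacian_eq[OF x section_alongD[OF V]] tproj_unit[OF \<psi>1[OF x]] by simp

lemma section_along_laplacian:
  assumes V: "section_along V"
  shows "section_along (laplacian r \<psi> V)"
proof (rule section_along_cong)
  note sV = section_alongD(1)[OF V]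
  show "section_along (\<lambda>x. slap r V x - (\<psi> x \<bullet> slap r V x) *\<^sub>R \<psi> x - along V x)"
    using section_alongD[OF section_along_along[OF sV]] \<psi>1
    by (auto simp: section_along_def inner_diff_right intro!: smooth_intros sV \<psi>)
  show "slap r V x - (\<psi> x \<bullet> slap r V x) *\<^sub>R \<psi> x - along V x = laplacian r \<psi> V x" if "x \<in> S" for x
    using laplacian_eq'[OF V that] by simp
qed

lemma along_inner: "along V x \<bullet> W = (\<Sum>b\<in>Basis. (V x \<bullet> sD r b \<psi> x) * (W \<bullet> sD r b \<psi> x))"
  unfolding along_def inner_sum_left by (intro sum.cong refl) (simp add: inner_commute)

lemma laplacian_inner:
  assumes V: "section_along V" and x: "x \<in> S" and W: "\<psi> x \<bullet> W = 0"
  shows "laplacian r \<psi> V x \<bullet> W = slap r V x \<bullet> W - along V x \<bullet> W"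
  unfolding laplacian_eq'[OF V x] using W by (simp add: inner_diff_left)

lemma ip_laplacian:
  assumes V: "section_along V" and W: "section_along W"
  shows "ip (laplacian r \<psi> V) W = ip V (laplacian r \<psi> W)"
proof -
  note s = section_alongD(1)[OF V] section_alongD(1)[OF W]
  have *: "ip (laplacian r \<psi> V') W' = ip (slap r V') W' - ip (along V') W'"
    if V': "section_along V'" and W': "section_along W'" for V' W'
  proof -
    have "ip (laplacian r \<psi> V') W' = ip (\<lambda>x. slap r V' x - along V' x) W'"
      unfolding ip_def using laplacian_inner[OF V'] section_alongD(2)[OF W']
      by (intro sint_cong) (simp add: inner_diff_left)
    then show ?thesis
      using section_alongD(1)[OF V'] section_alongD(1)[OF W']
      by (simp add: ip_diff_left smooth_on_slap smooth_along)
  qed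
  have "ip (along V) W = ip (along W) V"
    unfolding ip_def by (intro sint_cong) (simp add: along_inner mult.commute)
  then show ?thesis
    unfolding *[OF V W] ip_commute[of V] *[OF W V] using ip_slap[OF s] by (simp add: ip_commute)
qed

end


subsection \<open>The second variation at the tropical map\<close>

text \<open>\<open>L\<close> is a linear isometric embedding of the ambient spaces; its restriction
  to \<open>S\<close> is the totally geodesic inclusion of the smaller sphere.\<close>

locale tropical_map = round_sphere S r \<kappa> m
  for S :: "'a::euclidean_space set" and r \<kappa> m :: real +
  fixes L :: "'a \<Rightarrow> 'b::euclidean_space"
  assumes linear_L: "linear L" and norm_L: "norm (L x) = norm x" and r_eq: "r = 1 / sqrt 2"
begin

abbreviation \<phi> :: "'a \<Rightarrow> 'b \<times> real" where "\<phi> \<equiv> tropical \<circ> L"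

definition \<eta> :: "'a \<Rightarrow> 'b \<times> real" where "\<eta> x = (L x, - r)"

lemma r_sq: "r * r = 1 / 2"
  by (simp add: r_eq)

lemma \<kappa>_eq: "\<kappa> = 2"
  by (simp add: \<kappa>_def power2_eq_square r_sq)

lemma \<phi>_apply: "\<phi> x = (L x, r)"
  by (simp add: tropical_def r_eq)

lemma L_inner: "L x \<bullet> L y = x \<bullet> y"
  by (simp add: dot_norm norm_L flip: linear_add[OF linear_L])

lemma S_inner2: "x \<in> S \<Longrightarrow> x \<bullet> x = 1 / 2"
  using S_inner'[of x] by (simp add: \<kappa>_eq)

definition LT :: "'b \<Rightarrow> 'a" where "LT = adjoint L"

lemma LT_inner: "x \<bullet> LT y = L x \<bullet> y" "LT y \<bullet> x = y \<bullet> L x"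
  using adjoint_works[OF linear_L, of x y] by (simp_all add: LT_def inner_commute)

lemma linear_LT: "linear LT"
  unfolding LT_def by (rule adjoint_linear[OF linear_L])

lemma LT_L: "LT (L x) = x"
  by (rule vector_eq_rdot[THEN iffD1]) (simp add: LT_inner L_inner)

lemma linear_L_0: "linear (\<lambda>x. (L x, 0 :: real))"
  using linear_L by (auto intro!: linearI simp: linear_add linear_scale)

lemma smooth_affine: "smooth_on S (\<lambda>x. (L x, c :: real))"
  by (intro smooth_on_Pair smooth_on_linear linear_L smooth_on_const)

lemma sD_affine:
  assumes x: "x \<in> S"
  shows "sD r v (\<lambda>x. (L x, c :: real)) x = (L (v - (\<kappa> * (x \<bullet> v)) *\<^sub>R x), 0)"
  using sD_add[OF x smooth_affine[of 0] smooth_on_const, of v "(0, c)"] x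
  by (simp add: sD_linear[OF linear_L_0 x])

lemma slap_affine:
  assumes x: "x \<in> S"
  shows "slap r (\<lambda>x. (L x, c :: real)) x = ((\<kappa> * m) *\<^sub>R L x, 0)"
  using slap_add[OF x smooth_affine[of 0] smooth_on_const, of "(0, c)"] x
  by (simp add: slap_linear[OF linear_L_0 x])

lemma \<phi>_eq: "\<phi> = (\<lambda>x. (L x, r))" and \<eta>_eq: "\<eta> = (\<lambda>x. (L x, - r))"
  by (simp_all only: fun_eq_iff \<phi>_apply \<eta>_def simp_thms)

lemma smooth_\<phi>: "smooth_on S \<phi>" and smooth_\<eta>: "smooth_on S \<eta>"
  unfolding \<phi>_eq \<eta>_eq by (rule smooth_affine)+

lemma \<phi>_\<phi>: "x \<in> S \<Longrightarrow> \<phi> x \<bullet> \<phi> x = 1"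
  by (simp add: \<phi>_apply L_inner S_inner2 r_sq del: o_apply)

sublocale sphere_valued S r \<kappa> m \<phi>
  by unfold_locales (use smooth_\<phi> \<phi>_\<phi> in auto)

lemma \<phi>_\<eta>: "x \<in> S \<Longrightarrow> \<phi> x \<bullet> \<eta> x = 0"
  by (simp add: \<phi>_apply \<eta>_def L_inner S_inner2 r_sq del: o_apply)

lemma \<eta>_\<eta>: "x \<in> S \<Longrightarrow> \<eta> x \<bullet> \<eta> x = 1"
  by (simp add: \<eta>_def L_inner S_inner2 r_sq)

lemma sD_\<phi>: "x \<in> S \<Longrightarrow> sD r v \<phi> x = (L (v - (\<kappa> * (x \<bullet> v)) *\<^sub>R x), 0)"
  unfolding \<phi>_eq by (rule sD_affine)

lemma sD_\<eta>: "x \<in> S \<Longrightarrow> sD r v \<eta> x = sD r v \<phi> x"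
  unfolding \<phi>_eq \<eta>_eq by (simp add: sD_affine)

lemma slap_\<phi>: "x \<in> S \<Longrightarrow> slap r \<phi> x = ((2 * m) *\<^sub>R L x, 0)"
  unfolding \<phi>_eq by (simp add: slap_affine \<kappa>_eq)

lemma tension_\<phi>:
  assumes x: "x \<in> S"
  shows "tension r \<phi> x = - m *\<^sub>R \<eta> x"
proof -
  have "\<phi> x \<bullet> slap r \<phi> x = m"
    using S_inner2[OF x] by (simp add: slap_\<phi>[OF x] \<phi>_apply L_inner del: o_apply)
  then show ?thesis
    unfolding tension_eq[OF x] tproj_unit[OF \<phi>_\<phi>[OF x]]
    by (simp add: slap_\<phi>[OF x] \<phi>_apply \<eta>_def del: o_apply) (simp add: algebra_simps flip: scaleR_add_left)
qed

lemma srad_eq: "srad w x = 2 * (x \<bullet> w x)"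
  by (simp only: srad_def) (simp only: \<kappa>_eq)

lemma tangential_norm:
  assumes x: "x \<in> S"
  shows "(v - (\<kappa> * (x \<bullet> v)) *\<^sub>R x) \<bullet> (w - (\<kappa> * (x \<bullet> w)) *\<^sub>R x) = v \<bullet> w - \<kappa> * (x \<bullet> v) * (x \<bullet> w)"
  by (simp add: inner_simps S_inner2[OF x] \<kappa>_eq inner_commute algebra_simps)

lemma energy_\<phi>:
  assumes x: "x \<in> S"
  shows "(\<Sum>b\<in>Basis. sD r b \<phi> x \<bullet> sD r b \<phi> x) = m"
proof -
  have "(\<Sum>b\<in>Basis. sD r b \<phi> x \<bullet> sD r b \<phi> x) = (\<Sum>b\<in>Basis. 1 - \<kappa> * ((x \<bullet> b) * (x \<bullet> b)))"
    by (intro sum.cong refl) (simp add: sD_\<phi>[OF x] L_inner tangential_norm[OF x])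
  also have "\<dots> = m"
    using S_inner'[OF x] by (simp add: sum_subtractf m_def euclidean_inner[of x x] flip: sum_distrib_left)
  finally show ?thesis .
qed

text \<open>The adjoint takes the projection onto the range of \<open>L\<close> back to the ambient
  space of the domain, where \<open>sdiv\<close> and \<open>srad\<close> apply.\<close>

definition hpart :: "('a \<Rightarrow> 'b \<times> real) \<Rightarrow> 'a \<Rightarrow> 'a" where
  "hpart V x = LT (fst (V x))"

lemma linear_LT_fst: "linear (\<lambda>v. LT (fst v))"
  using linear_compose[OF linear_fst linear_LT] by (simp add: o_def)

lemma smooth_hpart: "smooth_on S V \<Longrightarrow> smooth_on S (hpart V)"
  unfolding hpart_def[abs_def] by (rule smooth_on_compose_linear[OF linear_LT_fst])

context
  fixes V :: "'a \<Rightarrow> 'b \<times> real"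
  assumes V: "section_along V"
begin

private lemma sV: "smooth_on S V" and \<phi>V: "x \<in> S \<Longrightarrow> \<phi> x \<bullet> V x = 0"
  using section_alongD[OF V] by auto

private lemma sw: "smooth_on S (hpart V)"
  by (rule smooth_hpart[OF sV])

private lemma sf: "smooth_on S (srad (hpart V))"
  by (rule smooth_srad[OF sw])

text \<open>Orthogonality to \<open>\<phi>\<close> determines the last component from the normal
  one; the relation is multiplied by \<open>r\<close> so that \<open>r * r = 1 / 2\<close> can be
  used.\<close>

lemma section_snd:
  assumes x: "x \<in> S"
  shows "snd (V x) = - r * srad (hpart V) x"
proof -
  have "L x \<bullet> fst (V x) + r * snd (V x) = 0"
    using \<phi>V[OF x] by (simp add: \<phi>_apply inner_prod_def del: o_apply)
  then have "r * (L x \<bullet> fst (V x)) + (r * r) * snd (V x) = 0" by algebra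
  then show ?thesis by (simp add: srad_eq hpart_def LT_inner r_sq)
qed

lemma \<eta>_section:
  assumes x: "x \<in> S"
  shows "\<eta> x \<bullet> V x = srad (hpart V) x"
proof -
  have "L x \<bullet> fst (V x) + r * snd (V x) = 0"
    using \<phi>V[OF x] by (simp add: \<phi>_apply inner_prod_def del: o_apply)
  then show ?thesis by (simp add: \<eta>_def inner_prod_def srad_eq hpart_def LT_inner)
qed

lemma section_sD_\<phi>:
  assumes x: "x \<in> S"
  shows "V x \<bullet> sD r b \<phi> x = hpart V x \<bullet> (b - (\<kappa> * (x \<bullet> b)) *\<^sub>R x)"
  by (simp add: sD_\<phi>[OF x] inner_prod_def hpart_def LT_inner)

text \<open>The projection inside the derivative of \<open>\<phi>\<close> adds only a contraction of
  the gradient with \<open>x\<close>, which is zero.\<close>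

lemma dinner_section:
  assumes x: "x \<in> S"
  shows "(\<Sum>b\<in>Basis. sD r b V x \<bullet> sD r b \<phi> x) = sdiv (hpart V) x"
proof -
  have 1: "sD r b V x \<bullet> sD r b \<phi> x = sD r b (\<lambda>y. hpart V y \<bullet> b) x - \<kappa> * (((x \<bullet> b) *\<^sub>R sD r b (hpart V) x) \<bullet> x)" for b
  proof -
    have "sD r b (hpart V) x = LT (fst (sD r b V x))"
      unfolding hpart_def[abs_def] by (rule sD_compose_linear[OF linear_LT_fst x sV])
    moreover have "sD r b (\<lambda>y. hpart V y \<bullet> b) x = sD r b (hpart V) x \<bullet> b"
      by (rule sD_compose_linear[OF _ x sw]) (auto intro!: linearI simp: inner_add_left)
    ultimately show ?thesis
      by (simp add: sD_\<phi>[OF x] inner_prod_def inner_diff_right flip: LT_inner)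
  qed
  show ?thesis
    unfolding 1 sum_subtractf sum_distrib_left[symmetric] inner_sum_left[symmetric] sum_coord_sD[OF x sw]
    by (simp add: sdiv_def)
qed

text \<open>Apply the Laplacian to \<phi> \<bullet> V = 0. The square of the \<open>2 * sdiv\<close>
  found here is the source of the factor 4 in the Hessian.\<close>

lemma \<phi>_slap_section:
  assumes x: "x \<in> S"
  shows "\<phi> x \<bullet> slap r V x = 2 * sdiv (hpart V) x - m * srad (hpart V) x"
proof -
  have "slap r (\<lambda>x. \<phi> x \<bullet> V x) x = 0"
    using slap_cong[OF x, of "\<lambda>x. \<phi> x \<bullet> V x" "\<lambda>x. 0"] \<phi>V x by (simp del: o_apply)
  then have "\<phi> x \<bullet> slap r V x + slap r \<phi> x \<bullet> V x - 2 * (\<Sum>b\<in>Basis. sD r b \<phi> x \<bullet> sD r b V x) = 0"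
    using slap_bilinear[OF bounded_bilinear_inner x smooth_\<phi> sV] by (simp del: o_apply)
  moreover have "slap r \<phi> x \<bullet> V x = m * srad (hpart V) x"
    by (simp add: slap_\<phi>[OF x] inner_prod_def srad_eq hpart_def LT_inner)
  ultimately show ?thesis
    using dinner_section[OF x] by (simp add: inner_commute del: o_apply)
qed

text \<open>\<open>\<phi>\<close> is an isometric immersion, so trace<V, d\<phi>> d\<phi> is the
  orthogonal projection onto the image of d\<phi>.\<close>

lemma along_section:
  assumes x: "x \<in> S"
  shows "along V x = (L (tproj x (hpart V x)), 0)"
proof -
  interpret lt: linear "tproj x" by (rule linear_tproj)
  interpret l: linear "\<lambda>x. (L x, 0::real)" by (rule linear_L_0)
  have t: "tproj x b = b - (\<kappa> * (x \<bullet> b)) *\<^sub>R x" for b by (rule tproj_S[OF x])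
  have sym: "u \<bullet> tproj x b = tproj x u \<bullet> b" for u b
    by (simp add: t inner_diff_left inner_diff_right inner_commute)
  have "along V x = (\<Sum>b\<in>Basis. (tproj x (hpart V x) \<bullet> b) *\<^sub>R (L (tproj x b), 0))"
    unfolding along_def section_sD_\<phi>[OF x] unfolding sD_\<phi>[OF x] t[symmetric] sym ..
  also have "\<dots> = (L (tproj x (\<Sum>b\<in>Basis. (tproj x (hpart V x) \<bullet> b) *\<^sub>R b)), 0)"
    by (simp only: lt.sum lt.scale l.sum l.scale)
  also have "tproj x (\<Sum>b\<in>Basis. (tproj x (hpart V x) \<bullet> b) *\<^sub>R b) = tproj x (hpart V x)"
    using tproj_tangent[OF tproj_tangent_S[OF x]] by (simp add: euclidean_representation)
  finally show ?thesis .
qed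

lemma along_inner_section:
  assumes x: "x \<in> S"
  shows "along V x \<bullet> V x = along V x \<bullet> along V x"
proof -
  have "tproj x (hpart V x) \<bullet> hpart V x = tproj x (hpart V x) \<bullet> tproj x (hpart V x)"
    by (simp add: tproj_S[OF x] inner_simps S_inner2[OF x] \<kappa>_eq inner_commute algebra_simps)
  moreover have "L (tproj x (hpart V x)) \<bullet> fst (V x) = tproj x (hpart V x) \<bullet> hpart V x"
    by (simp add: hpart_def LT_inner)
  ultimately show ?thesis by (simp add: along_section[OF x] inner_prod_def L_inner)
qed

text \<open>Differentiate f = \<eta> \<bullet> V, using that \<open>\<eta>\<close> and
  \<open>\<phi>\<close> have the same derivative; then contract with V, where the radial part of the
  gradient of f drops out.\<close>

lemma normal_derivative_sum:
  assumes x: "x \<in> S"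
  shows "(\<Sum>b\<in>Basis. (\<eta> x \<bullet> sD r b V x) * (V x \<bullet> sD r b \<phi> x))
    = (\<Sum>b\<in>Basis. (hpart V x \<bullet> b) * sD r b (srad (hpart V)) x) - along V x \<bullet> V x"
proof -
  have 1: "\<eta> x \<bullet> sD r b V x = sD r b (srad (hpart V)) x - V x \<bullet> sD r b \<phi> x" for b
  proof -
    have "sD r b (srad (hpart V)) x = sD r b (\<lambda>x. \<eta> x \<bullet> V x) x"
      by (rule sD_cong[OF x]) (simp add: \<eta>_section)
    also have "\<dots> = \<eta> x \<bullet> sD r b V x + sD r b \<phi> x \<bullet> V x"
      by (simp add: sD_inner[OF x smooth_\<eta> sV] sD_\<eta>[OF x])
    finally show ?thesis by (simp add: inner_commute)
  qed
  have 2: "(\<Sum>b\<in>Basis. sD r b (srad (hpart V)) x * (V x \<bullet> sD r b \<phi> x))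
      = (\<Sum>b\<in>Basis. (hpart V x \<bullet> b) * sD r b (srad (hpart V)) x)"
  proof -
    have "(\<Sum>b\<in>Basis. sD r b (srad (hpart V)) x * (V x \<bullet> sD r b \<phi> x))
        = (\<Sum>b\<in>Basis. (hpart V x \<bullet> b) * sD r b (srad (hpart V)) x
           - \<kappa> * (hpart V x \<bullet> x) * ((x \<bullet> b) *\<^sub>R sD r b (srad (hpart V)) x))"
      unfolding section_sD_\<phi>[OF x] by (intro sum.cong refl) (simp add: inner_diff_right algebra_simps)
    also have "\<dots> = (\<Sum>b\<in>Basis. (hpart V x \<bullet> b) * sD r b (srad (hpart V)) x)"
      unfolding sum_subtractf sum_distrib_left[symmetric] sum_coord_sD[OF x sf] by simp
    finally show ?thesis .
  qed
  show ?thesis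
    unfolding 1 left_diff_distrib sum_subtractf 2 along_inner ..
qed

text \<open>Here \<tau> = -m \<eta>, |d\<phi>|^2 = m and <d\<tau>, d\<phi>> = -m^2. The zeroth-order
  multiples of V cancel, -2 m^2 + m^2 + m^2 = 0, and the \<open>along V\<close> terms with
  coefficients 2 m and -2 m cancel as well.\<close>

lemma second_variation_eq:
  assumes x: "x \<in> S"
  shows "second_variation r \<phi> V x =
    laplacian r \<phi> (laplacian r \<phi> V) x
    + laplacian r \<phi> (\<lambda>y. along V y - m *\<^sub>R V y) x
    + ((2 * m) *\<^sub>R (\<Sum>b\<in>Basis. (\<eta> x \<bullet> sD r b V x) *\<^sub>R sD r b \<phi> x)
    - (m\<^sup>2 * (\<eta> x \<bullet> V x)) *\<^sub>R \<eta> x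
    + along (laplacian r \<phi> V) x + along (along V) x
    - (2 * m * sdiv (hpart V) x) *\<^sub>R \<eta> x - m *\<^sub>R laplacian r \<phi> V x)"
proof -
  have s\<tau>: "smooth_on S (tension r \<phi>)"
  proof (rule smooth_on_cong)
    show "smooth_on S (\<lambda>x. - m *\<^sub>R \<eta> x)" by (intro smooth_intros smooth_\<eta>)
  qed (simp add: tension_\<phi> del: o_apply)
  have sD\<tau>: "sD r v (tension r \<phi>) x = - m *\<^sub>R sD r v \<phi> x" for v
  proof -
    have "sD r v (tension r \<phi>) x = sD r v (\<lambda>x. (- m) *\<^sub>R \<eta> x) x"
      by (rule sD_cong[OF x]) (simp add: tension_\<phi> del: o_apply)
    then show ?thesis by (simp only: sD_cmult[OF x smooth_\<eta>] sD_\<eta>[OF x])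
  qed
  have e: "energy_density r \<phi> y = m" if "y \<in> S" for y
    using energy_density_eq[OF that] energy_\<phi>[OF that] by simp
  have d\<tau>: "dinner r \<phi> (tension r \<phi>) x = - (m\<^sup>2)"
    unfolding dinner_eq[OF x s\<tau>] sD\<tau> inner_scaleR_left sum_distrib_left[symmetric] energy_\<phi>[OF x]
    by (simp add: power2_eq_square)
  have dV: "dinner r \<phi> V x = sdiv (hpart V) x"
    unfolding dinner_eq[OF x sV] dinner_section[OF x] ..
  have n\<tau>: "(norm (tension r \<phi> x))\<^sup>2 = m\<^sup>2"
    using \<eta>_\<eta>[OF x] by (simp add: tension_\<phi>[OF x] power_mult_distrib power2_norm_eq_inner del: o_apply)
  have t1: "tr x (\<lambda>e. inner (V x) (pb_conn r \<phi> (tension r \<phi>) x e) *\<^sub>R sderiv r \<phi> x e) = - m *\<^sub>R along V x"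
  proof -
    have "tr x (\<lambda>e. inner (V x) (pb_conn r \<phi> (tension r \<phi>) x e) *\<^sub>R sderiv r \<phi> x e)
        = tr x (\<lambda>e. (- m) *\<^sub>R (inner (V x) (sderiv r \<phi> x e) *\<^sub>R sderiv r \<phi> x e))"
    proof (rule tr_cong)
      fix e assume e: "e \<in> onb x"
      have "pb_conn r \<phi> (tension r \<phi>) x e = - m *\<^sub>R sD r e \<phi> x"
        unfolding pb_conn_def sderiv_onb[OF e] sD\<tau>
        using \<psi>_sD[OF x, of e] by (intro tproj_orthogonal) simp
      then show "inner (V x) (pb_conn r \<phi> (tension r \<phi>) x e) *\<^sub>R sderiv r \<phi> x e
          = (- m) *\<^sub>R (inner (V x) (sderiv r \<phi> x e) *\<^sub>R sderiv r \<phi> x e)"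
        unfolding sderiv_onb[OF e] by simp
    qed
    also have "\<dots> = - m *\<^sub>R tr_along r \<phi> V x" unfolding tr_along_def tr_def scaleR_sum_right ..
    finally show ?thesis unfolding tr_along_eq[OF x] .
  qed
  have t2: "tr x (\<lambda>e. inner (tension r \<phi> x) (pb_conn r \<phi> V x e) *\<^sub>R sderiv r \<phi> x e)
      = - m *\<^sub>R (\<Sum>b\<in>Basis. (\<eta> x \<bullet> sD r b V x) *\<^sub>R sD r b \<phi> x)"
  proof -
    have "tr x (\<lambda>e. inner (tension r \<phi> x) (pb_conn r \<phi> V x e) *\<^sub>R sderiv r \<phi> x e)
        = tr x (\<lambda>e. (- m) *\<^sub>R ((\<eta> x \<bullet> sD r e V x) *\<^sub>R sD r e \<phi> x))"
    proof (rule tr_cong)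
      fix e assume e: "e \<in> onb x"
      have "\<eta> x \<bullet> pb_conn r \<phi> V x e = \<eta> x \<bullet> sD r e V x"
        unfolding pb_conn_def sderiv_onb[OF e] tproj_unit[OF \<phi>_\<phi>[OF x]]
        using \<phi>_\<eta>[OF x] by (simp add: inner_diff_right inner_commute[of "\<eta> x"] del: o_apply)
      then show "inner (tension r \<phi> x) (pb_conn r \<phi> V x e) *\<^sub>R sderiv r \<phi> x e
          = (- m) *\<^sub>R ((\<eta> x \<bullet> sD r e V x) *\<^sub>R sD r e \<phi> x)"
        unfolding tension_\<phi>[OF x] sderiv_onb[OF e] by simp
    qed
    also have "\<dots> = - m *\<^sub>R tr x (\<lambda>e. (\<eta> x \<bullet> sD r e V x) *\<^sub>R sD r e \<phi> x)"
      unfolding tr_def scaleR_sum_right ..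
    also have "tr x (\<lambda>e. (\<eta> x \<bullet> sD r e V x) *\<^sub>R sD r e \<phi> x)
        = (\<Sum>b\<in>Basis. (\<eta> x \<bullet> sD r b V x) *\<^sub>R sD r b \<phi> x)"
      by (rule tr_sD_bilinear[OF bounded_bilinear.comp1[OF bounded_bilinear_scaleR
              bounded_linear_inner_right] x sV smooth_\<phi>])
    finally show ?thesis .
  qed
  have U: "section_along (\<lambda>y. along V y - m *\<^sub>R V y)"
    by (intro section_along_diff section_along_along section_along_cmult V sV)
  have U': "section_along (\<lambda>y. tr_along r \<phi> V y - energy_density r \<phi> y *\<^sub>R V y)"
    by (rule section_along_cong[OF U]) (simp add: tr_along_eq e del: o_apply)
  have l: "laplacian r \<phi> (\<lambda>y. tr_along r \<phi> V y - energy_density r \<phi> y *\<^sub>R V y) x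
      = laplacian r \<phi> (\<lambda>y. along V y - m *\<^sub>R V y) x"
  proof -
    have "slap r (\<lambda>y. tr_along r \<phi> V y - energy_density r \<phi> y *\<^sub>R V y) x = slap r (\<lambda>y. along V y - m *\<^sub>R V y) x"
      by (rule slap_cong[OF x]) (simp add: tr_along_eq e del: o_apply)
    moreover have "along (\<lambda>y. tr_along r \<phi> V y - energy_density r \<phi> y *\<^sub>R V y) x = along (\<lambda>y. along V y - m *\<^sub>R V y) x"
      by (simp only: along_def[of "\<lambda>y. tr_along r \<phi> V y - energy_density r \<phi> y *\<^sub>R V y"]
          along_def[of "\<lambda>y. along V y - m *\<^sub>R V y"] tr_along_eq[OF x] e[OF x])
    ultimately show ?thesis
      unfolding laplacian_eq'[OF U x] laplacian_eq'[OF U' x] by simp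
  qed
  have aa: "tr_along r \<phi> (tr_along r \<phi> V) x = along (along V) x"
    unfolding tr_along_eq[OF x] by (simp add: along_def[of "tr_along r \<phi> V"] along_def[of "along V"] tr_along_eq[OF x] del: o_apply)
  show ?thesis
    unfolding second_variation_def l aa t1 t2 n\<tau> d\<tau> dV e[OF x]
    unfolding tr_along_eq[OF x] tension_\<phi>[OF x]
    by (simp add: algebra_simps power2_eq_square) (simp flip: scaleR_add_left)
qed

theorem hessian_form_eq:
  "hessian_form r \<phi> V V = ip (slap r V) (slap r V) - 2 * m * ip (slap r V) V
    - 4 * ip (sdiv (hpart V)) (sdiv (hpart V))"
proof -
  define \<Lambda> where "\<Lambda> = laplacian r \<phi> V"
  define U where "U y = along V y - m *\<^sub>R V y" for y
  define f where "f = srad (hpart V)"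
  define w where "w = hpart V"
  define d where "d = sdiv w"
  define R where "R x = (2 * m) *\<^sub>R (\<Sum>b\<in>Basis. (\<eta> x \<bullet> sD r b V x) *\<^sub>R sD r b \<phi> x)
    - (m\<^sup>2 * (\<eta> x \<bullet> V x)) *\<^sub>R \<eta> x + along \<Lambda> x + along (along V) x
    - (2 * m * d x) *\<^sub>R \<eta> x - m *\<^sub>R \<Lambda> x" for x
  have s\<Lambda>: "section_along \<Lambda>" unfolding \<Lambda>_def by (rule section_along_laplacian[OF V])
  have sU: "section_along U"
    unfolding U_def[abs_def] by (intro section_along_diff section_along_along section_along_cmult V sV)
  note sm = section_alongD(1)[OF s\<Lambda>] section_alongD(1)[OF sU] sV
    section_alongD(1)[OF section_along_laplacian[OF s\<Lambda>]] section_alongD(1)[OF section_along_laplacian[OF sU]]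
  have sd: "smooth_on S d" unfolding d_def w_def by (rule smooth_sdiv[OF sw])
  have sR: "smooth_on S R"
    unfolding R_def[abs_def] by (intro smooth_intros smooth_\<eta> smooth_\<phi> sm sd smooth_along)
  have "hessian_form r \<phi> V V = ip (\<lambda>x. laplacian r \<phi> \<Lambda> x + laplacian r \<phi> U x + R x) V"
    unfolding hessian_form_def ip_def
    by (rule sint_cong) (simp add: second_variation_eq R_def \<Lambda>_def U_def[abs_def] d_def w_def del: o_apply)
  also have "\<dots> = ip (laplacian r \<phi> \<Lambda>) V + ip (laplacian r \<phi> U) V + ip R V"
    by (simp add: ip_add_left sm sR smooth_on_add del: o_apply)
  \<comment> \<open>Moving the outer Laplacians across leaves only second derivatives of V, so the
    remaining comparison is pointwise.\<close>
  also have "\<dots> = ip \<Lambda> \<Lambda> + ip U \<Lambda> + ip R V"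
    unfolding ip_laplacian[OF s\<Lambda> V] ip_laplacian[OF sU V] \<Lambda>_def[symmetric] ..
  also have "\<dots> = sint (\<lambda>x. \<Lambda> x \<bullet> \<Lambda> x + U x \<bullet> \<Lambda> x + R x \<bullet> V x)"
    unfolding ip_def using sm sR by (simp add: integrable_smooth smooth_on_inner)
  also have "\<dots> = sint (\<lambda>x. slap r V x \<bullet> slap r V x - 2 * m * (slap r V x \<bullet> V x) - 4 * (d x \<bullet> d x)
      + 2 * m * (d x \<bullet> f x - m * (f x \<bullet> f x) + (\<Sum>b\<in>Basis. (w x \<bullet> b) \<bullet> sD r b f x)))"
  proof (rule sint_cong)
    fix x assume x: "x \<in> S"
    let ?a = "slap r V x" and ?p = "\<phi> x" and ?v = "V x" and ?T = "along V x"
    have pv: "?p \<bullet> ?v = 0" and pT: "?p \<bullet> ?T = 0" and pp: "?p \<bullet> ?p = 1"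
      using \<phi>V[OF x] section_alongD(2)[OF section_along_along[OF sV] x] \<phi>_\<phi>[OF x] by auto
    have Lam: "\<Lambda> x = ?a - (?p \<bullet> ?a) *\<^sub>R ?p - ?T"
      unfolding \<Lambda>_def by (rule laplacian_eq'[OF V x])
    have pa: "?p \<bullet> ?a = 2 * d x - m * f x"
      unfolding d_def f_def w_def by (rule \<phi>_slap_section[OF x])
    have LT: "(\<Lambda> x + ?T) \<bullet> (\<Lambda> x + ?T) = ?a \<bullet> ?a - (2 * d x - m * f x)\<^sup>2"
      unfolding Lam pa[symmetric] using pp by (simp add: inner_simps inner_commute power2_eq_square del: o_apply)
    have Lv: "\<Lambda> x \<bullet> ?v = ?a \<bullet> ?v - ?T \<bullet> ?v"
      unfolding Lam using pv by (simp add: inner_diff_left del: o_apply)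
    have n: "(\<Sum>b\<in>Basis. (\<eta> x \<bullet> sD r b V x) *\<^sub>R sD r b \<phi> x) \<bullet> ?v
        = (\<Sum>b\<in>Basis. (w x \<bullet> b) * sD r b f x) - ?T \<bullet> ?v"
      using normal_derivative_sum[OF x] unfolding f_def w_def inner_sum_left inner_scaleR_left
      by (simp only: inner_commute[of "sD r b \<phi> x" "V x" for b])
    have aL: "along \<Lambda> x \<bullet> ?v = ?T \<bullet> \<Lambda> x" unfolding along_inner by (simp add: mult.commute)
    have aT: "along (along V) x \<bullet> ?v = ?T \<bullet> ?v"
      unfolding along_inner_section[OF x] by (subst (1 2) along_inner) (simp add: mult.commute)
    have TT: "?T \<bullet> ?T = ?T \<bullet> ?v" using along_inner_section[OF x] by simp
    have ev: "\<eta> x \<bullet> ?v = f x" unfolding f_def by (rule \<eta>_section[OF x])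
    have "R x \<bullet> ?v = 2 * m * ((\<Sum>b\<in>Basis. (w x \<bullet> b) * sD r b f x) - ?T \<bullet> ?v) - m\<^sup>2 * f x * f x
        + ?T \<bullet> \<Lambda> x + ?T \<bullet> ?v - 2 * m * d x * f x - m * (\<Lambda> x \<bullet> ?v)"
      unfolding R_def inner_diff_left inner_add_left inner_scaleR_left n aL aT ev by simp
    moreover have "U x \<bullet> \<Lambda> x = ?T \<bullet> \<Lambda> x - m * (\<Lambda> x \<bullet> ?v)"
      by (simp add: U_def inner_diff_left inner_commute[of "\<Lambda> x" "V x"])
    moreover have "\<Lambda> x \<bullet> \<Lambda> x = (?a \<bullet> ?a - (2 * d x - m * f x)\<^sup>2) - 2 * (?T \<bullet> \<Lambda> x) - ?T \<bullet> ?v"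
      using LT TT by (simp add: inner_add_left inner_add_right inner_commute[of "\<Lambda> x" "along V x"])
    ultimately show "\<Lambda> x \<bullet> \<Lambda> x + U x \<bullet> \<Lambda> x + R x \<bullet> V x
        = slap r V x \<bullet> slap r V x - 2 * m * (slap r V x \<bullet> V x) - 4 * (d x \<bullet> d x)
      + 2 * m * (d x \<bullet> f x - m * (f x \<bullet> f x) + (\<Sum>b\<in>Basis. (w x \<bullet> b) \<bullet> sD r b f x))"
      unfolding Lv by (simp add: power2_eq_square algebra_simps)
  qed
  also have "\<dots> = ip (slap r V) (slap r V) - 2 * m * ip (slap r V) V - 4 * ip d d
      + 2 * m * (ip d f - m * ip f f + (\<Sum>b\<in>Basis. ip (\<lambda>x. w x \<bullet> b) (sD r b f)))"
  proof -
    have sf': "smooth_on S f" and sw': "smooth_on S w" unfolding f_def w_def by (rule sf, rule sw)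
    have [simp]: "integrable \<mu> (\<lambda>x. slap r V x \<bullet> slap r V x)" "integrable \<mu> (\<lambda>x. slap r V x \<bullet> V x)"
      "integrable \<mu> (\<lambda>x. d x \<bullet> d x)" "integrable \<mu> (\<lambda>x. d x \<bullet> f x)" "integrable \<mu> (\<lambda>x. f x \<bullet> f x)"
      "integrable \<mu> (\<lambda>x. (w x \<bullet> b) \<bullet> sD r b f x)" for b
      by (intro integrable_smooth smooth_intros sV sd sf' sw')+
    show ?thesis unfolding ip_def
      by (simp del: inner_real_def)
  qed
  \<comment> \<open>The bracket left over from the pointwise comparison is the divergence theorem
    for \<open>w\<close> tested with \<open>f\<close>.\<close>
  also have "ip d f - m * ip f f + (\<Sum>b\<in>Basis. ip (\<lambda>x. w x \<bullet> b) (sD r b f)) = 0"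
    using ip_sdiv[OF sw sf] by (simp add: d_def f_def w_def)
  finally show ?thesis unfolding d_def w_def by (simp only: mult_zero_right add_0_right)
qed

end

end

section \<open>Splitting the gap form into components\<close>

context round_sphere
begin

lemma slap_inner_const: "x \<in> S \<Longrightarrow> smooth_on S F \<Longrightarrow> slap r (\<lambda>x. F x \<bullet> c) x = slap r F x \<bullet> c"
  by (rule slap_compose_linear) (auto intro!: linearI simp: inner_add_left)

lemma ip_components:
  fixes F G :: "'a \<Rightarrow> 'c::euclidean_space"
  assumes "smooth_on S F" "smooth_on S G"
  shows "ip F G = (\<Sum>c\<in>Basis. ip (\<lambda>x. F x \<bullet> c) (\<lambda>x. G x \<bullet> c))"
proof -
  have "ip F G = sint (\<lambda>x. \<Sum>c\<in>Basis. (F x \<bullet> c) \<bullet> (G x \<bullet> c))"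
    unfolding ip_def by (intro sint_cong) (subst euclidean_inner, simp)
  also have "\<dots> = (\<Sum>c\<in>Basis. ip (\<lambda>x. F x \<bullet> c) (\<lambda>x. G x \<bullet> c))"
    unfolding ip_def
    by (intro Bochner_Integration.integral_sum integrable_smooth smooth_intros assms)
  finally show ?thesis .
qed

lemma gap_form_components:
  assumes F: "smooth_on S F"
  shows "gap_form F = (\<Sum>c\<in>Basis. gap_form (\<lambda>x. F x \<bullet> c))"
proof -
  have sc: "ip (\<lambda>x. slap r F x \<bullet> c) (\<lambda>x. G x \<bullet> c) = ip (slap r (\<lambda>x. F x \<bullet> c)) (\<lambda>x. G x \<bullet> c)" for c G
    using F by (intro ip_cong) (simp_all add: slap_inner_const)
  have sc': "ip (slap r (\<lambda>x. F x \<bullet> c)) (\<lambda>x. slap r F x \<bullet> c) = ip (slap r (\<lambda>x. F x \<bullet> c)) (slap r (\<lambda>x. F x \<bullet> c))" for c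
    using F by (intro ip_cong) (simp_all add: slap_inner_const)
  show ?thesis
    unfolding gap_form_def ip_components[OF smooth_on_slap[OF F] smooth_on_slap[OF F]]
      ip_components[OF smooth_on_slap[OF F] F] sc sc' sum_subtractf sum_distrib_left ..
qed

lemma gap_form_nonneg: "smooth_on S F \<Longrightarrow> gap_form F \<ge> 0"
  unfolding gap_form_components
  by (intro sum_nonneg gap_form_nonneg_real smooth_on_inner smooth_on_const)

end

context tropical_map
begin

lemma gap_form_eq: "gap_form F = ip (slap r F) (slap r F) - 2 * m * ip (slap r F) F"
  by (simp only: gap_form_def) (simp only: \<kappa>_eq)

text \<open>The part \<open>N\<close> of the first component orthogonal to the range of
  \<open>L\<close> contributes its own nonnegative gap form and nothing to div w, so it may be
  dropped.\<close>

lemma gap_form_fst: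
  assumes V: "smooth_on S V"
  shows "gap_form (hpart V) \<le> gap_form (\<lambda>x. fst (V x))"
proof -
  define F where "F x = fst (V x)" for x
  define w where "w = hpart V"
  define N where "N x = F x - L (w x)" for x
  have w: "w x = LT (F x)" for x by (simp add: w_def hpart_def F_def)
  have sF: "smooth_on S F" unfolding F_def[abs_def] by (rule smooth_on_compose_linear[OF linear_fst V])
  have sw: "smooth_on S w" unfolding w_def by (rule smooth_hpart[OF V])
  have sLw: "smooth_on S (\<lambda>x. L (w x))" by (rule smooth_on_compose_linear[OF linear_L sw])
  have sN: "smooth_on S N" unfolding N_def[abs_def] by (intro smooth_on_diff sF sLw)
  have slw: "slap r w x = LT (slap r F x)" if "x \<in> S" for x
    unfolding w by (rule slap_compose_linear[OF linear_LT that sF])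
  have slN: "slap r N x = slap r F x - L (slap r w x)" if "x \<in> S" for x
    unfolding N_def[abs_def] slap_diff[OF that sF sLw] slap_compose_linear[OF linear_L that sw] ..
  have split: "(p - L (LT p)) \<bullet> (v - L (LT v)) = p \<bullet> v - LT p \<bullet> LT v" for p v
  proof -
    have "p \<bullet> L (LT v) = LT p \<bullet> LT v" "L (LT p) \<bullet> v = LT p \<bullet> LT v"
      by (rule LT_inner(2)[symmetric], rule LT_inner(1)[symmetric])
    then show ?thesis by (simp add: inner_diff_left inner_diff_right L_inner)
  qed
  have split': "p \<bullet> v = LT p \<bullet> LT v + (p - L (LT p)) \<bullet> (v - L (LT v))" for p v
    using split[of p v] by simp
  have 1: "ip (slap r F) (slap r F) = ip (slap r w) (slap r w) + ip (slap r N) (slap r N)"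
  proof -
    have "ip (slap r F) (slap r F) = sint (\<lambda>x. slap r w x \<bullet> slap r w x + slap r N x \<bullet> slap r N x)"
      unfolding ip_def by (intro sint_cong) (simp add: slN slw split'[symmetric])
    then show ?thesis
      by (simp add: ip_def integrable_smooth smooth_on_inner smooth_on_slap sw sN)
  qed
  have 2: "ip (slap r F) F = ip (slap r w) w + ip (slap r N) N"
  proof -
    have "ip (slap r F) F = sint (\<lambda>x. slap r w x \<bullet> w x + slap r N x \<bullet> N x)"
      unfolding ip_def by (intro sint_cong) (simp add: slN slw N_def w split'[symmetric])
    then show ?thesis
      by (simp add: ip_def integrable_smooth smooth_on_inner smooth_on_slap sw sN)
  qed
  have "gap_form F = gap_form w + gap_form N"
    by (simp add: gap_form_def 1 2 algebra_simps)
  then show ?thesis using gap_form_nonneg[OF sN] by (simp add: F_def[abs_def] w_def)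
qed

lemma gap_form_Pair:
  fixes V :: "'a \<Rightarrow> 'b \<times> real"
  assumes V: "smooth_on S V"
  shows "gap_form V = gap_form (\<lambda>x. fst (V x)) + gap_form (\<lambda>x. snd (V x))"
proof -
  have sF: "smooth_on S (\<lambda>x. fst (V x))" by (rule smooth_on_compose_linear[OF linear_fst V])
  have "(\<Sum>c\<in>Basis. g c) = (\<Sum>b\<in>Basis. g (b, 0)) + g (0, 1)" for g :: "'b \<times> real \<Rightarrow> real"
    unfolding Basis_prod_def by (subst sum.union_disjoint) (auto simp: sum.reindex inj_on_def)
  then show ?thesis
    unfolding gap_form_components[OF V] gap_form_components[OF sF] by (simp add: inner_prod_def)
qed

theorem hessian_form_nonneg:
  assumes V: "section_along V" and mean0: "sint (\<lambda>x. \<eta> x \<bullet> V x) = 0"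
  shows "hessian_form r \<phi> V V \<ge> 0"
proof -
  note sV = section_alongD(1)[OF V]
  define w where "w = hpart V"
  have sw: "smooth_on S w" unfolding w_def by (rule smooth_hpart[OF sV])
  note sf = smooth_srad[OF sw]
  have "sint (srad w) = 0"
    using mean0 sint_cong[of "\<lambda>x. \<eta> x \<bullet> V x" "srad w"] \<eta>_section[OF V] by (simp add: w_def)
  from stability_inequality[OF sw this \<kappa>_eq]
  have "4 * ip (sdiv w) (sdiv w) \<le> (\<Sum>b\<in>Basis. gap_form (\<lambda>x. w x \<bullet> b)) + gap_form (srad w) / 2" .
  also have "(\<Sum>b\<in>Basis. gap_form (\<lambda>x. w x \<bullet> b)) = gap_form w"
    by (rule gap_form_components[OF sw, symmetric])
  also have "gap_form w \<le> gap_form (\<lambda>x. fst (V x))" unfolding w_def by (rule gap_form_fst[OF sV])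
  \<comment> \<open>The last component is \<open>- r\<close> times \<open>srad w\<close>, and
    \<open>r * r = 1 / 2\<close>.\<close>
  also have "gap_form (srad w) / 2 = gap_form (\<lambda>x. snd (V x))"
  proof -
    have sn: "snd (V x) = (- r) *\<^sub>R srad w x" if "x \<in> S" for x
      using section_snd[OF V that] by (simp add: w_def)
    have sls: "slap r (\<lambda>x. snd (V x)) x = (- r) *\<^sub>R slap r (srad w) x" if "x \<in> S" for x
      unfolding slap_cmult[OF that sf, symmetric] by (rule slap_cong[OF that]) (rule sn)
    have "ip (slap r (\<lambda>x. snd (V x))) (slap r (\<lambda>x. snd (V x)))
        = ip (\<lambda>x. (- r) *\<^sub>R slap r (srad w) x) (\<lambda>x. (- r) *\<^sub>R slap r (srad w) x)"
      by (intro ip_cong sls)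
    also have "\<dots> = (r * r) * ip (slap r (srad w)) (slap r (srad w))"
      unfolding ip_scaleR_left ip_scaleR_right by simp
    finally have 1: "ip (slap r (\<lambda>x. snd (V x))) (slap r (\<lambda>x. snd (V x)))
        = ip (slap r (srad w)) (slap r (srad w)) / 2" by (simp add: r_sq)
    have "ip (slap r (\<lambda>x. snd (V x))) (\<lambda>x. snd (V x))
        = ip (\<lambda>x. (- r) *\<^sub>R slap r (srad w) x) (\<lambda>x. (- r) *\<^sub>R srad w x)"
      by (intro ip_cong sls sn)
    also have "\<dots> = (r * r) * ip (slap r (srad w)) (srad w)"
      unfolding ip_scaleR_left ip_scaleR_right by simp
    finally have 2: "ip (slap r (\<lambda>x. snd (V x))) (\<lambda>x. snd (V x)) = ip (slap r (srad w)) (srad w) / 2"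
      by (simp add: r_sq)
    show ?thesis unfolding gap_form_eq 1 2 by (simp add: diff_divide_distrib)
  qed
  also have "gap_form (\<lambda>x. fst (V x)) + gap_form (\<lambda>x. snd (V x)) = gap_form V"
    by (rule gap_form_Pair[OF sV, symmetric])
  finally have "4 * ip (sdiv w) (sdiv w) \<le> gap_form V" by simp
  then show ?thesis
    using hessian_form_eq[OF V] by (simp add: gap_form_eq w_def del: o_apply)
qed

lemma section_along_normal:
  assumes "\<And>x. x \<in> S \<Longrightarrow> V x = c *\<^sub>R \<eta> x"
  shows "section_along V"
proof (rule section_along_cong)
  show "section_along (\<lambda>x. c *\<^sub>R \<eta> x)"
    unfolding section_along_def using \<phi>_\<eta> smooth_\<eta> by (auto intro!: smooth_intros simp del: o_apply)
qed (simp add: assms)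

text \<open>The components of \<open>\<eta>\<close> are affine, so the two Laplacian terms cancel.
  What remains is -4 times the squared norm of div w, where w is c times the position vector, of
  divergence \<open>c * m\<close>.\<close>

lemma hessian_form_normal:
  assumes V: "\<And>x. x \<in> S \<Longrightarrow> V x = c *\<^sub>R \<eta> x"
  shows "hessian_form r \<phi> V V = - 4 * (c * m)\<^sup>2 * measure \<mu> S"
proof -
  have sl: "slap r V x = c *\<^sub>R ((2 * m) *\<^sub>R L x, 0)" if x: "x \<in> S" for x
  proof -
    have "slap r V x = slap r (\<lambda>x. c *\<^sub>R \<eta> x) x" by (rule slap_cong[OF x V])
    also have "\<dots> = c *\<^sub>R slap r \<eta> x" by (rule slap_cmult[OF x smooth_\<eta>])
    also have "slap r \<eta> x = ((2 * m) *\<^sub>R L x, 0)" unfolding \<eta>_eq slap_affine[OF x] by (simp add: \<kappa>_eq)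
    finally show ?thesis .
  qed
  have "ip (slap r V) (slap r V) = sint (\<lambda>x. c\<^sup>2 * (2 * m\<^sup>2))"
    unfolding ip_def by (rule sint_cong) (simp add: sl L_inner S_inner2 power2_eq_square)
  moreover have "ip (slap r V) V = sint (\<lambda>x. c\<^sup>2 * m)"
    unfolding ip_def by (rule sint_cong) (simp add: sl V \<eta>_def L_inner S_inner2 power2_eq_square)
  moreover have "ip (sdiv (hpart V)) (sdiv (hpart V)) = sint (\<lambda>x. (c * m)\<^sup>2)"
  proof -
    have "sdiv (hpart V) x = c * m" if x: "x \<in> S" for x
    proof -
      have "sdiv (hpart V) x = (\<Sum>b\<in>Basis. sD r b (\<lambda>y. c *\<^sub>R (y \<bullet> b)) x)"
        unfolding sdiv_def
        by (intro sum.cong refl sD_cong x)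
          (simp add: hpart_def V \<eta>_def linear_scale[OF linear_LT] LT_L)
      also have "\<dots> = (\<Sum>b\<in>Basis. c * (1 - \<kappa> * ((x \<bullet> b) * (x \<bullet> b))))"
        by (intro sum.cong refl) (simp only: sD_cmult[OF x smooth_on_coord] sD_coord[OF x], simp)
      also have "\<dots> = c * m"
        using S_inner'[OF x] by (simp add: sum_subtractf m_def euclidean_inner[of x x] flip: sum_distrib_left)
      finally show ?thesis .
    qed
    then show ?thesis
      unfolding ip_def by (intro sint_cong) (simp add: power2_eq_square)
  qed
  ultimately show ?thesis
    using hessian_form_eq[OF section_along_normal[of V c, OF V]]
    by (simp add: power_mult_distrib del: o_apply) (simp add: power2_eq_square)
qed


subsection \<open>The index\<close>

lemma sections_iff: "V \<in> sections r \<phi> \<longleftrightarrow> section_along V \<and> (\<forall>x. x \<notin> S \<longrightarrow> V x = 0)"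
  unfolding sections_def section_along_def tangent_def S_def[symmetric] by simp

theorem index_\<phi>: "index r \<phi> = 1"
proof -
  define negative where "negative W \<longleftrightarrow>
     subspace W \<and> (\<exists>B. finite B \<and> W = span B) \<and> W \<subseteq> sections r \<phi> \<and>
     (\<forall>V\<in>W. V \<noteq> 0 \<longrightarrow> hessian_form r \<phi> V V < 0)" for W
  define \<N> where "\<N> = {enat (dim W) | W. negative W}"
  have le: "n \<le> 1" if n: "n \<in> \<N>" for n
  proof (rule ccontr)
    obtain W where W0: "n = enat (dim W)" "negative W"
      using n by (auto simp: \<N>_def)
    then have W: "n = enat (dim W)" "subspace W" "W \<subseteq> sections r \<phi>"
      and neg: "\<And>V. V \<in> W \<Longrightarrow> V \<noteq> 0 \<Longrightarrow> hessian_form r \<phi> V V < 0"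
      by (simp_all add: negative_def)
    assume "\<not> n \<le> 1"
    then have d: "dim W \<ge> 2" using W(1) by (simp add: one_enat_def)
    obtain C where C: "C \<subseteq> W" "independent C" "card C = dim W"
      by (rule real_vector.basis_exists[of W]) blast
    have "C \<noteq> {}" using C(3) d by auto
    then obtain u where u: "u \<in> C" by blast
    have "C \<noteq> {u}" using C(3) d by auto
    then obtain v where v: "v \<in> C" "v \<noteq> u" using u by blast
    have "u \<noteq> 0" using C(2) u dependent_zero by blast
    have nsp: "v \<noteq> k *\<^sub>R u" for k
    proof
      assume "v = k *\<^sub>R u"
      then have "v \<in> span (C - {v})" using u v(2) by (simp add: span_scale span_base)
      then show False using C(2) v(1) by (auto simp: dependent_def)
    qed
    define mean where "mean V = sint (\<lambda>x. \<eta> x \<bullet> V x)" for V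
    have sec: "section_along V" if "V \<in> W" for V using W(3) that sections_iff by blast
    have nz: "V = 0" if V: "V \<in> W" "mean V = 0" for V
      using hessian_form_nonneg[OF sec[OF V(1)]] V(2) neg[OF V(1)] unfolding mean_def by force
    have uW: "u \<in> W" and vW: "v \<in> W" using u v C(1) by auto
    have "mean u \<noteq> 0" using nz[OF uW] \<open>u \<noteq> 0\<close> by blast
    \<comment> \<open>\<open>mean\<close> is linear on \<open>W\<close> with trivial kernel there;
      \<open>v - k *\<^sub>R u\<close> lies in the kernel, contradicting independence.\<close>
    define k where "k = mean v / mean u"
    have "mean (v - k *\<^sub>R u) = mean v - k * mean u"
    proof -
      have "integrable \<mu> (\<lambda>x. \<eta> x \<bullet> u x)" "integrable \<mu> (\<lambda>x. \<eta> x \<bullet> v x)"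
        by (intro integrable_smooth smooth_intros smooth_\<eta> section_alongD(1)[OF sec[OF uW]]
            section_alongD(1)[OF sec[OF vW]])+
      then show ?thesis by (simp add: mean_def scaleR_fun_def inner_diff_right)
    qed
    then have "mean (v - k *\<^sub>R u) = 0" using \<open>mean u \<noteq> 0\<close> by (simp add: k_def)
    moreover have "v - k *\<^sub>R u \<in> W" using uW vW W(2) by (simp add: subspace_diff subspace_scale)
    ultimately have "v - k *\<^sub>R u = 0" by (intro nz)
    then show False using nsp[of k] by simp
  qed
  have mem: "1 \<in> \<N>"
  proof -
    \<comment> \<open>Cut off because elements of \<open>sections\<close> vanish off the
      sphere.\<close>
    define N where "N x = (if x \<in> S then \<eta> x else 0)" for x
    have kN: "(k *\<^sub>R N) x = k *\<^sub>R \<eta> x" if "x \<in> S" for k x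
      using that by (simp add: N_def scaleR_fun_def)
    have secN: "k *\<^sub>R N \<in> sections r \<phi>" for k
      unfolding sections_iff using section_along_normal[of "k *\<^sub>R N" k] kN
      by (simp add: N_def scaleR_fun_def)
    have negN: "hessian_form r \<phi> (k *\<^sub>R N) (k *\<^sub>R N) < 0" if "k \<noteq> 0" for k
    proof -
      have "hessian_form r \<phi> (k *\<^sub>R N) (k *\<^sub>R N) = - 4 * (k * m)\<^sup>2 * measure \<mu> S"
        by (rule hessian_form_normal) (rule kN)
      also have "\<dots> < 0" using measure_\<mu>_pos that m_ge by simp
      finally show ?thesis .
    qed
    have "N \<noteq> 0"
    proof
      assume "N = 0"
      then have "hessian_form r \<phi> (1 *\<^sub>R N) (1 *\<^sub>R N) = 0"
        by (simp add: hessian_form_def del: o_apply)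
      then show False using negN[of 1] by simp
    qed
    then have "dim (span {N}) = 1" by (simp add: dim_eq_card_independent)
    moreover have "enat (dim (span {N})) \<in> \<N>"
      unfolding \<N>_def mem_Collect_eq negative_def
    proof (intro exI conjI ballI impI)
      show "span {N} \<subseteq> sections r \<phi>" using secN by (auto simp: span_singleton)
      fix V assume "V \<in> span {N}" "V \<noteq> 0"
      then obtain k where "V = k *\<^sub>R N" "k \<noteq> 0" by (auto simp: span_singleton)
      then show "hessian_form r \<phi> V V < 0" using negN by simp
    qed (auto simp: subspace_span)
    ultimately show ?thesis by (simp add: one_enat_def)
  qed
  have "Sup \<N> = 1"
    by (rule antisym[OF Sup_least[OF le] Sup_upper[OF mem]])
  then show ?thesis unfolding index_def \<N>_def negative_def .
qed

lemma not_harmonic_\<phi>: "\<not> harmonic r \<phi>"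
proof
  assume "harmonic r \<phi>"
  moreover obtain b :: 'a where "b \<in> Basis" using nonempty_Basis by blast
  then have "r *\<^sub>R b \<in> S" using r_pos by (simp add: S_def)
  ultimately have "tension r \<phi> (r *\<^sub>R b) = 0" "\<eta> (r *\<^sub>R b) \<bullet> \<eta> (r *\<^sub>R b) = 1"
    using \<eta>_\<eta> unfolding harmonic_def S_def by auto
  then show False
    using tension_\<phi>[OF \<open>r *\<^sub>R b \<in> S\<close>] m_ge by auto
qed

end


subsection \<open>Biharmonicity\<close>

lemma Ck_on_slice:
  fixes G :: "'t::euclidean_space \<times> 'a::euclidean_space \<Rightarrow> 'c::euclidean_space"
  assumes "open U" "Ck_on k G U"
  shows "Ck_on k (\<lambda>x. G (t, x)) {x. (t, x) \<in> U}"
  using assms(2)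
proof (induction k arbitrary: G)
  case 0
  then have "continuous_on U G" by simp
  have "continuous_on {x. (t, x) \<in> U} (\<lambda>x. G (t, x))"
    by (rule continuous_on_compose2[OF \<open>continuous_on U G\<close>]) (auto intro!: continuous_intros)
  then show ?case by simp
next
  case (Suc k)
  have "open ((\<lambda>x. (t, x)) -` U)"
    by (rule open_vimage[OF assms(1)]) (intro continuous_intros)
  then have o: "open {x. (t, x) \<in> U}" by (simp add: vimage_def)
  show ?case
  proof (rule Ck_on_SucI'[OF o])
    fix x assume "x \<in> {x. (t, x) \<in> U}"
    then have "(G has_derivative frechet_derivative G (at (t, x))) (at (t, x))"
      using Ck_on_SucD(1)[OF Suc.prems] by simp
    moreover have "((\<lambda>x. (t, x)) has_derivative (\<lambda>v. (0, v))) (at x)"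
      by (auto intro!: derivative_eq_intros)
    ultimately show "((\<lambda>x. G (t, x)) has_derivative (\<lambda>v. frechet_derivative G (at (t, x)) (0, v))) (at x)"
      by (rule has_derivative_compose[rotated])
  next
    show "Ck_on k (\<lambda>x. frechet_derivative G (at (t, x)) (0, v)) {x. (t, x) \<in> U}" for v
      by (rule Suc.IH[OF Ck_on_SucD(2)[OF Suc.prems]])
  qed
qed

text \<open>Compactness bounds the time derivative uniformly, giving estimates of order
  \<open>t\<close> for the variation and for its Laplacian, uniformly on the sphere.\<close>

lemma Ck_on_Lipschitz_time:
  fixes H :: "real \<times> 'a::euclidean_space \<Rightarrow> 'c::euclidean_space"
  assumes U: "open U" "Ck_on (Suc 0) H U" and K: "compact K" "{-\<delta>..\<delta>} \<times> K \<subseteq> U"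
  obtains C where "C \<ge> 0" "\<And>t x. \<bar>t\<bar> \<le> \<delta> \<Longrightarrow> x \<in> K \<Longrightarrow> norm (H (t, x) - H (0, x)) \<le> C * \<bar>t\<bar>"
proof -
  define F where "F p = frechet_derivative H (at p) (1, 0)" for p
  have "continuous_on U F" using Ck_on_SucD(2)[OF U(2)] by (simp add: F_def[abs_def])
  then have "compact (F ` ({-\<delta>..\<delta>} \<times> K))"
    using K by (intro compact_continuous_image compact_Times) (auto intro: continuous_on_subset)
  then obtain C where C: "C > 0" "\<And>p. p \<in> {-\<delta>..\<delta>} \<times> K \<Longrightarrow> norm (F p) \<le> C"
    using compact_imp_bounded[of "F ` ({-\<delta>..\<delta>} \<times> K)"] by (auto simp: bounded_pos)
  have "norm (H (t, x) - H (0, x)) \<le> C * \<bar>t\<bar>" if t: "\<bar>t\<bar> \<le> \<delta>" and x: "x \<in> K" for t x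
  proof -
    have "norm (H (t, x) - H (0, x)) \<le> C * norm (t - 0)"
    proof (rule differentiable_bound[of "{-\<delta>..\<delta>}" "\<lambda>t. H (t, x)" "\<lambda>t s. frechet_derivative H (at (t, x)) (s, 0)"])
      fix s assume s: "s \<in> {-\<delta>..\<delta>}"
      then have D: "(H has_derivative frechet_derivative H (at (s, x))) (at (s, x))"
        using Ck_on_SucD(1)[OF U(2)] K(2) x by blast
      have "((\<lambda>t. (t, x)) has_derivative (\<lambda>v. (v, 0))) (at s)"
        by (auto intro!: derivative_eq_intros)
      from has_derivative_compose[OF this D]
      show "((\<lambda>t. H (t, x)) has_derivative (\<lambda>v. frechet_derivative H (at (s, x)) (v, 0))) (at s within {-\<delta>..\<delta>})"
        by (rule has_derivative_at_withinI)
      show "onorm (\<lambda>v. frechet_derivative H (at (s, x)) (v, 0)) \<le> C"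
      proof (rule onorm_le)
        fix v :: real
        have "frechet_derivative H (at (s, x)) (v *\<^sub>R (1, 0)) = v *\<^sub>R F (s, x)"
          unfolding F_def by (rule linear_scale[OF has_derivative_linear[OF D]])
        then have "norm (frechet_derivative H (at (s, x)) (v, 0)) = \<bar>v\<bar> * norm (F (s, x))" by simp
        also have "\<dots> \<le> \<bar>v\<bar> * C" using C(2)[of "(s, x)"] s x by (intro mult_left_mono) auto
        finally show "norm (frechet_derivative H (at (s, x)) (v, 0)) \<le> C * norm v" by (simp add: mult.commute)
      qed
    qed (use t in auto)
    then show ?thesis by simp
  qed
  then show ?thesis using C(1) that[of C] by simp
qed

lemma has_real_derivative_zeroI:
  fixes E :: "real \<Rightarrow> real"
  assumes "\<delta> > 0" "\<And>t. \<bar>t\<bar> \<le> \<delta> \<Longrightarrow> \<bar>E t - E 0\<bar> \<le> M * t\<^sup>2"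
  shows "(E has_real_derivative 0) (at 0)"
  unfolding has_field_derivative_iff
proof (rule Lim_null_comparison)
  show "\<forall>\<^sub>F t in at 0. norm ((E t - E 0) / (t - 0)) \<le> M * \<bar>t\<bar>"
    unfolding eventually_at
  proof (intro exI[of _ \<delta>] conjI ballI impI assms(1))
    fix t :: real assume t: "t \<noteq> 0 \<and> dist t 0 < \<delta>"
    then have "\<bar>E t - E 0\<bar> \<le> (M * \<bar>t\<bar>) * \<bar>t\<bar>" using assms(2)[of t] by (simp add: power2_eq_square mult.assoc)
    then show "norm ((E t - E 0) / (t - 0)) \<le> M * \<bar>t\<bar>" using t by (simp add: divide_le_eq)
  qed
  show "((\<lambda>t. M * \<bar>t\<bar>) \<longlongrightarrow> 0) (at 0)"
    by (auto intro!: tendsto_eq_intros)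
qed

context round_sphere
begin

text \<open>The derivative \<open>sD r b\<close> in the space variable, for functions on an open subset of space-time.\<close>

definition jD :: "'a \<Rightarrow> (real \<times> 'a \<Rightarrow> 'c::euclidean_space) \<Rightarrow> real \<times> 'a \<Rightarrow> 'c" where
  "jD b G p = frechet_derivative G (at p) (0, b - (\<kappa> * (snd p \<bullet> b)) *\<^sub>R snd p)"

lemma Ck_on_jD:
  assumes U: "open U" and G: "\<forall>k. Ck_on k G U"
  shows "\<forall>k. Ck_on k (jD b G) U"
proof -
  have "Ck_on k (\<lambda>p. (0, b) + (snd p \<bullet> (- \<kappa> *\<^sub>R b)) *\<^sub>R (0::real, snd p)) U" for k
  proof (intro Ck_on_add[OF U] Ck_on_const Ck_on_bounded_bilinear[OF bounded_bilinear_scaleR U] Ck_on_linear)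
    show "bounded_linear (\<lambda>p::real \<times> 'a. snd p \<bullet> (- \<kappa> *\<^sub>R b))"
      by (rule bounded_linear_inner_left_comp[OF bounded_linear_snd])
    show "bounded_linear (\<lambda>p::real \<times> 'a. (0::real, snd p))"
      by (intro bounded_linear_Pair bounded_linear_zero bounded_linear_snd)
  qed
  moreover have "(0, b) + (snd p \<bullet> (- \<kappa> *\<^sub>R b)) *\<^sub>R (0::real, snd p) = (0, b - (\<kappa> * (snd p \<bullet> b)) *\<^sub>R snd p)" for p :: "real \<times> 'a"
    by simp
  ultimately have "\<forall>k. Ck_on k (\<lambda>p::real \<times> 'a. (0::real, b - (\<kappa> * (snd p \<bullet> b)) *\<^sub>R snd p)) U" by simp
  then show ?thesis unfolding jD_def[abs_def] using Ck_on_frechet_derivative[OF U G] by blast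
qed

lemma sD_eq_jD:
  assumes G: "Ck_on (Suc 0) G U" and tx: "(t, x) \<in> U" and x: "x \<in> S"
    and f: "\<And>y. y \<in> S \<Longrightarrow> f y = G (t, y)"
  shows "sD r b f x = jD b G (t, x)"
proof -
  have "((\<lambda>y. (t, y)) has_derivative (\<lambda>v. (0, v))) (at x)"
    by (auto intro!: derivative_eq_intros)
  from sD_eq[OF x has_derivative_compose[OF this Ck_on_SucD(1)[OF G tx]] f, of b] show ?thesis by (simp add: jD_def tproj_S[OF x])
qed

text \<open>This presents the Laplacian of a variation as the restriction of one smooth space-time
  function, to which the Lipschitz bound in time applies.\<close>

lemma slap_eq_jD:
  assumes U: "open U" and G: "\<forall>k. Ck_on k G U" and tS: "\<And>y. y \<in> S \<Longrightarrow> (t, y) \<in> U" and x: "x \<in> S"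
    and f: "\<And>y. y \<in> S \<Longrightarrow> f y = G (t, y)"
  shows "slap r f x = - (\<Sum>b\<in>Basis. jD b (jD b G) (t, x))"
proof -
  have "sD r b (sD r b f) x = jD b (jD b G) (t, x)" for b
    using Ck_on_jD[OF U G, of b] G tS x f
    by (intro sD_eq_jD[of _ U] sD_eq_jD[of G U]) auto
  then show ?thesis by (simp add: slap_def)
qed

end

context tropical_map
begin

lemma sphere_map_\<phi>: "sphere_map r \<phi>"
proof -
  have "norm (\<phi> x) = 1" if "x \<in> S" for x
    using \<phi>_\<phi>[OF that] by (simp add: norm_eq_sqrt_inner del: o_apply)
  then show ?thesis using smooth_\<phi> unfolding sphere_map_def S_def by auto
qed

text \<open>The bienergy agrees with its value at \<open>\<phi>\<close> up to second order, because the first-order part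
  of its integrand integrates to zero by self-adjointness of the Laplacian.\<close>

theorem biharmonic_\<phi>: "biharmonic r \<phi>"
  unfolding biharmonic_def
proof (intro conjI allI impI sphere_map_\<phi>, elim conjE)
  fix \<epsilon> :: real and \<Phi> :: "real \<Rightarrow> 'a \<Rightarrow> 'b \<times> real"
  assume \<epsilon>: "0 < \<epsilon>" and sm: "smooth_on ({-\<epsilon><..<\<epsilon>} \<times> sphere 0 r) (\<lambda>(t, x). \<Phi> t x)"
    and sph: "\<forall>t\<in>{-\<epsilon><..<\<epsilon>}. \<Phi> t ` sphere 0 r \<subseteq> sphere 0 1"
    and \<Phi>0: "\<forall>x\<in>sphere 0 r. \<Phi> 0 x = \<phi> x"
  obtain U G where U: "open U" "{-\<epsilon><..<\<epsilon>} \<times> S \<subseteq> U" and G: "\<forall>k. Ck_on k G U"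
    and GP: "\<forall>p\<in>{-\<epsilon><..<\<epsilon>} \<times> S. G p = (\<lambda>(t, x). \<Phi> t x) p"
    using sm unfolding smooth_on_def S_def[symmetric] by blast
  \<comment> \<open>Halving puts a compact time interval inside the open one.\<close>
  define \<delta> where "\<delta> = \<epsilon> / 2"
  have \<delta>: "\<delta> > 0" and \<delta>\<epsilon>: "\<bar>t\<bar> \<le> \<delta> \<Longrightarrow> t \<in> {-\<epsilon><..<\<epsilon>}" for t using \<epsilon> by (auto simp: \<delta>_def)
  have tU: "(t, x) \<in> U" if "\<bar>t\<bar> \<le> \<delta>" "x \<in> S" for t x using U(2) \<delta>\<epsilon>[OF that(1)] that(2) by blast
  have \<Phi>G: "\<Phi> t x = G (t, x)" if "\<bar>t\<bar> \<le> \<delta>" "x \<in> S" for t x using GP \<delta>\<epsilon>[OF that(1)] that(2) by auto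
  have s\<Phi>: "smooth_on S (\<Phi> t)" if t: "\<bar>t\<bar> \<le> \<delta>" for t
  proof -
    have "open ((\<lambda>x. (t, x)) -` U)" by (rule open_vimage[OF U(1)]) (intro continuous_intros)
    then have "open {x. (t, x) \<in> U}" by (simp add: vimage_def)
    then show ?thesis
      unfolding smooth_on_def using Ck_on_slice[OF U(1)] G tU[OF t] \<Phi>G[OF t]
      by (intro exI[of _ "{x. (t, x) \<in> U}"] exI[of _ "\<lambda>x. G (t, x)"]) auto
  qed
  have \<Phi>1: "\<Phi> t x \<bullet> \<Phi> t x = 1" if "\<bar>t\<bar> \<le> \<delta>" "x \<in> S" for t x
  proof -
    have "\<Phi> t x \<in> sphere 0 1" using sph \<delta>\<epsilon>[OF that(1)] that(2) unfolding S_def by blast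
    then have "norm (\<Phi> t x) = 1" by simp
    then show ?thesis by (simp add: norm_eq_1)
  qed
  define h where "h t x = slap r (\<Phi> t) x \<bullet> slap r (\<Phi> t) x - (\<Phi> t x \<bullet> slap r (\<Phi> t) x)\<^sup>2" for t x
  have sh: "smooth_on S (h t)" if "\<bar>t\<bar> \<le> \<delta>" for t
    unfolding h_def[abs_def] power2_eq_square by (intro smooth_intros s\<Phi> that)
  have E: "bienergy r (\<Phi> t) = sint (h t) / 2" if t: "\<bar>t\<bar> \<le> \<delta>" for t
  proof -
    interpret t: sphere_valued S r \<kappa> m "\<Phi> t"
      by unfold_locales (rule s\<Phi>[OF t], rule \<Phi>1[OF t])
    have "sint (\<lambda>x. (norm (tension r (\<Phi> t) x))\<^sup>2) = sint (h t)"
      unfolding h_def by (intro sint_cong t.norm_tension)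
    then show ?thesis by (simp add: bienergy_def)
  qed
  define a where "a = slap r \<phi>"
  have sa: "smooth_on S a" unfolding a_def by (intro smooth_intros smooth_\<phi>)
  have ax: "a x = (2 * m) *\<^sub>R (L x, 0)" if "x \<in> S" for x using slap_\<phi>[OF that] by (simp add: a_def)
  have sla: "slap r a x = (2 * m) *\<^sub>R a x" if x: "x \<in> S" for x
  proof -
    have "slap r a x = slap r (\<lambda>x. (2 * m) *\<^sub>R (L x, 0)) x" by (rule slap_cong[OF x ax])
    also have "\<dots> = (2 * m) *\<^sub>R slap r (\<lambda>x. (L x, 0)) x" by (rule slap_cmult[OF x smooth_affine])
    also have "slap r (\<lambda>x. (L x, 0)) x = a x" using slap_affine[OF x, of 0] ax[OF x] by (simp add: \<kappa>_eq)
    finally show ?thesis .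
  qed
  have aa: "a x \<bullet> a x = 2 * m\<^sup>2" and \<phi>a: "\<phi> x \<bullet> a x = m" if "x \<in> S" for x
    using that by (simp_all add: ax \<phi>_apply L_inner S_inner2 power2_eq_square del: o_apply)
  have na: "norm (a x) \<le> 2 * m" if "x \<in> S" for x
  proof -
    have "(norm (a x))\<^sup>2 \<le> (2 * m)\<^sup>2" using aa[OF that] by (simp add: power2_norm_eq_inner power_mult_distrib)
    then show ?thesis by (rule power2_le_imp_le) (use m_ge in simp)
  qed
  have n\<phi>: "norm (\<phi> x) = 1" if "x \<in> S" for x using \<phi>_\<phi>[OF that] by (simp add: norm_eq_1)
  have \<Phi>0': "\<Phi> 0 x = \<phi> x" if "x \<in> S" for x using \<Phi>0 that unfolding S_def by blast
  have sl0: "slap r (\<Phi> 0) x = a x" if "x \<in> S" for x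
    unfolding a_def by (rule slap_cong[OF that \<Phi>0'])
  define H where "H p = - (\<Sum>b\<in>Basis. jD b (jD b G) p)" for p
  have H: "slap r (\<Phi> t) x = H (t, x)" if "\<bar>t\<bar> \<le> \<delta>" "x \<in> S" for t x
    unfolding H_def using that by (intro slap_eq_jD[OF U(1) G] tU \<Phi>G)
  have CkH: "Ck_on (Suc 0) H U"
  proof -
    have "Ck_on (Suc 0) (\<lambda>p. \<Sum>b\<in>B. jD b (jD b G) p) U" if "finite B" for B
      using that
    proof induction
      case (insert b B)
      then show ?case
        using Ck_on_jD[OF U(1) Ck_on_jD[OF U(1) G], of b b] by (simp add: Ck_on_add[OF U(1)] del: Ck_on.simps)
    qed (simp add: Ck_on_const del: Ck_on.simps)
    from Ck_on_bounded_linear[OF bounded_linear_minus[OF bounded_linear_ident] U(1) this[OF finite_Basis]]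
    show ?thesis unfolding H_def[abs_def] .
  qed
  have sub: "{-\<delta>..\<delta>} \<times> S \<subseteq> U" using tU by auto
  obtain C1 where C1: "C1 \<ge> 0" "\<And>t x. \<bar>t\<bar> \<le> \<delta> \<Longrightarrow> x \<in> S \<Longrightarrow> norm (G (t, x) - G (0, x)) \<le> C1 * \<bar>t\<bar>"
    using Ck_on_Lipschitz_time[OF U(1) G[rule_format] compact_S sub] by blast
  obtain C2 where C2: "C2 \<ge> 0" "\<And>t x. \<bar>t\<bar> \<le> \<delta> \<Longrightarrow> x \<in> S \<Longrightarrow> norm (H (t, x) - H (0, x)) \<le> C2 * \<bar>t\<bar>"
    using Ck_on_Lipschitz_time[OF U(1) CkH compact_S sub] by blast
  \<comment> \<open>One summand for each term of the remainder \<open>R\<close> below;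
    \<open>\<delta>\<close> absorbs one factor of |t| from the quadratic term inside the last
    square.\<close>
  define M where "M = C2\<^sup>2 + 2 * m * (C1 * C2) + (C2 + 2 * m * C1 + C1 * C2 * \<delta>)\<^sup>2"
  have "\<bar>bienergy r (\<Phi> t) - bienergy r (\<Phi> 0)\<bar> \<le> (M * measure \<mu> S / 2) * t\<^sup>2" if t: "\<bar>t\<bar> \<le> \<delta>" for t
  proof -
    have 0: "\<bar>0::real\<bar> \<le> \<delta>" using \<delta> by simp
    define P where "P x = \<Phi> t x - \<phi> x" for x
    define q where "q = slap r P"
    have sP: "smooth_on S P" unfolding P_def[abs_def] by (intro smooth_intros s\<Phi>[OF t] smooth_\<phi>)
    have sq: "smooth_on S q" unfolding q_def by (intro smooth_intros sP)
    have qx: "q x = slap r (\<Phi> t) x - a x" if "x \<in> S" for x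
      unfolding q_def P_def[abs_def] a_def by (rule slap_diff[OF that s\<Phi>[OF t] smooth_\<phi>])
    have nP: "norm (P x) \<le> C1 * \<bar>t\<bar>" if "x \<in> S" for x
      using C1(2)[OF t that] \<Phi>G[OF t that] \<Phi>G[OF 0 that] \<Phi>0'[OF that] by (simp add: P_def del: o_apply)
    have nq: "norm (q x) \<le> C2 * \<bar>t\<bar>" if "x \<in> S" for x
      using C2(2)[OF t that] H[OF t that] H[OF 0 that] sl0[OF that] by (simp add: qx[OF that])
    define R where "R x = q x \<bullet> q x - 2 * m * (P x \<bullet> q x) - (\<phi> x \<bullet> q x + a x \<bullet> P x + P x \<bullet> q x)\<^sup>2" for x
    have sR: "smooth_on S R"
      unfolding R_def[abs_def] power2_eq_square by (intro smooth_intros smooth_\<phi> sa sP sq)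
    have hR: "h t x - h 0 x = (2 * (a x \<bullet> q x) - 2 * m * (\<phi> x \<bullet> q x + a x \<bullet> P x)) + R x" if x: "x \<in> S" for x
    proof -
      have "h 0 x = a x \<bullet> a x - (\<phi> x \<bullet> a x)\<^sup>2" by (simp add: h_def sl0[OF x] \<Phi>0'[OF x] del: o_apply)
      moreover have "h t x = (a x + q x) \<bullet> (a x + q x) - ((\<phi> x + P x) \<bullet> (a x + q x))\<^sup>2"
        by (simp add: h_def qx[OF x] P_def)
      ultimately show ?thesis
        using \<phi>a[OF x] by (simp add: R_def inner_add_left inner_add_right inner_commute[of "q x" "a x"]
            inner_commute[of "P x" "a x"] power2_eq_square algebra_simps del: o_apply)
    qed
    have Rb: "\<bar>R x\<bar> \<le> M * t\<^sup>2" if x: "x \<in> S" for x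
    proof -
      have 1: "\<bar>q x \<bullet> q x\<bar> \<le> C2\<^sup>2 * t\<^sup>2"
        using power_mono[OF nq[OF x], of 2] by (simp add: power2_norm_eq_inner power_mult_distrib)
      have 2: "\<bar>P x \<bullet> q x\<bar> \<le> (C1 * C2) * t\<^sup>2"
      proof -
        have "\<bar>P x \<bullet> q x\<bar> \<le> norm (P x) * norm (q x)" by (rule Cauchy_Schwarz_ineq2)
        also have "\<dots> \<le> (C1 * \<bar>t\<bar>) * (C2 * \<bar>t\<bar>)"
          using nP[OF x] nq[OF x] C1(1) by (intro mult_mono) auto
        finally show ?thesis by (simp add: power2_eq_square mult_ac)
      qed
      have 3: "\<bar>\<phi> x \<bullet> q x\<bar> \<le> C2 * \<bar>t\<bar>"
        using Cauchy_Schwarz_ineq2[of "\<phi> x" "q x"] nq[OF x] n\<phi>[OF x] by (simp del: o_apply)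
      have 4: "\<bar>a x \<bullet> P x\<bar> \<le> (2 * m * C1) * \<bar>t\<bar>"
      proof -
        have "\<bar>a x \<bullet> P x\<bar> \<le> norm (a x) * norm (P x)" by (rule Cauchy_Schwarz_ineq2)
        also have "\<dots> \<le> (2 * m) * (C1 * \<bar>t\<bar>)" using nP[OF x] na[OF x] m_ge by (intro mult_mono) auto
        finally show ?thesis by (simp add: mult.assoc)
      qed
      have 5: "\<bar>P x \<bullet> q x\<bar> \<le> (C1 * C2 * \<delta>) * \<bar>t\<bar>"
      proof -
        have "(C1 * C2) * t\<^sup>2 = (C1 * C2 * \<bar>t\<bar>) * \<bar>t\<bar>" by (simp add: power2_eq_square)
        also have "\<dots> \<le> (C1 * C2 * \<delta>) * \<bar>t\<bar>" using t C1(1) C2(1) by (intro mult_right_mono mult_left_mono) auto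
        finally show ?thesis using 2 by simp
      qed
      have "\<bar>\<phi> x \<bullet> q x + a x \<bullet> P x + P x \<bullet> q x\<bar> \<le> (C2 + 2 * m * C1 + C1 * C2 * \<delta>) * \<bar>t\<bar>"
        unfolding distrib_right using 3 4 5 by linarith
      from power_mono[OF this, of 2]
      have 6: "(\<phi> x \<bullet> q x + a x \<bullet> P x + P x \<bullet> q x)\<^sup>2 \<le> (C2 + 2 * m * C1 + C1 * C2 * \<delta>)\<^sup>2 * t\<^sup>2"
        by (simp add: power_mult_distrib del: o_apply)
      have 7: "\<bar>2 * m * (P x \<bullet> q x)\<bar> \<le> 2 * m * (C1 * C2) * t\<^sup>2"
        using mult_left_mono[OF 2, of "2 * m"] m_ge by (simp add: abs_mult mult.assoc)
      have "\<bar>R x\<bar> \<le> \<bar>q x \<bullet> q x\<bar> + \<bar>2 * m * (P x \<bullet> q x)\<bar> + (\<phi> x \<bullet> q x + a x \<bullet> P x + P x \<bullet> q x)\<^sup>2"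
        unfolding R_def using zero_le_power2[of "\<phi> x \<bullet> q x + a x \<bullet> P x + P x \<bullet> q x"] by linarith
      also have "\<dots> \<le> C2\<^sup>2 * t\<^sup>2 + 2 * m * (C1 * C2) * t\<^sup>2 + (C2 + 2 * m * C1 + C1 * C2 * \<delta>)\<^sup>2 * t\<^sup>2"
        by (intro add_mono 1 6 7)
      finally show ?thesis by (simp add: M_def distrib_right)
    qed
    \<comment> \<open>With \<open>a\<close> the Laplacian of \<open>\<phi>\<close> and \<Delta> a =
      2 m a, everything becomes a multiple of \<open>ip a P\<close>: 4 m - 2 m - 2 m = 0.\<close>
    have lin: "sint (\<lambda>x. 2 * (a x \<bullet> q x) - 2 * m * (\<phi> x \<bullet> q x + a x \<bullet> P x)) = 0"
    proof -
      have i: "integrable \<mu> (\<lambda>x. a x \<bullet> q x)" "integrable \<mu> (\<lambda>x. \<phi> x \<bullet> q x)" "integrable \<mu> (\<lambda>x. a x \<bullet> P x)"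
        by (intro integrable_smooth smooth_intros sa sq smooth_\<phi> sP)+
      then have "sint (\<lambda>x. 2 * (a x \<bullet> q x) - 2 * m * (\<phi> x \<bullet> q x + a x \<bullet> P x))
          = 2 * ip a q - 2 * m * (ip \<phi> q + ip a P)"
        unfolding ip_def by (simp del: o_apply)
      moreover have "ip a q = 2 * m * ip a P"
      proof -
        have "ip a q = ip (slap r a) P" unfolding q_def by (rule ip_slap[OF sa sP, symmetric])
        also have "\<dots> = ip (\<lambda>x. (2 * m) *\<^sub>R a x) P" by (rule ip_cong[OF sla refl])
        finally show ?thesis by (simp only: ip_scaleR_left)
      qed
      moreover have "ip \<phi> q = ip a P"
        unfolding q_def a_def by (rule ip_slap[OF smooth_\<phi> sP, symmetric])
      ultimately show ?thesis by simp
    qed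
    have "sint (h t) - sint (h 0) = sint (\<lambda>x. h t x - h 0 x)"
      by (rule Bochner_Integration.integral_diff[symmetric]) (intro integrable_smooth sh t 0)+
    also have "\<dots> = sint (\<lambda>x. (2 * (a x \<bullet> q x) - 2 * m * (\<phi> x \<bullet> q x + a x \<bullet> P x)) + R x)"
      by (rule sint_cong[OF hR])
    also have "\<dots> = sint R"
    proof -
      have "smooth_on S (\<lambda>x. 2 * (a x \<bullet> q x) - 2 * m * (\<phi> x \<bullet> q x + a x \<bullet> P x))"
        by (intro smooth_intros sa sq smooth_\<phi> sP)
      from Bochner_Integration.integral_add[OF integrable_smooth[OF this] integrable_smooth[OF sR]]
      show ?thesis unfolding lin by simp
    qed
    also have "\<bar>\<dots>\<bar> \<le> sint (\<lambda>x. M * t\<^sup>2)"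
    proof -
      interpret finite_measure \<mu> by (rule finite_\<mu>)
      have "norm (sint R) \<le> sint (\<lambda>x. norm (R x))" by (rule integral_norm_bound)
      also have "\<dots> \<le> sint (\<lambda>x. M * t\<^sup>2)"
        using Rb integrable_smooth[OF sR] by (intro integral_mono) auto
      finally show ?thesis by simp
    qed
    finally show ?thesis unfolding E[OF t] E[OF 0] by (simp add: abs_le_iff field_simps)
  qed
  then show "((\<lambda>t. bienergy r (\<Phi> t)) has_real_derivative 0) (at 0)"
    by (rule has_real_derivative_zeroI[OF \<delta>])
qed

end

lemma tropical_mapI:
  fixes L :: "'a::euclidean_space \<Rightarrow> 'b::euclidean_space"
  assumes "2 \<le> DIM('a)" "linear L" "\<And>x. norm (L x) = norm x"
  shows "tropical_map (sphere 0 (1 / sqrt 2)) (1 / sqrt 2) 2 (real DIM('a) - 1) L"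
  unfolding tropical_map_def round_sphere_def tropical_map_axioms_def
  using assms by (auto simp: power_divide)

theorem proposition5p1:
  fixes m n :: nat and L :: "'a::euclidean_space \<Rightarrow> 'b::euclidean_space"
  assumes "DIM('a) = m + 1" and "DIM('b) = n + 1" and "1 \<le> m" and "m \<le> n"
    and "linear L" and "\<forall>x. norm (L x) = norm x"
  defines "r \<equiv> 1 / sqrt 2"
  shows "biharmonic r (tropical \<circ> L) \<and> \<not> harmonic r (tropical \<circ> L)
         \<and> index r (tropical \<circ> L) = 1
         \<and> index r (tropical :: 'b \<Rightarrow> 'b \<times> real) = 1"
proof -
  interpret L: tropical_map "sphere 0 r" r 2 "real DIM('a) - 1" L
    unfolding r_def using assms by (intro tropical_mapI) auto
  \<comment> \<open>The identity as isometry turns the composition into the tropical inclusion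
    itself.\<close>
  interpret id: tropical_map "sphere 0 r" r 2 "real DIM('b) - 1" "id :: 'b \<Rightarrow> 'b"
    unfolding r_def using assms by (intro tropical_mapI) (auto intro: linear_id)
  show ?thesis
    using L.biharmonic_\<phi> L.not_harmonic_\<phi> L.index_\<phi> id.index_\<phi> by simp
qed

end
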